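(* Do not assume AC. Let $j:M\to N$ be an elementary embedding of inner models $M\subseteq N$ of ZF, and let $b$ be a parameter with $j(b)=b$ such that $M$ is $b$-definable in $N$. Let $A$ be a $b$-definable class (or set) in $N$ satisfying either of the following equivalent conditions: (a) the transitive closure of $A$ has a $b$-definable well-ordering in $N$; (b) $A\subseteq\mathrm{HOD}[b]^N$. Then $A^M=A^N$.
   Context: Work in NGB (no choice); the result is a scheme over the defining formulas of $M$ and $A$. A class $A$ is $b$-definable in a transitive model $N$ if $A=\{x\in N: N\models\varphi(x,b)\}$ for some formula $\varphi$. For another model $P$ containing $b$, $A^P=\{x\in P: P\models\varphi(x,b)\}$ uses the same formula and parameter. $\mathrm{HOD}[b]^N$ is the class of sets hereditarily definable in $N$ from ordinal parameters and $b$. Inner models are transitive proper class models containing all ordinals. An elementary embedding means a $\Delta_0$-elementary cofinal map: every $y\in N$ lies in some $j(x)$. *)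

theory Defs
  imports Main
begin

text \<open>
  The ambient universe is an arbitrary model of NGB without choice: a type \<open>'v\<close> of sets,
  a membership relation \<open>E\<close> on it, and a family \<open>\<C>\<close> of subsets of \<open>'v\<close>, the classes.
  Neither \<open>E\<close> nor the natural numbers of the model are assumed to be standard.
\<close>

type_synonym 'v mem = "'v \<Rightarrow> 'v \<Rightarrow> bool"

definition ext :: "'v mem \<Rightarrow> 'v \<Rightarrow> 'v set" where
  "ext E x = {y. E y x}"

definition transitive :: "'v mem \<Rightarrow> 'v set \<Rightarrow> bool" where
  "transitive E T \<longleftrightarrow> (\<forall>x\<in>T. ext E x \<subseteq> T)"

text \<open>Kuratowski pairs: \<open>p = {{x}, {x, y}}\<close>.\<close>

definition is_opair :: "'v mem \<Rightarrow> 'v \<Rightarrow> 'v \<Rightarrow> 'v \<Rightarrow> bool" where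
  "is_opair E p x y \<longleftrightarrow> (\<forall>z. E z p \<longleftrightarrow> ext E z = {x} \<or> ext E z = {x, y})"

section \<open>Formulas of set theory\<close>

text \<open>Variables are de Bruijn indices: \<open>Forall\<close> binds variable 0 of its body.\<close>

datatype fm = Mem nat nat | Eq nat nat | Neg fm | Conj fm fm | Forall fm

primrec sat :: "'v mem \<Rightarrow> 'v set \<Rightarrow> (nat \<Rightarrow> 'v) \<Rightarrow> fm \<Rightarrow> bool" where
  "sat E D e (Mem i k) \<longleftrightarrow> E (e i) (e k)"
| "sat E D e (Eq i k) \<longleftrightarrow> e i = e k"
| "sat E D e (Neg \<phi>) \<longleftrightarrow> \<not> sat E D e \<phi>"
| "sat E D e (Conj \<phi> \<psi>) \<longleftrightarrow> sat E D e \<phi> \<and> sat E D e \<psi>"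
| "sat E D e (Forall \<phi>) \<longleftrightarrow> (\<forall>x\<in>D. sat E D (case_nat x e) \<phi>)"

text \<open>The bounded quantifier \<open>\<forall>v\<^sub>0 \<in> v\<^sub>i\<close>, where \<open>i\<close> is counted outside the quantifier.\<close>

definition BForall :: "nat \<Rightarrow> fm \<Rightarrow> fm" where
  "BForall i \<phi> = Forall (Neg (Conj (Mem 0 (Suc i)) (Neg \<phi>)))"

inductive delta0 :: "fm \<Rightarrow> bool" where
  "delta0 (Mem i k)"
| "delta0 (Eq i k)"
| "delta0 \<phi> \<Longrightarrow> delta0 (Neg \<phi>)"
| "delta0 \<phi> \<Longrightarrow> delta0 \<psi> \<Longrightarrow> delta0 (Conj \<phi> \<psi>)"
| "delta0 \<phi> \<Longrightarrow> delta0 (BForall i \<phi>)"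

section \<open>The theories ZF and NGB\<close>

text \<open>Extensionality, foundation, pairing, union, power set and infinity, relativized to \<open>D\<close>.\<close>

definition basic_set_axioms :: "'v mem \<Rightarrow> 'v set \<Rightarrow> bool" where
  "basic_set_axioms E D \<longleftrightarrow>
    (\<forall>x\<in>D. \<forall>y\<in>D. (\<forall>z\<in>D. E z x \<longleftrightarrow> E z y) \<longrightarrow> x = y) \<and>
    (\<forall>x\<in>D. (\<exists>y\<in>D. E y x) \<longrightarrow> (\<exists>y\<in>D. E y x \<and> \<not> (\<exists>z\<in>D. E z x \<and> E z y))) \<and>
    (\<forall>x\<in>D. \<forall>y\<in>D. \<exists>p\<in>D. \<forall>z\<in>D. E z p \<longleftrightarrow> z = x \<or> z = y) \<and>
    (\<forall>x\<in>D. \<exists>u\<in>D. \<forall>z\<in>D. E z u \<longleftrightarrow> (\<exists>y\<in>D. E y x \<and> E z y)) \<and>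
    (\<forall>x\<in>D. \<exists>p\<in>D. \<forall>y\<in>D. E y p \<longleftrightarrow> (\<forall>z\<in>D. E z y \<longrightarrow> E z x)) \<and>
    (\<exists>w\<in>D. (\<exists>y\<in>D. E y w \<and> (\<forall>z\<in>D. \<not> E z y)) \<and>
      (\<forall>x\<in>D. E x w \<longrightarrow> (\<exists>y\<in>D. E y w \<and> (\<forall>z\<in>D. E z y \<longleftrightarrow> E z x \<or> z = x))))"

text \<open>The last two conjuncts are the schemes of separation and replacement.\<close>

definition models_ZF :: "'v mem \<Rightarrow> 'v set \<Rightarrow> bool" where
  "models_ZF E D \<longleftrightarrow>
    basic_set_axioms E D \<and>
    (\<forall>\<phi> e. range e \<subseteq> D \<longrightarrow>
      (\<forall>a\<in>D. \<exists>s\<in>D. \<forall>x\<in>D. E x s \<longleftrightarrow> E x a \<and> sat E D (case_nat x e) \<phi>)) \<and>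
    (\<forall>\<phi> e. range e \<subseteq> D \<longrightarrow>
      (\<forall>a\<in>D.
        (\<forall>x\<in>D. E x a \<longrightarrow> (\<forall>y\<in>D. \<forall>z\<in>D.
          sat E D (case_nat x (case_nat y e)) \<phi> \<and> sat E D (case_nat x (case_nat z e)) \<phi>
            \<longrightarrow> y = z)) \<longrightarrow>
        (\<exists>s\<in>D. \<forall>y\<in>D. E y s \<longleftrightarrow>
          (\<exists>x\<in>D. E x a \<and> sat E D (case_nat x (case_nat y e)) \<phi>))))"

text \<open>
  The relations given by formulas that quantify over sets only, with class parameters;
  they are represented as predicates on assignments of sets to the variables.
\<close>

inductive predicative :: "'v mem \<Rightarrow> 'v set set \<Rightarrow> ((nat \<Rightarrow> 'v) \<Rightarrow> bool) \<Rightarrow> bool"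
  for E \<C> where
  "predicative E \<C> (\<lambda>e. E (e i) (e k))"
| "predicative E \<C> (\<lambda>e. e i = e k)"
| "X \<in> \<C> \<Longrightarrow> predicative E \<C> (\<lambda>e. e i \<in> X)"
| "predicative E \<C> P \<Longrightarrow> predicative E \<C> (\<lambda>e. \<not> P e)"
| "predicative E \<C> P \<Longrightarrow> predicative E \<C> Q \<Longrightarrow> predicative E \<C> (\<lambda>e. P e \<and> Q e)"
| "predicative E \<C> P \<Longrightarrow> predicative E \<C> (\<lambda>e. \<forall>x. P (case_nat x e))"

text \<open>
  Beyond the basic axioms for sets: every set is a class, predicative class comprehension,
  foundation for classes, and replacement for class functions.
\<close>

definition NGB :: "'v mem \<Rightarrow> 'v set set \<Rightarrow> bool" where
  "NGB E \<C> \<longleftrightarrow>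
    basic_set_axioms E UNIV \<and>
    (\<forall>x. ext E x \<in> \<C>) \<and>
    (\<forall>P e. predicative E \<C> P \<longrightarrow> {x. P (case_nat x e)} \<in> \<C>) \<and>
    (\<forall>X\<in>\<C>. X \<noteq> {} \<longrightarrow> (\<exists>y\<in>X. ext E y \<inter> X = {})) \<and>
    (\<forall>F\<in>\<C>.
      (\<forall>x y z. (\<exists>p\<in>F. is_opair E p x y) \<and> (\<exists>q\<in>F. is_opair E q x z) \<longrightarrow> y = z) \<longrightarrow>
      (\<forall>a. \<exists>s. \<forall>y. E y s \<longleftrightarrow> (\<exists>x. E x a \<and> (\<exists>p\<in>F. is_opair E p x y))))"

section \<open>Well-orderings, ordinals and inner models\<close>

text \<open>
  Every nonempty subset of \<open>W\<close> that is an element of \<open>D\<close> has an \<open>R\<close>-least element;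
  subsets of \<open>W\<close> in the sense of HOL that are not sets of the model are not considered.
\<close>

definition well_orders :: "'v mem \<Rightarrow> 'v set \<Rightarrow> ('v \<Rightarrow> 'v \<Rightarrow> bool) \<Rightarrow> 'v set \<Rightarrow> bool" where
  "well_orders E D R W \<longleftrightarrow>
    irreflp_on W R \<and> transp_on W R \<and> totalp_on W R \<and>
    (\<forall>u\<in>D. ext E u \<subseteq> W \<and> ext E u \<noteq> {} \<longrightarrow>
      (\<exists>m\<in>ext E u. \<forall>x\<in>ext E u. x = m \<or> R m x))"

definition ordinal :: "'v mem \<Rightarrow> 'v \<Rightarrow> bool" where
  "ordinal E x \<longleftrightarrow> transitive E (ext E x) \<and> well_orders E UNIV E (ext E x)"

definition inner_model :: "'v mem \<Rightarrow> 'v set set \<Rightarrow> 'v set \<Rightarrow> bool" where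
  "inner_model E \<C> M \<longleftrightarrow>
    M \<in> \<C> \<and> (\<nexists>x. M = ext E x) \<and> transitive E M \<and> {\<alpha>. ordinal E \<alpha>} \<subseteq> M \<and> models_ZF E M"

text \<open>
  Only the values of \<open>j\<close> on \<open>M\<close> matter; the first conjunct says that \<open>j\<close> restricted to \<open>M\<close>
  is a class of the universe.
\<close>

definition elementary_embedding ::
  "'v mem \<Rightarrow> 'v set set \<Rightarrow> ('v \<Rightarrow> 'v) \<Rightarrow> 'v set \<Rightarrow> 'v set \<Rightarrow> bool" where
  "elementary_embedding E \<C> j M N \<longleftrightarrow>
    {p. \<exists>x\<in>M. is_opair E p x (j x)} \<in> \<C> \<and>
    j ` M \<subseteq> N \<and>
    (\<forall>\<phi> e. delta0 \<phi> \<longrightarrow> range e \<subseteq> M \<longrightarrow> (sat E M e \<phi> \<longleftrightarrow> sat E N (j \<circ> e) \<phi>)) \<and>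
    (\<forall>y\<in>N. \<exists>x\<in>M. E y (j x))"

section \<open>Definability from a parameter\<close>

text \<open>
  The first variables denote the entries of \<open>xs\<close> and every other variable denotes \<open>b\<close>.  Hence
  the relations \<open>\<lambda>xs. sat E N (asg b xs) \<phi>\<close> are those definable over \<open>N\<close> from the parameter
  \<open>b\<close> alone, without a side condition on the free variables of \<open>\<phi>\<close>.
\<close>

definition asg :: "'v \<Rightarrow> 'v list \<Rightarrow> nat \<Rightarrow> 'v" where
  "asg b xs i = (if i < length xs then xs ! i else b)"

definition definable_class :: "'v mem \<Rightarrow> 'v set \<Rightarrow> 'v \<Rightarrow> fm \<Rightarrow> 'v set" where
  "definable_class E N b \<phi> = {x \<in> N. sat E N (asg b [x]) \<phi>}"

text \<open>
  The intersection is over classes of the universe.  Iterating \<open>E\<close> along the natural numbers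
  of HOL would be wrong when those of the universe are nonstandard.
\<close>

definition trcl :: "'v mem \<Rightarrow> 'v set set \<Rightarrow> 'v set \<Rightarrow> 'v set" where
  "trcl E \<C> A = \<Inter>{T \<in> \<C>. A \<subseteq> T \<and> transitive E T}"

definition OD :: "'v mem \<Rightarrow> 'v set \<Rightarrow> 'v \<Rightarrow> 'v set" where
  "OD E N b = {x \<in> N. \<exists>\<phi> \<alpha>s. set \<alpha>s \<subseteq> {\<alpha> \<in> N. ordinal E \<alpha>} \<and>
    (\<forall>y\<in>N. sat E N (asg b (y # \<alpha>s)) \<phi> \<longleftrightarrow> y = x)}"

definition HOD :: "'v mem \<Rightarrow> 'v set set \<Rightarrow> 'v set \<Rightarrow> 'v \<Rightarrow> 'v set" where
  "HOD E \<C> N b = {x \<in> N. trcl E \<C> {x} \<subseteq> OD E N b}"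

definition trcl_definably_well_ordered ::
  "'v mem \<Rightarrow> 'v set set \<Rightarrow> 'v set \<Rightarrow> 'v \<Rightarrow> 'v set \<Rightarrow> bool" where
  "trcl_definably_well_ordered E \<C> N b A \<longleftrightarrow>
    (\<exists>\<psi>. well_orders E N (\<lambda>x y. sat E N (asg b [x, y]) \<psi>) (trcl E \<C> A))"

end

theory Submission
  imports Defs
begin

text \<open>
  The sets ordinal definable from \<open>b\<close> in \<open>N\<close> have a \<open>b\<close>-definable enumeration by ordinals, which is
  built by recursion: at each index one of finitely many set operations is applied
  to sets enumerated earlier, starting from \<open>{\<xi>}\<close>, \<open>{b}\<close> and \<open>V\<^sub>\<xi>\<close>.  The range contains the
  solution set of every formula on every product of its members, because by collection each
  quantifier can be bounded by some \<open>V\<^sub>\<xi>\<close>; hence the range is exactly \<open>OD\<close>.  Well-ordering by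
  least names gives the implication from (b) to (a).  Conversely, if the transitive closure of \<open>A\<close>
  is definably well-ordered, then its least element in some \<open>V\<^sub>\<zeta>\<close> that is not enumerated would be
  definable from \<open>\<zeta>\<close>.

  Every ordinal \<open>\<delta>\<close> which is \<open>b\<close>-definable in \<open>N\<close> is fixed by \<open>j\<close>.
  Let \<open>M\<^sub>0 = N\<close> and \<open>M\<^sub>n\<^sub>+\<^sub>1 = M\<^bsup>M\<^sub>n\<^esup>\<close>, and let \<open>\<delta>\<^sub>n\<close> be the ordinal defined in \<open>M\<^sub>n\<close> by the formula for
  \<open>\<delta>\<close>.  Then \<open>\<delta>\<^sub>n\<^sub>+\<^sub>1 \<le> j(\<delta>\<^sub>n\<^sub>+\<^sub>1) = \<delta>\<^sub>n\<close>, so the sequence is eventually constant and all \<open>\<delta>\<^sub>n\<close> agree.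
  The index \<open>n\<close> has to range over the natural numbers of the universe, which may be nonstandard,
  and iterating the defining formula of \<open>M\<close> is then not possible.  But \<open>M\<^sub>n\<close> is also the domain of
  the \<open>n\<close>-th iterate of \<open>j\<close>, which is a class uniformly in \<open>n\<close>; a Gaifman-style argument shows by
  induction on \<open>n\<close> that \<open>j\<close> is elementary from \<open>M\<^sub>n\<^sub>+\<^sub>1\<close> to \<open>M\<^sub>n\<close>.

  Finally, suppose that the enumerations \<open>F\<^sup>M\<close> and \<open>F\<^sup>N\<close> differ at a name of a member of \<open>HOD\<close>, and
  choose \<open>\<zeta>\<close> least such that \<open>F\<^sup>N(\<zeta>)\<close> is \<open>\<in>\<close>-minimal.  Then \<open>\<zeta>\<close> is definable, hence fixed, and
  so is the least name of an element of the symmetric difference of \<open>F\<^sup>M(\<zeta>)\<close> and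
  \<open>F\<^sup>N(\<zeta>) = j(F\<^sup>M(\<zeta>))\<close>; such an element is itself fixed and cannot exist.  The same argument
  compares \<open>A\<^sup>M\<close> and \<open>A\<^sup>N\<close>.
\<close>

section \<open>The universe\<close>

text \<open>Two gaps between HOL and the universe shape the proof. \<open>OD\<close> quantifies over
  formulas of HOL, whereas formulas coded inside the universe could have nonstandard length; so the
  enumeration is built from set operations and not from codes with satisfaction in some V_\<xi>.
  Transfinite closure may compose nonstandardly many operations, yet it never leaves
  \<open>OD\<close>, since each value is defined from its name by the single formula for
  \<open>enum\<close>. Moreover, an induction along the natural numbers of the universe needs one
  class, but elementarity is a scheme over formulas. Two predicative conditions form the induction
  hypothesis: \<open>coherent\<close>, by which \<open>j\<close> carries the trace of stage m+1 on a
  set of M to the trace of stage m on its image, and \<open>stage_defined\<close>, by which the next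
  stage is cut out by the formula for M. Elementarity is recovered from \<open>coherent\<close> for
  each formula separately. Closure of the enumerated sets and preservation of solution sets by
  \<open>j\<close> are one induction over formulas, carried out for pairs of sets in
  \<open>op_family\<close>.\<close>

lemma in_ext_iff [simp]: "y \<in> ext E x \<longleftrightarrow> E y x"
  by (simp add: ext_def)

locale ngb =
  fixes E :: "'v mem" and \<C> :: "'v set set"
  assumes NGB: "NGB E \<C>"
begin

definition code :: "'v set \<Rightarrow> 'v" where
  "code X = (THE x. ext E x = X)"

definition is_set :: "'v set \<Rightarrow> bool" where
  "is_set X \<longleftrightarrow> (\<exists>x. ext E x = X)"

lemma basic: "basic_set_axioms E UNIV"
  using NGB by (simp add: NGB_def)

lemma set_eqI: assumes "\<And>z. E z x \<longleftrightarrow> E z y" shows "x = y"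
proof -
  have "\<forall>x\<in>UNIV. \<forall>y\<in>UNIV. (\<forall>z\<in>UNIV. E z x \<longleftrightarrow> E z y) \<longrightarrow> x = y"
    using basic unfolding basic_set_axioms_def by (elim conjE)
  then show ?thesis using assms by blast
qed

lemma ext_inject [simp]: "ext E x = ext E y \<longleftrightarrow> x = y"
  using set_eqI by (metis in_ext_iff)

lemma code_ext [simp]: "code (ext E x) = x"
  by (auto simp: code_def)

lemma ext_code: "is_set X \<Longrightarrow> ext E (code X) = X"
  by (auto simp: is_set_def)

lemma E_code: "is_set X \<Longrightarrow> E y (code X) \<longleftrightarrow> y \<in> X"
  using ext_code by (auto simp: ext_def)

lemma is_set_ext [simp]: "is_set (ext E x)"
  using is_set_def by blast

lemma pairing: "\<exists>p. \<forall>z. E z p \<longleftrightarrow> z = x \<or> z = y"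
proof -
  have "\<forall>x\<in>UNIV. \<forall>y\<in>UNIV. \<exists>p\<in>UNIV. \<forall>z\<in>UNIV. E z p \<longleftrightarrow> z = x \<or> z = y"
    using basic unfolding basic_set_axioms_def by (elim conjE)
  then show ?thesis by simp
qed

lemma union: "\<exists>u. \<forall>z. E z u \<longleftrightarrow> (\<exists>y. E y x \<and> E z y)"
proof -
  have "\<forall>x\<in>UNIV. \<exists>u\<in>UNIV. \<forall>z\<in>UNIV. E z u \<longleftrightarrow> (\<exists>y\<in>UNIV. E y x \<and> E z y)"
    using basic unfolding basic_set_axioms_def by (elim conjE)
  then show ?thesis by simp
qed

lemma empty_set: "\<exists>x. \<forall>z. \<not> E z x"
proof -
  have "\<exists>w\<in>UNIV. (\<exists>y\<in>UNIV. E y w \<and> (\<forall>z\<in>UNIV. \<not> E z y)) \<and>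
      (\<forall>x\<in>UNIV. E x w \<longrightarrow> (\<exists>y\<in>UNIV. E y w \<and> (\<forall>z\<in>UNIV. E z y \<longleftrightarrow> E z x \<or> z = x)))"
    using basic unfolding basic_set_axioms_def by (elim conjE)
  then show ?thesis by auto
qed

lemma is_set_iff: "is_set X \<longleftrightarrow> (\<exists>x. \<forall>z. E z x \<longleftrightarrow> z \<in> X)"
  unfolding is_set_def ext_def by auto

lemma is_set_pair [simp]: "is_set {x, y}"
  using pairing[of x y] by (simp add: is_set_iff)

lemma is_set_sing [simp]: "is_set {x}"
  using is_set_pair[of x x] by simp

lemma is_set_Union: "is_set (\<Union>y\<in>ext E x. ext E y)"
  using union[of x] by (simp add: is_set_iff Bex_def)

lemma is_set_Un: assumes "is_set X" "is_set Y" shows "is_set (X \<union> Y)"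
proof -
  have "X \<union> Y = (\<Union>y\<in>ext E (code {code X, code Y}). ext E y)"
    using assms by (auto simp: E_code)
  then show ?thesis using is_set_Union by metis
qed

lemma is_set_empty [simp]: "is_set {}"
  using empty_set by (simp add: is_set_iff)

lemma is_set_insert: "is_set X \<Longrightarrow> is_set (insert x X)"
  using is_set_Un[of "{x}" X] by simp

section \<open>Singletons, pairs and successors as operations on sets\<close>

definition zero :: 'v where "zero = code {}"
definition sing :: "'v \<Rightarrow> 'v" where "sing x = code {x}"
definition upair :: "'v \<Rightarrow> 'v \<Rightarrow> 'v" where "upair x y = code {x, y}"
definition pr :: "'v \<Rightarrow> 'v \<Rightarrow> 'v" where "pr x y = upair (sing x) (upair x y)"
definition suc :: "'v \<Rightarrow> 'v" where "suc x = code (insert x (ext E x))"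

lemma E_zero [simp]: "\<not> E x zero"
  by (simp add: zero_def E_code)

lemma E_sing [simp]: "E y (sing x) \<longleftrightarrow> y = x"
  by (simp add: sing_def E_code)

lemma E_upair [simp]: "E z (upair x y) \<longleftrightarrow> z = x \<or> z = y"
  by (simp add: upair_def E_code)

lemma E_suc [simp]: "E y (suc x) \<longleftrightarrow> y = x \<or> E y x"
  by (simp add: suc_def E_code is_set_insert)

lemma ext_sing [simp]: "ext E (sing x) = {x}"
  by (auto simp: ext_def)

lemma ext_upair [simp]: "ext E (upair x y) = {x, y}"
  by (auto simp: ext_def)

lemma sing_inject [simp]: "sing x = sing y \<longleftrightarrow> x = y"
  by (metis E_sing)

lemma sing_neq_zero [simp]: "sing x \<noteq> zero" "zero \<noteq> sing x"
  by (metis E_sing E_zero)+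

lemma upair_eq: "upair x y = upair u v \<longleftrightarrow> x = u \<and> y = v \<or> x = v \<and> y = u"
  using ext_inject[of "upair x y" "upair u v"] by (auto simp: doubleton_eq_iff)

lemma sing_upair: "sing x = upair x x"
  by (rule set_eqI) simp

lemma pr_inject [simp]: "pr x y = pr u v \<longleftrightarrow> x = u \<and> y = v"
  unfolding pr_def upair_eq sing_upair by auto

lemma is_opair_iff: "is_opair E p x y \<longleftrightarrow> p = pr x y"
proof -
  have "is_opair E p x y \<longleftrightarrow> (\<forall>z. E z p \<longleftrightarrow> z = sing x \<or> z = upair x y)"
    unfolding is_opair_def by (metis ext_inject ext_sing ext_upair)
  then show ?thesis unfolding pr_def by (metis E_upair set_eqI)
qed

lemma comprehension: "predicative E \<C> (\<lambda>e. P (e 0)) \<Longrightarrow> {x. P x} \<in> \<C>"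
  using NGB unfolding NGB_def by (metis (no_types, lifting) Collect_cong old.nat.simps(4))

lemma ext_in_classes [simp]: "ext E x \<in> \<C>"
  using NGB by (simp add: NGB_def)

lemma foundation: "X \<in> \<C> \<Longrightarrow> x \<in> X \<Longrightarrow> \<exists>y\<in>X. \<forall>z\<in>X. \<not> E z y"
  using NGB unfolding NGB_def ext_def by fastforce

lemma replacement:
  assumes "F \<in> \<C>" "\<And>x y z. pr x y \<in> F \<Longrightarrow> pr x z \<in> F \<Longrightarrow> y = z"
  shows "is_set {y. \<exists>x. E x a \<and> pr x y \<in> F}"
proof -
  have "\<forall>F\<in>\<C>.
      (\<forall>x y z. (\<exists>p\<in>F. is_opair E p x y) \<and> (\<exists>q\<in>F. is_opair E q x z) \<longrightarrow> y = z) \<longrightarrow>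
      (\<forall>a. \<exists>s. \<forall>y. E y s \<longleftrightarrow> (\<exists>x. E x a \<and> (\<exists>p\<in>F. is_opair E p x y)))"
    using NGB unfolding NGB_def by (elim conjE)
  then have "\<exists>s. \<forall>y. E y s \<longleftrightarrow> (\<exists>x. E x a \<and> pr x y \<in> F)"
    using assms unfolding is_opair_iff by auto
  then show ?thesis by (simp add: is_set_iff)
qed

lemma foundation_set: "E x w \<Longrightarrow> \<exists>y. E y w \<and> (\<forall>z. E z w \<longrightarrow> \<not> E z y)"
  using foundation[OF ext_in_classes, of x w] by auto

lemma E_irrefl [simp]: "\<not> E x x"
  using foundation_set[of x "sing x"] by auto

lemma E_asym: "E x y \<Longrightarrow> \<not> E y x"
  using foundation_set[of x "upair x y"] by auto

text \<open>Together with trichotomy, the absence of short cycles yields transitivity of membership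
  on an ordinal.\<close>

lemma E_no_3_cycle: "E x y \<Longrightarrow> E y z \<Longrightarrow> \<not> E z x"
proof -
  have "is_set {x, y, z}" by (intro is_set_insert is_set_empty)
  then obtain w where "\<And>u. E u w \<longleftrightarrow> u = x \<or> u = y \<or> u = z" by (auto simp: is_set_iff)
  then show "E x y \<Longrightarrow> E y z \<Longrightarrow> \<not> E z x"
    using foundation_set[of x w] by metis
qed

end

section \<open>Definability\<close>

primrec rename :: "(nat \<Rightarrow> nat) \<Rightarrow> fm \<Rightarrow> fm" where
  "rename f (Mem i k) = Mem (f i) (f k)"
| "rename f (Eq i k) = Eq (f i) (f k)"
| "rename f (Neg \<phi>) = Neg (rename f \<phi>)"
| "rename f (Conj \<phi> \<psi>) = Conj (rename f \<phi>) (rename f \<psi>)"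
| "rename f (Forall \<phi>) = Forall (rename (case_nat 0 (\<lambda>i. Suc (f i))) \<phi>)"

lemma sat_rename: "sat E D e (rename f \<phi>) \<longleftrightarrow> sat E D (\<lambda>i. e (f i)) \<phi>"
proof (induction \<phi> arbitrary: e f)
  case (Forall \<phi>)
  have "(\<lambda>i. case_nat x e (case_nat 0 (\<lambda>i. Suc (f i)) i)) = case_nat x (\<lambda>i. e (f i))" for x
    by (auto split: nat.split)
  then show ?case by (simp add: Forall)
qed auto

lemma predicative_rename: "predicative E \<C> P \<Longrightarrow> predicative E \<C> (\<lambda>e. P (\<lambda>i. e (f i)))"
proof (induction arbitrary: f rule: predicative.induct)
  case (6 P)
  let ?f = "case_nat 0 (\<lambda>i. Suc (f i))"
  have "(\<lambda>e. \<forall>x. P (\<lambda>i. case_nat x e (?f i))) = (\<lambda>e. \<forall>x. P (case_nat x (\<lambda>i. e (f i))))"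
    by (intro HOL.ext all_cong1 arg_cong[of _ _ P]) (auto split: nat.split)
  then show ?case
    using predicative.intros(6)[OF 6(2)[of ?f]] by metis
qed (auto intro: predicative.intros)

text \<open>
  Definability is treated semantically, as a property of predicates on assignments, so that it
  can be verified by resolution; \<open>definable_term\<close> does the same for operations on sets.
\<close>

locale definability = ngb E \<C> for E :: "'v mem" and \<C> +
  fixes D :: "'v set" and df :: "((nat \<Rightarrow> 'v) \<Rightarrow> bool) \<Rightarrow> bool"
  assumes transitive: "transitive E D"
    and nonempty: "D \<noteq> {}"
    and upair_closed: "x \<in> D \<Longrightarrow> y \<in> D \<Longrightarrow> upair x y \<in> D"
    and cong: "df P \<Longrightarrow> (\<And>e. range e \<subseteq> D \<Longrightarrow> P e \<longleftrightarrow> Q e) \<Longrightarrow> df Q"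
    and mem_var: "df (\<lambda>e. E (e i) (e k))"
    and eq_var: "df (\<lambda>e. e i = e k)"
    and neg: "df P \<Longrightarrow> df (\<lambda>e. \<not> P e)"
    and conj: "df P \<Longrightarrow> df Q \<Longrightarrow> df (\<lambda>e. P e \<and> Q e)"
    and ball: "df (\<lambda>e. R (e 0) (\<lambda>i. e (Suc i))) \<Longrightarrow> df (\<lambda>e. \<forall>x\<in>D. R x e)"
    and ren: "df P \<Longrightarrow> df (\<lambda>e. P (\<lambda>i. e (f i)))"
begin

lemma mem_closed: "x \<in> D \<Longrightarrow> E y x \<Longrightarrow> y \<in> D"
  using transitive unfolding transitive_def by (metis in_ext_iff subsetD)

lemma disj: "df P \<Longrightarrow> df Q \<Longrightarrow> df (\<lambda>e. P e \<or> Q e)"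
  using neg[OF conj[OF neg neg]] by simp

lemma imp: "df P \<Longrightarrow> df Q \<Longrightarrow> df (\<lambda>e. P e \<longrightarrow> Q e)"
  using disj[OF neg, of P Q] by simp

lemma iff: "df P \<Longrightarrow> df Q \<Longrightarrow> df (\<lambda>e. P e \<longleftrightarrow> Q e)"
  unfolding iff_conv_conj_imp by (intro conj imp)

lemma bex: "df (\<lambda>e. R (e 0) (\<lambda>i. e (Suc i))) \<Longrightarrow> df (\<lambda>e. \<exists>x\<in>D. R x e)"
  using neg[OF ball[of "\<lambda>x e. \<not> R x e"], OF neg] by simp

lemma const: "df (\<lambda>e. c)"
proof -
  have t: "df (\<lambda>e. e 0 = e 0)" by (rule eq_var)
  then show ?thesis using neg[OF t] by (cases c) simp_all
qed

definition definable_term :: "((nat \<Rightarrow> 'v) \<Rightarrow> 'v) \<Rightarrow> bool" where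
  "definable_term t \<longleftrightarrow>
    (\<forall>e. range e \<subseteq> D \<longrightarrow> t e \<in> D) \<and> df (\<lambda>e. e 0 = t (\<lambda>i. e (Suc i)))"

lemma var: "definable_term (\<lambda>e. e i)"
  unfolding definable_term_def using eq_var by auto

lemma term_ren: assumes "definable_term t" shows "definable_term (\<lambda>e. t (\<lambda>i. e (f i)))"
proof -
  have "df (\<lambda>e. e 0 = t (\<lambda>i. e (Suc (f i))))"
    using ren[of "\<lambda>e. e 0 = t (\<lambda>i. e (Suc i))" "case_nat 0 (\<lambda>i. Suc (f i))"] assms
    by (simp add: definable_term_def)
  moreover have "t (\<lambda>i. e (f i)) \<in> D" if "range e \<subseteq> D" for e
  proof -
    have "range (\<lambda>i. e (f i)) \<subseteq> D" using that by auto
    then show ?thesis using assms unfolding definable_term_def by blast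
  qed
  ultimately show ?thesis unfolding definable_term_def by auto
qed

text \<open>The value of the term is named by a quantified variable \<open>x\<close> with
  \<open>x = t e\<close>. Closure of \<open>D\<close> under \<open>t\<close>, which is part of
  \<open>definable_term\<close>, lets this variable range over \<open>D\<close>.\<close>

lemma subst:
  assumes "df (\<lambda>e. R (e 0) (\<lambda>i. e (Suc i)))" and t: "definable_term t"
  shows "df (\<lambda>e. R (t e) e)"
proof -
  have "df (\<lambda>e. \<exists>x\<in>D. x = t e \<and> R x e)"
    by (rule bex, rule conj) (use assms in \<open>auto simp: definable_term_def\<close>)
  then show ?thesis
    by (rule cong) (use t in \<open>auto simp: definable_term_def\<close>)
qed

lemma subst1: "df (\<lambda>e. R (e 0)) \<Longrightarrow> definable_term t \<Longrightarrow> df (\<lambda>e. R (t e))"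
  using subst[of "\<lambda>x e. R x" t] by simp

text \<open>\<open>subst\<close> acts on variable 0 only, so the arguments are permuted and treated
  one after another, the last one first; terms already substituted are shifted past the remaining
  variables.\<close>

lemma subst2:
  assumes "df (\<lambda>e. R (e 0) (e 1))" "definable_term t" "definable_term u"
  shows "df (\<lambda>e. R (t e) (u e))"
proof -
  have "df (\<lambda>e. R (e 1) (e 0))"
    using ren[OF assms(1), of "case_nat 1 (\<lambda>i. 0)"] by simp
  then have "df (\<lambda>e. R (e 0) (u (\<lambda>i. e (Suc i))))"
    using subst[of "\<lambda>x e. R (e 0) x" "\<lambda>e. u (\<lambda>i. e (Suc i))"] term_ren[OF assms(3), of Suc] by simp
  then show ?thesis by (rule subst[OF _ assms(2)])
qed

lemma subst3:
  assumes "df (\<lambda>e. R (e 0) (e 1) (e 2))" "definable_term t" "definable_term u" "definable_term v"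
  shows "df (\<lambda>e. R (t e) (u e) (v e))"
proof -
  have "df (\<lambda>e. R (e 1) (e 2) (e 0))"
    using ren[OF assms(1), of "\<lambda>i. if i = 0 then 1 else if i = 1 then 2 else 0"] by simp
  then have "df (\<lambda>e. R (e 0) (e 1) (v (\<lambda>i. e (Suc (Suc i)))))"
    using subst[of "\<lambda>x e. R (e 0) (e 1) x" "\<lambda>e. v (\<lambda>i. e (Suc (Suc i)))"]
      term_ren[OF assms(4), of "\<lambda>i. Suc (Suc i)"] by (simp add: numeral_2_eq_2)
  then have "df (\<lambda>e. R (e 1) (e 0) (v (\<lambda>i. e (Suc (Suc i)))))"
    using ren[of _ "\<lambda>i. if i = 0 then 1 else if i = 1 then 0 else i"] by fastforce
  then have "df (\<lambda>e. R (e 0) (u (\<lambda>i. e (Suc i))) (v (\<lambda>i. e (Suc i))))"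
    using subst[of "\<lambda>x e. R (e 0) x (v (\<lambda>i. e (Suc i)))" "\<lambda>e. u (\<lambda>i. e (Suc i))"]
      term_ren[OF assms(3), of Suc] by simp
  then show ?thesis by (rule subst[OF _ assms(2)])
qed

lemma subst4:
  assumes "df (\<lambda>e. R (e 0) (e 1) (e 2) (e 3))"
    "definable_term t" "definable_term u" "definable_term v" "definable_term w"
  shows "df (\<lambda>e. R (t e) (u e) (v e) (w e))"
proof -
  have "df (\<lambda>e. R (e 1) (e 2) (e 3) (e 0))"
    using ren[OF assms(1), of "\<lambda>i. if i = 3 then 0 else Suc i"] by (simp add: numeral_3_eq_3 numeral_2_eq_2)
  then have "df (\<lambda>e. R (e 0) (e 1) (e 2) (w (\<lambda>i. e (i + 3))))"
    using subst[of "\<lambda>x e. R (e 0) (e 1) (e 2) x" "\<lambda>e. w (\<lambda>i. e (i + 3))"]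
      term_ren[OF assms(5), of "\<lambda>i. i + 3"] by (simp add: numeral_3_eq_3 numeral_2_eq_2)
  then have "df (\<lambda>e. R (e 1) (e 2) (e 0) (w (\<lambda>i. e (i + 3))))"
    using ren[of "\<lambda>e. R (e 0) (e 1) (e 2) (w (\<lambda>i. e (i + 3)))"
      "\<lambda>i. if i = 0 then 1 else if i = 1 then 2 else if i = 2 then 0 else i"] by simp
  then have "df (\<lambda>e. R (e 0) (e 1) (v (\<lambda>i. e (i + 2))) (w (\<lambda>i. e (i + 2))))"
    using subst[of "\<lambda>x e. R (e 0) (e 1) x (w (\<lambda>i. e (i + 2)))" "\<lambda>e. v (\<lambda>i. e (i + 2))"]
      term_ren[OF assms(4), of "\<lambda>i. i + 2"] by (simp add: numeral_3_eq_3 numeral_2_eq_2)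
  then have "df (\<lambda>e. R (e 1) (e 0) (v (\<lambda>i. e (i + 2))) (w (\<lambda>i. e (i + 2))))"
    using ren[of "\<lambda>e. R (e 0) (e 1) (v (\<lambda>i. e (i + 2))) (w (\<lambda>i. e (i + 2)))"
      "\<lambda>i. if i = 0 then 1 else if i = 1 then 0 else i"] by simp
  then have "df (\<lambda>e. R (e 0) (u (\<lambda>i. e (Suc i))) (v (\<lambda>i. e (Suc i))) (w (\<lambda>i. e (Suc i))))"
    using subst[of "\<lambda>x e. R (e 0) x (v (\<lambda>i. e (Suc i))) (w (\<lambda>i. e (Suc i)))" "\<lambda>e. u (\<lambda>i. e (Suc i))"]
      term_ren[OF assms(3), of Suc] by simp
  then show ?thesis by (rule subst[OF _ assms(2)])
qed

lemma mem: "definable_term t \<Longrightarrow> definable_term u \<Longrightarrow> df (\<lambda>e. E (t e) (u e))"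
  by (rule subst2[of E, OF mem_var])

lemma eq: "definable_term t \<Longrightarrow> definable_term u \<Longrightarrow> df (\<lambda>e. t e = u e)"
  by (rule subst2[of "(=)", OF eq_var])

lemmas intros = neg conj disj imp iff ball bex const mem eq var

text \<open>A term is described by its elements. Transitivity of \<open>D\<close> confines the
  elements of both sides to \<open>D\<close>, so that extensionality applies.\<close>

lemma termI:
  assumes "\<And>e. range e \<subseteq> D \<Longrightarrow> t e \<in> D"
    and "df (\<lambda>e. \<forall>x\<in>D. E x (e 0) \<longleftrightarrow> R x (\<lambda>i. e (Suc i)))"
    and "\<And>x e. range e \<subseteq> D \<Longrightarrow> x \<in> D \<Longrightarrow> E x (t e) \<longleftrightarrow> R x e"
  shows "definable_term t"
proof -
  have "(\<forall>x\<in>D. E x (e 0) \<longleftrightarrow> R x (\<lambda>i. e (Suc i))) \<longleftrightarrow> e 0 = t (\<lambda>i. e (Suc i))" if e: "range e \<subseteq> D" for e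
  proof -
    have s: "range (\<lambda>i. e (Suc i)) \<subseteq> D" using e by auto
    have 1: "x \<in> D" if "E x (e 0) \<or> E x (t (\<lambda>i. e (Suc i)))" for x
      using that assms(1)[OF s] e mem_closed by (metis rangeI subsetD)
    show ?thesis
    proof
      assume "\<forall>x\<in>D. E x (e 0) \<longleftrightarrow> R x (\<lambda>i. e (Suc i))"
      then show "e 0 = t (\<lambda>i. e (Suc i))" using 1 assms(3)[OF s] by (intro set_eqI) blast
    qed (use assms(3)[OF s] in simp)
  qed
  then have "df (\<lambda>e. e 0 = t (\<lambda>i. e (Suc i)))" by (intro cong[OF assms(2)]) auto
  then show ?thesis using assms(1) by (simp add: definable_term_def)
qed

lemma upair_term:
  assumes "definable_term t" "definable_term u" shows "definable_term (\<lambda>e. upair (t e) (u e))"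
  by (rule termI[where R = "\<lambda>x e. x = t e \<or> x = u e"])
    (use assms in \<open>auto simp: definable_term_def upair_closed intro!: intros term_ren[OF assms(1), of "\<lambda>i. Suc (Suc i)"] term_ren[OF assms(2), of "\<lambda>i. Suc (Suc i)"]\<close>)

lemma sing_term: "definable_term t \<Longrightarrow> definable_term (\<lambda>e. sing (t e))"
  unfolding sing_upair by (rule upair_term)

lemma pr_term: "definable_term t \<Longrightarrow> definable_term u \<Longrightarrow> definable_term (\<lambda>e. pr (t e) (u e))"
  unfolding pr_def by (intro upair_term sing_term)

lemma sing_closed: "x \<in> D \<Longrightarrow> sing x \<in> D"
  using upair_closed by (simp add: sing_upair)

lemma pr_closed: "x \<in> D \<Longrightarrow> y \<in> D \<Longrightarrow> pr x y \<in> D"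
  using upair_closed sing_closed by (simp add: pr_def)

lemma sing_closed_iff [simp]: "sing x \<in> D \<longleftrightarrow> x \<in> D"
  using sing_closed mem_closed E_sing by metis

lemma pr_closed_iff [simp]: "pr x y \<in> D \<longleftrightarrow> x \<in> D \<and> y \<in> D"
proof
  assume *: "pr x y \<in> D"
  then have "upair x y \<in> D" using mem_closed[OF *, of "upair x y"] by (simp add: pr_def)
  then show "x \<in> D \<and> y \<in> D" using mem_closed by auto
qed (simp add: pr_closed)

text \<open>For a fixed formula of HOL, satisfaction unfolds into finitely many definable steps. The
  domain \<open>{x. U x e}\<close> may vary with the assignment; this covers inner models as well as
  the stages of the iteration, uniformly in the stage.\<close>

lemma sat_definable:
  assumes "df (\<lambda>e. U (e 0) (\<lambda>i. e (Suc i)))"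
    and "\<And>x e. range e \<subseteq> D \<Longrightarrow> U x e \<Longrightarrow> x \<in> D" and "\<And>i. definable_term (t i)"
  shows "df (\<lambda>e. sat E {x. U x e} (\<lambda>i. t i e) \<phi>)"
  using assms
proof (induction \<phi> arbitrary: t U)
  case (Forall \<phi>)
  let ?t = "case_nat (\<lambda>e. e 0) (\<lambda>k e. t k (\<lambda>i. e (Suc i)))"
  have "df (\<lambda>e. sat E {x. U x (\<lambda>i. e (Suc i))} (\<lambda>i. ?t i e) \<phi>)"
  proof (rule Forall.IH)
    show "df (\<lambda>e. U (e 0) (\<lambda>i. e (Suc (Suc i))))"
      using ren[OF Forall.prems(1), of "case_nat 0 (\<lambda>i. Suc (Suc i))"] by simp
    show "range e \<subseteq> D \<Longrightarrow> U x (\<lambda>i. e (Suc i)) \<Longrightarrow> x \<in> D" for x e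
      by (rule Forall.prems(2)) auto
    show "definable_term (?t i)" for i
      using Forall.prems(3) term_ren var by (auto split: nat.split)
  qed
  then have "df (\<lambda>e. \<forall>x\<in>D. U x e \<longrightarrow> sat E {x. U x e} (case_nat x (\<lambda>i. t i e)) \<phi>)"
    using Forall.prems(1)
    by (intro ball imp, simp) (auto elim!: back_subst[of df] split: nat.split intro!: ext arg_cong2[of _ _ _ _ "\<lambda>e \<phi>. sat E _ e \<phi>"])
  then show ?case by (rule cong) (use Forall.prems(2) in auto)
qed (auto intro: intros)

end

lemma (in ngb) predicative_definability: "definability E \<C> UNIV (predicative E \<C>)"
proof
  show "predicative E \<C> P \<Longrightarrow> (\<And>e. range e \<subseteq> UNIV \<Longrightarrow> P e \<longleftrightarrow> Q e) \<Longrightarrow> predicative E \<C> Q" for P Q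
    using HOL.ext[of P Q] by auto
  show "predicative E \<C> (\<lambda>e. R (e 0) (\<lambda>i. e (Suc i))) \<Longrightarrow> predicative E \<C> (\<lambda>e. \<forall>x\<in>UNIV. R x e)" for R
    using predicative.intros(6)[of E \<C> "\<lambda>e. R (e 0) (\<lambda>i. e (Suc i))"] by simp
qed (auto simp: transitive_def intro: predicative.intros predicative_rename)

sublocale ngb \<subseteq> cls: definability E \<C> UNIV "predicative E \<C>"
  by (rule predicative_definability)

context ngb
begin

lemma cls_all: "predicative E \<C> (\<lambda>e. R (e 0) (\<lambda>i. e (Suc i))) \<Longrightarrow> predicative E \<C> (\<lambda>e. \<forall>x. R x e)"
  using cls.ball[of R] by simp

lemma cls_ex: "predicative E \<C> (\<lambda>e. R (e 0) (\<lambda>i. e (Suc i))) \<Longrightarrow> predicative E \<C> (\<lambda>e. \<exists>x. R x e)"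
  using cls.bex[of R] by simp

lemma cls_in: "X \<in> \<C> \<Longrightarrow> cls.definable_term t \<Longrightarrow> predicative E \<C> (\<lambda>e. t e \<in> X)"
  by (rule cls.subst1[of "\<lambda>x. x \<in> X"]) (rule predicative.intros)

text \<open>A set parameter \<open>c\<close> enters as the class parameter \<open>{c}\<close>, the
  extension of \<open>sing c\<close>.\<close>

lemma cls_const: "cls.definable_term (\<lambda>e. c)"
  using predicative.intros(3)[OF ext_in_classes[of "sing c"], where i = 0] by (simp add: cls.definable_term_def)

lemma cls_ball: "X \<in> \<C> \<Longrightarrow> predicative E \<C> (\<lambda>e. R (e 0) (\<lambda>i. e (Suc i))) \<Longrightarrow> predicative E \<C> (\<lambda>e. \<forall>x\<in>X. R x e)"
  unfolding Ball_def by (intro cls_all cls.imp cls_in cls.var)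

lemma cls_bex: "X \<in> \<C> \<Longrightarrow> predicative E \<C> (\<lambda>e. R (e 0) (\<lambda>i. e (Suc i))) \<Longrightarrow> predicative E \<C> (\<lambda>e. \<exists>x\<in>X. R x e)"
  unfolding Bex_def by (intro cls_ex cls.conj cls_in cls.var)

lemmas cls_intros = cls_all cls_ex cls_ball cls_bex cls_in cls_const cls.neg cls.conj cls.disj cls.imp cls.iff
  cls.const cls.mem cls.eq cls.var cls.pr_term cls.sing_term

section \<open>Ordinals\<close>

text \<open>Foundation supplies least elements, so of the well-ordering only transitivity of the set
  and trichotomy remain. All quantifiers become bounded, which makes being an ordinal absolute for
  transitive models and preserved by \<open>j\<close>.\<close>

lemma ordinal_iff: "ordinal E x \<longleftrightarrow> (\<forall>y z. E y x \<longrightarrow> E z y \<longrightarrow> E z x) \<and>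
    (\<forall>y z. E y x \<longrightarrow> E z x \<longrightarrow> E y z \<or> y = z \<or> E z y)" (is "_ \<longleftrightarrow> ?tr \<and> ?tot")
proof
  assume "ordinal E x"
  then show "?tr \<and> ?tot"
    unfolding ordinal_def transitive_def well_orders_def totalp_on_def ext_def by blast
next
  assume a: "?tr \<and> ?tot"
  have "transp_on (ext E x) E"
    unfolding transp_on_def by (metis a E_no_3_cycle E_asym in_ext_iff)
  moreover have "\<exists>m\<in>ext E u. \<forall>x\<in>ext E u. x = m \<or> E m x" if u: "ext E u \<subseteq> ext E x" "ext E u \<noteq> {}" for u
  proof -
    obtain v where "E v u" using u by auto
    then obtain m where m: "E m u" "\<And>z. E z u \<Longrightarrow> \<not> E z m" using foundation_set by blast
    have "z = m \<or> E m z" if "E z u" for z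
      using m that a u by (metis in_ext_iff subset_iff)
    then show ?thesis using m by (intro bexI[of _ m]) auto
  qed
  moreover have "totalp_on (ext E x) E"
    unfolding totalp_on_def by (metis a in_ext_iff)
  moreover have "transitive E (ext E x)"
    unfolding transitive_def subset_iff by (metis a in_ext_iff)
  ultimately show "ordinal E x"
    unfolding ordinal_def well_orders_def irreflp_on_def by simp
qed

lemma ordinal_trans: "ordinal E x \<Longrightarrow> E y x \<Longrightarrow> E z y \<Longrightarrow> E z x"
  unfolding ordinal_iff by blast

lemma ordinal_mem: "ordinal E x \<Longrightarrow> E y x \<Longrightarrow> ordinal E y"
  unfolding ordinal_iff by (metis E_asym E_no_3_cycle)

lemma ordinal_definable_cls: "predicative E \<C> (\<lambda>e. ordinal E (e 0))"
  unfolding ordinal_iff by (intro cls_intros)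

lemmas ordinal_cls = cls.subst1[of "ordinal E", OF ordinal_definable_cls]

text \<open>Two nested minimal choices: \<open>a\<close> is minimal among the ordinals incomparable
  with some ordinal, and \<open>c\<close> is minimal among those incomparable with \<open>a\<close>.
  Then \<open>a\<close> and \<open>c\<close> have the same elements.\<close>

lemma ordinal_linear: "ordinal E x \<Longrightarrow> ordinal E y \<Longrightarrow> E x y \<or> x = y \<or> E y x"
proof (rule ccontr)
  let ?inc = "\<lambda>x y. ordinal E y \<and> \<not> (E x y \<or> x = y \<or> E y x)"
  assume "ordinal E x" "ordinal E y" "\<not> (E x y \<or> x = y \<or> E y x)"
  moreover have "{x. ordinal E x \<and> (\<exists>y. ?inc x y)} \<in> \<C>"
    by (rule comprehension) (intro cls_intros ordinal_cls)
  ultimately obtain a where a: "ordinal E a" "\<exists>y. ?inc a y"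
    and amin: "\<And>z. ordinal E z \<Longrightarrow> \<exists>y. ?inc z y \<Longrightarrow> \<not> E z a"
    using foundation[of "{x. ordinal E x \<and> (\<exists>y. ?inc x y)}" x] by blast
  have "{y. ?inc a y} \<in> \<C>"
    by (rule comprehension) (intro cls_intros ordinal_cls)
  then obtain c where c: "?inc a c" and cmin: "\<And>z. ?inc a z \<Longrightarrow> \<not> E z c"
    using foundation[of "{y. ?inc a y}"] a(2) by blast
  have "E z a \<longleftrightarrow> E z c" for z
  proof
    assume z: "E z a"
    then have "\<not> ?inc z c" using amin ordinal_mem a by blast
    then show "E z c" using c z ordinal_trans a by blast
  next
    assume z: "E z c"
    then have "\<not> ?inc a z" using cmin by blast
    then show "E z a" using c z ordinal_trans ordinal_mem by blast
  qed
  then have "a = c" by (rule set_eqI)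
  then show False using c by simp
qed

lemma transitive_set_of_ordinals:
  "(\<And>y. E y x \<Longrightarrow> ordinal E y) \<Longrightarrow> (\<And>y z. E y x \<Longrightarrow> E z y \<Longrightarrow> E z x) \<Longrightarrow> ordinal E x"
  using ordinal_linear unfolding ordinal_iff[of x] by blast

lemma ordinal_zero: "ordinal E zero"
  by (simp add: ordinal_iff)

lemma ordinal_suc: "ordinal E x \<Longrightarrow> ordinal E (suc x)"
  by (rule transitive_set_of_ordinals) (auto intro: ordinal_mem ordinal_trans)

lemma ordinal_sup:
  assumes "\<And>x. E x s \<Longrightarrow> ordinal E x"
  shows "\<exists>\<gamma>. ordinal E \<gamma> \<and> (\<forall>x. E x s \<longrightarrow> E x \<gamma>)"
proof -
  obtain u where u: "\<And>z. E z u \<longleftrightarrow> (\<exists>y. E y s \<and> E z y)" using union[of s] by blast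
  have o: "ordinal E u"
    by (rule transitive_set_of_ordinals) (use u assms ordinal_mem ordinal_trans in blast)+
  moreover have "E x (suc u)" if "E x s" for x
    using ordinal_linear[OF o assms[OF that]] u[of u] u[of x] that by auto
  ultimately show ?thesis using ordinal_suc by blast
qed

lemma ordinal_least:
  assumes "{x. P x} \<in> \<C>" "ordinal E \<gamma>" "P \<gamma>"
  shows "\<exists>\<gamma>. ordinal E \<gamma> \<and> P \<gamma> \<and> (\<forall>\<delta>. E \<delta> \<gamma> \<longrightarrow> \<not> P \<delta>)"
proof -
  have "{x. ordinal E x \<and> x \<in> {x. P x}} \<in> \<C>"
    by (rule comprehension) (intro cls_intros ordinal_cls assms)
  then show ?thesis
    using foundation[of "{x. ordinal E x \<and> x \<in> {x. P x}}" \<gamma>] assms(2,3) ordinal_mem by simp blast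
qed

end

context definability
begin

lemma ordinal_definable: "df (\<lambda>e. ordinal E (e 0))"
proof -
  have "df (\<lambda>e. (\<forall>y\<in>D. \<forall>z\<in>D. E y (e 0) \<longrightarrow> E z y \<longrightarrow> E z (e 0)) \<and>
      (\<forall>y\<in>D. \<forall>z\<in>D. E y (e 0) \<longrightarrow> E z (e 0) \<longrightarrow> E y z \<or> y = z \<or> E z y))"
    by (intro intros)
  then show ?thesis
    by (rule cong) (unfold ordinal_iff, meson mem_closed rangeI subset_iff)
qed

lemma zero_term: assumes "zero \<in> D" shows "definable_term (\<lambda>e. zero)"
  by (rule termI[where R = "\<lambda>x e. False"]) (use assms in \<open>auto intro!: ball neg mem var\<close>)

lemma suc_term:
  assumes "\<And>x. x \<in> D \<Longrightarrow> suc x \<in> D" and t: "definable_term t" shows "definable_term (\<lambda>e. suc (t e))"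
  by (rule termI[where R = "\<lambda>x e. x = t e \<or> E x (t e)"])
    (use assms in \<open>auto simp: definable_term_def intro!: intros term_ren[OF t, of "\<lambda>i. Suc (Suc i)"]\<close>)

end

section \<open>Inner models\<close>

lemma range_case_nat [simp]: "range (case_nat x e) \<subseteq> D \<longleftrightarrow> x \<in> D \<and> range e \<subseteq> D"
  by (force simp: image_subset_iff split: nat.split)

lemma range_renamed: "range e \<subseteq> D \<Longrightarrow> range (\<lambda>i. e (f i)) \<subseteq> D"
  by auto

section \<open>Definability over an inner model, without and with set parameters\<close>

definition fo_definable :: "'v mem \<Rightarrow> 'v set \<Rightarrow> ((nat \<Rightarrow> 'v) \<Rightarrow> bool) \<Rightarrow> bool" where
  "fo_definable E D P \<longleftrightarrow> (\<exists>\<phi>. \<forall>e. range e \<subseteq> D \<longrightarrow> (sat E D e \<phi> \<longleftrightarrow> P e))"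

text \<open>A variable of the formula denotes either a variable of the assignment or a parameter.\<close>

definition fo_definable_par :: "'v mem \<Rightarrow> 'v set \<Rightarrow> ((nat \<Rightarrow> 'v) \<Rightarrow> bool) \<Rightarrow> bool" where
  "fo_definable_par E D P \<longleftrightarrow> (\<exists>\<phi> \<sigma>. (\<forall>i c. \<sigma> i = Inr c \<longrightarrow> c \<in> D) \<and>
    (\<forall>e. range e \<subseteq> D \<longrightarrow> (sat E D (\<lambda>i. case_sum e (\<lambda>c. c) (\<sigma> i)) \<phi> \<longleftrightarrow> P e)))"

lemma fo_definable_parI: "fo_definable E D P \<Longrightarrow> fo_definable_par E D P"
  unfolding fo_definable_def fo_definable_par_def by (erule exE, rule exI, rule exI[of _ Inl]) simp

locale inner = ngb E \<C> for E :: "'v mem" and \<C> +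
  fixes D :: "'v set"
  assumes inner_model: "inner_model E \<C> D"
begin

lemma D_class: "D \<in> \<C>" and D_trans: "transitive E D" and ZF: "models_ZF E D"
  and ordinal_in: "ordinal E \<alpha> \<Longrightarrow> \<alpha> \<in> D"
  using inner_model by (auto simp: inner_model_def)

lemma D_mem: "x \<in> D \<Longrightarrow> E y x \<Longrightarrow> y \<in> D"
  using D_trans unfolding transitive_def by (metis in_ext_iff subsetD)

lemma D_upair: assumes "x \<in> D" "y \<in> D" shows "upair x y \<in> D"
proof -
  have "\<forall>x\<in>D. \<forall>y\<in>D. \<exists>p\<in>D. \<forall>z\<in>D. E z p \<longleftrightarrow> z = x \<or> z = y"
    using ZF unfolding models_ZF_def basic_set_axioms_def by (elim conjE)
  then obtain p where "p \<in> D" "\<forall>z\<in>D. E z p \<longleftrightarrow> z = x \<or> z = y" using assms by blast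
  moreover from this have "p = upair x y" using assms D_mem by (intro set_eqI) (metis E_upair)
  ultimately show ?thesis by simp
qed

sublocale fo: definability E \<C> D "fo_definable E D"
proof
  show "D \<noteq> {}" using ordinal_in ordinal_zero by auto
  show "fo_definable E D (\<lambda>e. \<forall>x\<in>D. R x e)" if R: "fo_definable E D (\<lambda>e. R (e 0) (\<lambda>i. e (Suc i)))" for R
  proof -
    obtain \<phi> where \<phi>: "\<forall>e. range e \<subseteq> D \<longrightarrow> (sat E D e \<phi> \<longleftrightarrow> R (e 0) (\<lambda>i. e (Suc i)))"
      using R unfolding fo_definable_def by (elim exE)
    have "sat E D (case_nat x e) \<phi> \<longleftrightarrow> R x e" if "range e \<subseteq> D" "x \<in> D" for x e
      using \<phi>[rule_format, of "case_nat x e"] that by simp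
    then show ?thesis unfolding fo_definable_def by (intro exI[of _ "Forall \<phi>"]) auto
  qed
  show "fo_definable E D (\<lambda>e. P (\<lambda>i. e (f i)))" if P: "fo_definable E D P" for P f
  proof -
    obtain \<phi> where \<phi>: "\<forall>e. range e \<subseteq> D \<longrightarrow> (sat E D e \<phi> \<longleftrightarrow> P e)"
      using P unfolding fo_definable_def by (elim exE)
    have "sat E D e (rename f \<phi>) \<longleftrightarrow> P (\<lambda>i. e (f i))" if "range e \<subseteq> D" for e
      using \<phi>[rule_format, OF range_renamed[OF that]] by (simp add: sat_rename)
    then show ?thesis unfolding fo_definable_def by (intro exI[of _ "rename f \<phi>"]) simp
  qed
  show "fo_definable E D (\<lambda>e. E (e i) (e k))" for i k
    unfolding fo_definable_def by (rule exI[of _ "Mem i k"]) simp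
  show "fo_definable E D (\<lambda>e. e i = e k)" for i k
    unfolding fo_definable_def by (rule exI[of _ "Eq i k"]) simp
  show "fo_definable E D (\<lambda>e. \<not> P e)" if "fo_definable E D P" for P
    using that unfolding fo_definable_def by (elim exE) (rule exI[of _ "Neg _"], simp)
  show "fo_definable E D (\<lambda>e. P e \<and> Q e)" if PQ: "fo_definable E D P" "fo_definable E D Q" for P Q
  proof -
    obtain \<phi> \<psi> where "\<forall>e. range e \<subseteq> D \<longrightarrow> (sat E D e \<phi> \<longleftrightarrow> P e)"
      "\<forall>e. range e \<subseteq> D \<longrightarrow> (sat E D e \<psi> \<longleftrightarrow> Q e)"
      using PQ unfolding fo_definable_def by (elim exE)
    then show ?thesis unfolding fo_definable_def by (intro exI[of _ "Conj \<phi> \<psi>"]) simp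
  qed
  show "fo_definable E D Q" if "fo_definable E D P" "\<And>e. range e \<subseteq> D \<Longrightarrow> P e \<longleftrightarrow> Q e" for P Q
    using that(1) unfolding fo_definable_def by (elim exE) (rule exI, simp add: that(2))
qed (use D_trans D_upair in auto)

sublocale par: definability E \<C> D "fo_definable_par E D"
proof
  show "fo_definable_par E D (\<lambda>e. \<forall>x\<in>D. R x e)"
    if R: "fo_definable_par E D (\<lambda>e. R (e 0) (\<lambda>i. e (Suc i)))" for R
  proof -
    obtain \<phi> and \<sigma> :: "nat \<Rightarrow> nat + 'v" where \<sigma>: "\<forall>i c. \<sigma> i = Inr c \<longrightarrow> c \<in> D"
      and \<phi>: "\<forall>e. range e \<subseteq> D \<longrightarrow> (sat E D (\<lambda>i. case_sum e (\<lambda>c. c) (\<sigma> i)) \<phi> \<longleftrightarrow> R (e 0) (\<lambda>i. e (Suc i)))"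
      using R unfolding fo_definable_par_def by (elim exE conjE)
    \<comment> \<open>Formula variables that denoted variable 0 of the assignment are captured by
      the new quantifier. All others are moved past it by \<open>f\<close>, and
      \<open>\<tau>\<close> lowers the assignment variables they denote by one.\<close>
    define f where "f i = (if \<sigma> i = Inl 0 then 0 else Suc i)" for i
    define \<tau> where "\<tau> i = (case \<sigma> i of Inl k \<Rightarrow> Inl (k - 1) | Inr c \<Rightarrow> Inr c)" for i
    have env: "(\<lambda>i. case_nat x (\<lambda>i. case_sum e (\<lambda>c. c) (\<tau> i)) (f i)) = (\<lambda>i. case_sum (case_nat x e) (\<lambda>c. c) (\<sigma> i))" for x e
      unfolding f_def \<tau>_def by (auto split: sum.split nat.split intro!: HOL.ext)
    have "sat E D (case_nat x (\<lambda>i. case_sum e (\<lambda>c. c) (\<tau> i))) (rename f \<phi>) \<longleftrightarrow> R x e"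
      if "range e \<subseteq> D" "x \<in> D" for x e
      using \<phi>[rule_format, of "case_nat x e"] that unfolding sat_rename env by simp
    moreover have "\<forall>i c. \<tau> i = Inr c \<longrightarrow> c \<in> D" using \<sigma> by (auto simp: \<tau>_def split: sum.splits)
    ultimately show ?thesis unfolding fo_definable_par_def
      by (intro exI[of _ "Forall (rename f \<phi>)"] exI[of _ \<tau>]) auto
  qed
  show "fo_definable_par E D (\<lambda>e. P (\<lambda>i. e (f i)))" if P: "fo_definable_par E D P" for P f
  proof -
    obtain \<phi> and \<sigma> :: "nat \<Rightarrow> nat + 'v" where \<sigma>: "\<forall>i c. \<sigma> i = Inr c \<longrightarrow> c \<in> D"
      and \<phi>: "\<forall>e. range e \<subseteq> D \<longrightarrow> (sat E D (\<lambda>i. case_sum e (\<lambda>c. c) (\<sigma> i)) \<phi> \<longleftrightarrow> P e)"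
      using P unfolding fo_definable_par_def by (elim exE conjE)
    have env: "(\<lambda>i. case_sum e (\<lambda>c. c) (map_sum f (\<lambda>c. c) (\<sigma> i))) = (\<lambda>i. case_sum (\<lambda>i. e (f i)) (\<lambda>c. c) (\<sigma> i))" for e :: "nat \<Rightarrow> 'v"
      by (auto split: sum.split intro!: HOL.ext)
    have "sat E D (\<lambda>i. case_sum e (\<lambda>c. c) (map_sum f (\<lambda>c. c) (\<sigma> i))) \<phi> \<longleftrightarrow> P (\<lambda>i. e (f i))" if "range e \<subseteq> D" for e
      using \<phi>[rule_format, OF range_renamed[OF that]] unfolding env by simp
    moreover have "\<forall>i c. map_sum f (\<lambda>c. c) (\<sigma> i) = Inr c \<longrightarrow> c \<in> D"
    proof (intro allI impI)
      fix i c assume "map_sum f (\<lambda>c. c) (\<sigma> i) = Inr c"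
      then show "c \<in> D" using \<sigma> by (cases "\<sigma> i") auto
    qed
    ultimately show ?thesis unfolding fo_definable_par_def
      by (intro exI[of _ \<phi>] exI[of _ "\<lambda>i. map_sum f (\<lambda>c. c) (\<sigma> i)"]) auto
  qed
  show "fo_definable_par E D (\<lambda>e. P e \<and> Q e)" if P: "fo_definable_par E D P" and Q: "fo_definable_par E D Q" for P Q
  proof -
    obtain \<phi> and \<sigma> :: "nat \<Rightarrow> nat + 'v" where \<sigma>: "\<forall>i c. \<sigma> i = Inr c \<longrightarrow> c \<in> D"
      and \<phi>: "\<forall>e. range e \<subseteq> D \<longrightarrow> (sat E D (\<lambda>i. case_sum e (\<lambda>c. c) (\<sigma> i)) \<phi> \<longleftrightarrow> P e)"
      using P unfolding fo_definable_par_def by (elim exE conjE)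
    obtain \<psi> and \<tau> :: "nat \<Rightarrow> nat + 'v" where \<tau>: "\<forall>i c. \<tau> i = Inr c \<longrightarrow> c \<in> D"
      and \<psi>: "\<forall>e. range e \<subseteq> D \<longrightarrow> (sat E D (\<lambda>i. case_sum e (\<lambda>c. c) (\<tau> i)) \<psi> \<longleftrightarrow> Q e)"
      using Q unfolding fo_definable_par_def by (elim exE conjE)
    \<comment> \<open>The two formulas may attach different parameters to the same variable, so
      their variables are interleaved: even ones for \<open>\<phi>\<close>, odd ones for
      \<open>\<psi>\<close>.\<close>
    define \<rho> where "\<rho> i = (if even i then \<sigma> (i div 2) else \<tau> (i div 2))" for i
    have "sat E D (\<lambda>i. case_sum e (\<lambda>c. c) (\<rho> i)) (Conj (rename (\<lambda>i. 2 * i) \<phi>) (rename (\<lambda>i. Suc (2 * i)) \<psi>)) \<longleftrightarrow> P e \<and> Q e"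
      if "range e \<subseteq> D" for e
      using \<phi>[rule_format, OF that] \<psi>[rule_format, OF that] by (simp add: sat_rename \<rho>_def)
    moreover have "\<forall>i c. \<rho> i = Inr c \<longrightarrow> c \<in> D" using \<sigma> \<tau> by (auto simp: \<rho>_def)
    ultimately show ?thesis unfolding fo_definable_par_def 
      by (intro exI[of _ "Conj (rename (\<lambda>i. 2 * i) \<phi>) (rename (\<lambda>i. Suc (2 * i)) \<psi>)"] exI[of _ \<rho>])
        (simp del: sat.simps)
  qed
  show "fo_definable_par E D (\<lambda>e. E (e i) (e k))" for i k
    by (rule fo_definable_parI) (rule fo.mem_var)
  show "fo_definable_par E D (\<lambda>e. e i = e k)" for i k
    by (rule fo_definable_parI) (rule fo.eq_var)
  show "fo_definable_par E D (\<lambda>e. \<not> P e)" if "fo_definable_par E D P" for P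
    using that unfolding fo_definable_par_def
    by (elim exE conjE) (rule exI[of _ "Neg _"], rule exI, rule conjI, assumption, simp)
  show "fo_definable_par E D Q" if "fo_definable_par E D P" "\<And>e. range e \<subseteq> D \<Longrightarrow> P e \<longleftrightarrow> Q e" for P Q
    using that(1) unfolding fo_definable_par_def
    by (elim exE conjE) (rule exI, rule exI, rule conjI, assumption, simp add: that(2))
qed (use fo.nonempty D_trans D_upair in auto)

lemma par_const: assumes "c \<in> D" shows "par.definable_term (\<lambda>e. c)"
proof -
  have "fo_definable_par E D (\<lambda>e. e 0 = c)"
    unfolding fo_definable_par_def
    by (rule exI[of _ "Eq 0 1"], rule exI[of _ "case_nat (Inl 0) (\<lambda>i. Inr c)"])
      (use assms in \<open>auto split: nat.splits\<close>)
  then show ?thesis using assms by (simp add: par.definable_term_def)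
qed

lemmas par_intros = par.intros par.pr_term par.sing_term par_const par.subst1[of "ordinal E", OF par.ordinal_definable]
lemmas fo_intros = fo.intros fo.pr_term fo.sing_term fo.subst1[of "ordinal E", OF fo.ordinal_definable]

text \<open>Brings definability with parameters into the form in which \<open>models_ZF\<close>
  states its schemes: variable 0 free, all others parameters from \<open>D\<close>.\<close>

lemma par_formula1:
  assumes "fo_definable_par E D (\<lambda>e. R (e 0))"
  shows "\<exists>\<phi> e. range e \<subseteq> D \<and> (\<forall>x\<in>D. sat E D (case_nat x e) \<phi> \<longleftrightarrow> R x)"
proof -
  obtain \<phi> and \<sigma> :: "nat \<Rightarrow> nat + 'v" where \<sigma>: "\<forall>i c. \<sigma> i = Inr c \<longrightarrow> c \<in> D"
    and \<phi>: "\<forall>e. range e \<subseteq> D \<longrightarrow> (sat E D (\<lambda>i. case_sum e (\<lambda>c. c) (\<sigma> i)) \<phi> \<longleftrightarrow> R (e 0))"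
    using assms unfolding fo_definable_par_def by (elim exE conjE)
  \<comment> \<open>Default for formula variables that denote assignment variables. Those denoting
    variable 0 are redirected by \<open>f\<close>, and \<open>R (e 0)\<close> does not see the
    others.\<close>
  obtain d where d: "d \<in> D" using fo.nonempty by blast
  define f where "f i = (if \<sigma> i = Inl 0 then 0 else Suc i)" for i
  define e where "e i = (case \<sigma> i of Inl k \<Rightarrow> d | Inr c \<Rightarrow> c)" for i
  have "range e \<subseteq> D" using \<sigma> d by (auto simp: e_def split: sum.splits)
  moreover have env: "(\<lambda>i. case_nat x e (f i)) = (\<lambda>i. case_sum (case_nat x (\<lambda>i. d)) (\<lambda>c. c) (\<sigma> i))" for x
    unfolding f_def e_def by (auto split: sum.split nat.split intro!: HOL.ext)
  have "sat E D (case_nat x e) (rename f \<phi>) \<longleftrightarrow> R x" if "x \<in> D" for x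
    using \<phi>[rule_format, of "case_nat x (\<lambda>i. d)"] that d unfolding sat_rename env by simp
  ultimately show ?thesis by blast
qed

lemma par_formula2:
  assumes "fo_definable_par E D (\<lambda>e. R (e 0) (e 1))"
  shows "\<exists>\<phi> e. range e \<subseteq> D \<and> (\<forall>x\<in>D. \<forall>y\<in>D. sat E D (case_nat x (case_nat y e)) \<phi> \<longleftrightarrow> R x y)"
proof -
  obtain \<phi> and \<sigma> :: "nat \<Rightarrow> nat + 'v" where \<sigma>: "\<forall>i c. \<sigma> i = Inr c \<longrightarrow> c \<in> D"
    and \<phi>: "\<forall>e. range e \<subseteq> D \<longrightarrow> (sat E D (\<lambda>i. case_sum e (\<lambda>c. c) (\<sigma> i)) \<phi> \<longleftrightarrow> R (e 0) (e 1))"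
    using assms unfolding fo_definable_par_def by (elim exE conjE)
  obtain d where d: "d \<in> D" using fo.nonempty by blast
  define f where "f i = (if \<sigma> i = Inl 0 then 0 else if \<sigma> i = Inl 1 then Suc 0 else Suc (Suc i))" for i
  define e where "e i = (case \<sigma> i of Inl k \<Rightarrow> d | Inr c \<Rightarrow> c)" for i
  have "range e \<subseteq> D" using \<sigma> d by (auto simp: e_def split: sum.splits)
  moreover have env: "(\<lambda>i. case_nat x (case_nat y e) (f i)) =
      (\<lambda>i. case_sum (case_nat x (case_nat y (\<lambda>i. d))) (\<lambda>c. c) (\<sigma> i))" for x y
    unfolding f_def e_def by (auto split: sum.split nat.split intro!: HOL.ext)
  have "sat E D (case_nat x (case_nat y e)) (rename f \<phi>) \<longleftrightarrow> R x y" if "x \<in> D" "y \<in> D" for x y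
    using \<phi>[rule_format, of "case_nat x (case_nat y (\<lambda>i. d))"] that d unfolding sat_rename env by simp
  ultimately show ?thesis by blast
qed

lemma separation:
  assumes "fo_definable_par E D (\<lambda>e. R (e 0))" "a \<in> D"
  shows "\<exists>s\<in>D. \<forall>x. E x s \<longleftrightarrow> E x a \<and> R x"
proof -
  obtain \<phi> e where e: "range e \<subseteq> D" "\<forall>x\<in>D. sat E D (case_nat x e) \<phi> \<longleftrightarrow> R x"
    using par_formula1[OF assms(1)] by (elim exE conjE)
  have "\<forall>\<phi> e. range e \<subseteq> D \<longrightarrow>
      (\<forall>a\<in>D. \<exists>s\<in>D. \<forall>x\<in>D. E x s \<longleftrightarrow> E x a \<and> sat E D (case_nat x e) \<phi>)"
    using ZF unfolding models_ZF_def by (elim conjE)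
  then obtain s where "s \<in> D" "\<forall>x\<in>D. E x s \<longleftrightarrow> E x a \<and> sat E D (case_nat x e) \<phi>"
    using e(1) assms(2) by meson
  then show ?thesis using e(2) D_mem assms(2) by blast
qed

lemma bounded_comprehension:
  assumes "fo_definable_par E D (\<lambda>e. R (e 0))" "w \<in> D" "\<And>x. R x \<Longrightarrow> x \<in> D \<Longrightarrow> E x w"
  shows "\<exists>s\<in>D. \<forall>x. E x s \<longleftrightarrow> x \<in> D \<and> R x"
  using separation[OF assms(1,2)] assms(2,3) D_mem by blast

lemma replacement_in:
  assumes "fo_definable_par E D (\<lambda>e. R (e 0) (e 1))" "a \<in> D"
    and "\<And>x y z. E x a \<Longrightarrow> y \<in> D \<Longrightarrow> z \<in> D \<Longrightarrow> R x y \<Longrightarrow> R x z \<Longrightarrow> y = z"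
  shows "\<exists>s\<in>D. \<forall>y. E y s \<longleftrightarrow> y \<in> D \<and> (\<exists>x. E x a \<and> R x y)"
proof -
  obtain \<phi> e where e: "range e \<subseteq> D"
    "\<forall>x\<in>D. \<forall>y\<in>D. sat E D (case_nat x (case_nat y e)) \<phi> \<longleftrightarrow> R x y"
    using par_formula2[OF assms(1)] by (elim exE conjE)
  have "\<forall>\<phi> e. range e \<subseteq> D \<longrightarrow>
      (\<forall>a\<in>D.
        (\<forall>x\<in>D. E x a \<longrightarrow> (\<forall>y\<in>D. \<forall>z\<in>D.
          sat E D (case_nat x (case_nat y e)) \<phi> \<and> sat E D (case_nat x (case_nat z e)) \<phi>
            \<longrightarrow> y = z)) \<longrightarrow>
        (\<exists>s\<in>D. \<forall>y\<in>D. E y s \<longleftrightarrow>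
          (\<exists>x\<in>D. E x a \<and> sat E D (case_nat x (case_nat y e)) \<phi>)))"
    using ZF unfolding models_ZF_def by (elim conjE)
  note * = this[THEN spec, THEN spec, THEN mp, OF e(1), THEN bspec, OF assms(2), THEN mp, of \<phi>]
  have "\<exists>s\<in>D. \<forall>y\<in>D. E y s \<longleftrightarrow> (\<exists>x\<in>D. E x a \<and> sat E D (case_nat x (case_nat y e)) \<phi>)"
    by (rule *) (use e(2) assms(3) in simp)
  then obtain s where s: "s \<in> D" "\<forall>y\<in>D. E y s \<longleftrightarrow> (\<exists>x\<in>D. E x a \<and> R x y)"
    using e(2) by auto
  have "E y s \<longleftrightarrow> y \<in> D \<and> (\<exists>x. E x a \<and> R x y)" for y
    using s D_mem assms(2) by blast
  then show ?thesis using s(1) by blast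
qed

text \<open>Through this, foundation for classes of the universe applies to properties defined over
  \<open>D\<close>.\<close>

lemma definable_class_in: assumes "fo_definable_par E D (\<lambda>e. R (e 0))" shows "{x \<in> D. R x} \<in> \<C>"
proof -
  obtain \<phi> e where e: "range e \<subseteq> D" "\<forall>x\<in>D. sat E D (case_nat x e) \<phi> \<longleftrightarrow> R x"
    using par_formula1[OF assms(1)] by (elim exE conjE)
  have "cls.definable_term (\<lambda>d. case_nat (d 0) e i)" for i
    by (cases i) (auto intro: cls_intros)
  then have "predicative E \<C> (\<lambda>d. sat E {x. x \<in> D} (\<lambda>i. case_nat (d 0) e i) \<phi>)"
    by (intro cls.sat_definable) (auto intro: cls_intros D_class)
  then have "predicative E \<C> (\<lambda>d. d 0 \<in> D \<and> sat E D (case_nat (d 0) e) \<phi>)"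
    by (intro cls_intros D_class) simp
  then have "{x. x \<in> D \<and> sat E D (case_nat x e) \<phi>} \<in> \<C>" by (rule comprehension)
  moreover have "{x. x \<in> D \<and> sat E D (case_nat x e) \<phi>} = {x \<in> D. R x}" using e by auto
  ultimately show ?thesis by simp
qed

lemma D_union: assumes "x \<in> D" shows "\<exists>u\<in>D. \<forall>z. E z u \<longleftrightarrow> (\<exists>y. E y x \<and> E z y)"
proof -
  have "\<forall>x\<in>D. \<exists>u\<in>D. \<forall>z\<in>D. E z u \<longleftrightarrow> (\<exists>y\<in>D. E y x \<and> E z y)"
    using ZF unfolding models_ZF_def basic_set_axioms_def by (elim conjE)
  then obtain u where "u \<in> D" "\<forall>z\<in>D. E z u \<longleftrightarrow> (\<exists>y\<in>D. E y x \<and> E z y)" using assms by blast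
  then show ?thesis using assms D_mem by blast
qed

lemma D_pow: assumes "x \<in> D" shows "\<exists>p\<in>D. \<forall>y. E y p \<longleftrightarrow> y \<in> D \<and> ext E y \<subseteq> ext E x"
proof -
  have "\<forall>x\<in>D. \<exists>p\<in>D. \<forall>y\<in>D. E y p \<longleftrightarrow> (\<forall>z\<in>D. E z y \<longrightarrow> E z x)"
    using ZF unfolding models_ZF_def basic_set_axioms_def by (elim conjE)
  then have "\<exists>p\<in>D. \<forall>y\<in>D. E y p \<longleftrightarrow> (\<forall>z\<in>D. E z y \<longrightarrow> E z x)"
    using assms by (rule bspec)
  then obtain p where p: "p \<in> D" "\<forall>y\<in>D. E y p \<longleftrightarrow> (\<forall>z\<in>D. E z y \<longrightarrow> E z x)"
    by (elim bexE) (rule that)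
  have "E y p \<longleftrightarrow> y \<in> D \<and> ext E y \<subseteq> ext E x" for y
  proof (cases "y \<in> D")
    case True
    then have "E y p \<longleftrightarrow> (\<forall>z\<in>D. E z y \<longrightarrow> E z x)" using p(2) by simp
    then show ?thesis using D_mem[OF True] True by auto
  next
    case False
    then show ?thesis using D_mem[OF p(1)] by metis
  qed
  then show ?thesis using p(1) by metis
qed

lemma D_Un: assumes "x \<in> D" "y \<in> D" shows "\<exists>u\<in>D. \<forall>z. E z u \<longleftrightarrow> E z x \<or> E z y"
  using D_union[OF D_upair[OF assms]] by auto

lemma D_insert: assumes "x \<in> D" "a \<in> D" shows "\<exists>u\<in>D. \<forall>z. E z u \<longleftrightarrow> z = x \<or> E z a"
  using D_Un[OF D_upair[OF assms(1,1)] assms(2)] by auto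

end

lemma (in definability) in_dom: "definable_term t \<Longrightarrow> df (\<lambda>e. t e \<in> D)"
  by (rule cong[OF const[of True]]) (simp add: definable_term_def)

section \<open>Recursion in inner models\<close>

text \<open>Recursion inside \<open>D\<close> along a definable, set-like, well-founded relation:
  \<open>G p i f y\<close> says that \<open>y\<close> is the value at \<open>i\<close> when
  \<open>f\<close> collects the earlier values. The parameter \<open>p\<close> stays a variable, so
  the resulting relation is again definable without parameters. The instances are the cumulative
  hierarchy and the enumeration.\<close>

locale recursion = inner E \<C> D for E :: "'v mem" and \<C> and D +
  fixes I :: "'v \<Rightarrow> bool" and lt :: "'v \<Rightarrow> 'v \<Rightarrow> bool"
    and G :: "'v \<Rightarrow> 'v \<Rightarrow> 'v \<Rightarrow> 'v \<Rightarrow> bool"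
  assumes I_def: "fo_definable E D (\<lambda>e. I (e 0))"
    and lt_def: "fo_definable E D (\<lambda>e. lt (e 0) (e 1))"
    and G_def: "fo_definable E D (\<lambda>e. G (e 0) (e 1) (e 2) (e 3))"
    and I_in: "I i \<Longrightarrow> i \<in> D"
    and lt_trans: "I i \<Longrightarrow> I k \<Longrightarrow> I l \<Longrightarrow> lt i k \<Longrightarrow> lt k l \<Longrightarrow> lt i l"
    and lt_irrefl: "I i \<Longrightarrow> \<not> lt i i"
    and below: "I i \<Longrightarrow> \<exists>s\<in>D. \<forall>k. E k s \<longleftrightarrow> I k \<and> lt k i"
    and lt_wf: "X \<in> \<C> \<Longrightarrow> x \<in> X \<Longrightarrow> (\<And>i. i \<in> X \<Longrightarrow> I i) \<Longrightarrow> \<exists>m\<in>X. \<forall>k\<in>X. \<not> lt k m"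
    and G_total: "p \<in> D \<Longrightarrow> I i \<Longrightarrow> f \<in> D \<Longrightarrow> \<exists>!y. y \<in> D \<and> G p i f y"
begin

definition restr :: "'v \<Rightarrow> 'v \<Rightarrow> 'v \<Rightarrow> bool" where
  "restr f i g \<longleftrightarrow> (\<forall>u\<in>D. E u g \<longleftrightarrow> E u f \<and> (\<exists>k\<in>D. \<exists>z\<in>D. u = pr k z \<and> I k \<and> lt k i))"

definition correct :: "'v \<Rightarrow> 'v \<Rightarrow> bool" where
  "correct p f \<longleftrightarrow> (\<forall>u\<in>D. E u f \<longrightarrow> (\<exists>k\<in>D. \<exists>y\<in>D. u = pr k y \<and> I k \<and>
    (\<forall>l\<in>D. I l \<longrightarrow> lt l k \<longrightarrow> (\<exists>z\<in>D. E (pr l z) f)) \<and> (\<exists>g\<in>D. restr f k g \<and> G p k g y)))"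

definition rec :: "'v \<Rightarrow> 'v \<Rightarrow> 'v \<Rightarrow> bool" where
  "rec p i y \<longleftrightarrow> I i \<and> y \<in> D \<and> (\<exists>f\<in>D. correct p f \<and> E (pr i y) f)"

lemmas rec_fo_intros = fo_intros fo.subst1[of I, OF I_def] fo.subst2[of lt, OF lt_def] fo.subst4[of G, OF G_def] fo.in_dom

lemma rec_def_fo: "fo_definable E D (\<lambda>e. rec (e 0) (e 1) (e 2))"
  unfolding rec_def correct_def restr_def by (intro rec_fo_intros)

lemmas rec_par_intros = par_intros
  par.subst1[of I, OF fo_definable_parI, OF I_def]
  par.subst2[of lt, OF fo_definable_parI, OF lt_def]
  par.subst3[of rec, OF fo_definable_parI, OF rec_def_fo]
  par.in_dom

lemma correctD:
  assumes "correct p f" "f \<in> D" "E (pr k y) f"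
  shows "I k" "y \<in> D" "\<And>l. I l \<Longrightarrow> lt l k \<Longrightarrow> \<exists>z. E (pr l z) f"
    "\<exists>g\<in>D. restr f k g \<and> G p k g y"
proof -
  have u: "pr k y \<in> D" using D_mem assms by blast
  from assms(1)[unfolded correct_def, THEN bspec, OF u, THEN mp, OF assms(3)]
  have *: "I k \<and> y \<in> D \<and> (\<forall>l\<in>D. I l \<longrightarrow> lt l k \<longrightarrow> (\<exists>z\<in>D. E (pr l z) f)) \<and> (\<exists>g\<in>D. restr f k g \<and> G p k g y)"
    by auto
  from * show "I k" "y \<in> D" "\<exists>g\<in>D. restr f k g \<and> G p k g y" by auto
  show "\<exists>z. E (pr l z) f" if "I l" "lt l k" for l
    using * that I_in[OF that(1)] by auto
qed

lemma restr_iff: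
  assumes "restr f i g" "f \<in> D" "g \<in> D"
  shows "E u g \<longleftrightarrow> E u f \<and> (\<exists>k z. u = pr k z \<and> I k \<and> lt k i)"
proof (cases "u \<in> D")
  case True
  then show ?thesis using assms(1) by (auto simp: restr_def)
next
  case False
  then show ?thesis using D_mem[OF assms(2), of u] D_mem[OF assms(3), of u] by auto
qed

text \<open>At a minimal disagreement the two restrictions coincide, so \<open>G\<close> yields the
  same value. Taking both attempts equal shows that an attempt is single-valued.\<close>

lemma correct_agree:
  assumes p: "p \<in> D" and f: "correct p f" "f \<in> D" and g: "correct p g" "g \<in> D"
    and "E (pr k y) f" "E (pr k z) g"
  shows "y = z"
proof (rule ccontr)
  let ?X = "{k \<in> D. I k \<and> (\<exists>y\<in>D. \<exists>z\<in>D. E (pr k y) f \<and> E (pr k z) g \<and> y \<noteq> z)}"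
  assume "y \<noteq> z"
  then have "k \<in> ?X"
    using correctD(1,2)[OF f assms(6)] correctD(2)[OF g assms(7)] I_in assms by auto
  moreover have "?X \<in> \<C>"
    by (rule definable_class_in) (intro rec_par_intros f g)
  ultimately have "\<exists>m\<in>?X. \<forall>k\<in>?X. \<not> lt k m" by (intro lt_wf) auto
  then obtain m where m: "m \<in> ?X" "\<forall>k\<in>?X. \<not> lt k m" by (elim bexE) (rule that)
  from m(1) obtain y z where yz: "I m" "E (pr m y) f" "E (pr m z) g" "y \<noteq> z" "y \<in> D" "z \<in> D" by auto
  obtain f' where f': "f' \<in> D" "restr f m f'" "G p m f' y" using correctD(4)[OF f yz(2)] by auto
  obtain g' where g': "g' \<in> D" "restr g m g'" "G p m g' z" using correctD(4)[OF g yz(3)] by auto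
  have same: "a = c" if "I l" "lt l m" "E (pr l a) f" "E (pr l c) g" for l a c
  proof (rule ccontr)
    assume "a \<noteq> c"
    then have "l \<in> ?X" using that correctD(2)[OF f that(3)] correctD(2)[OF g that(4)] I_in by auto
    then show False using m(2)[THEN bspec] that(2) by simp
  qed
  have "f' = g'"
  proof (rule set_eqI)
    fix u
    show "E u f' \<longleftrightarrow> E u g'"
      unfolding restr_iff[OF f'(2) f(2) f'(1)] restr_iff[OF g'(2) g(2) g'(1)]
      using same correctD(3)[OF f yz(2)] correctD(3)[OF g yz(3)] by (metis (no_types))
  qed
  then show False using G_total[OF p yz(1) f'(1)] f' g' yz by blast
qed

lemma rec_unique: "p \<in> D \<Longrightarrow> rec p i y \<Longrightarrow> rec p i z \<Longrightarrow> y = z"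
  unfolding rec_def using correct_agree by blast

lemma rec_in: "rec p i y \<Longrightarrow> I i \<and> y \<in> D"
  by (simp add: rec_def)

lemma restr_rec:
  assumes p: "p \<in> D" and f: "correct p f" "f \<in> D" "E (pr k y) f" "restr f k g" "g \<in> D"
  shows "E u g \<longleftrightarrow> (\<exists>l z. u = pr l z \<and> I l \<and> lt l k \<and> rec p l z)"
proof
  assume "E u g"
  then obtain l z where l: "u = pr l z" "I l" "lt l k" "E u f"
    unfolding restr_iff[OF f(4,2,5)] by auto
  then have "rec p l z" using f(1,2) correctD(2)[OF f(1,2)] unfolding rec_def by blast
  then show "\<exists>l z. u = pr l z \<and> I l \<and> lt l k \<and> rec p l z" using l by blast
next
  assume "\<exists>l z. u = pr l z \<and> I l \<and> lt l k \<and> rec p l z"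
  then obtain l z where l: "u = pr l z" "I l" "lt l k" "rec p l z" by blast
  obtain c where c: "E (pr l c) f" using correctD(3)[OF f(1-3) l(2,3)] by blast
  then have "rec p l c" using f(1,2) correctD(2)[OF f(1,2)] l(2) unfolding rec_def by blast
  then have "c = z" using rec_unique p l(4) by blast
  then show "E u g" unfolding restr_iff[OF f(4,2,5)] using c l by blast
qed

lemma rec_step:
  assumes p: "p \<in> D" and "rec p i y"
  shows "\<exists>g\<in>D. (\<forall>u. E u g \<longleftrightarrow> (\<exists>l z. u = pr l z \<and> I l \<and> lt l i \<and> rec p l z)) \<and> G p i g y"
proof -
  obtain f where f: "correct p f" "f \<in> D" "E (pr i y) f" using assms(2) by (auto simp: rec_def)
  obtain g where "g \<in> D" "restr f i g" "G p i g y" using correctD(4)[OF f] by auto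
  then show ?thesis using restr_rec[OF p f] by blast
qed

lemma rec_exists: assumes p: "p \<in> D" and "I i" shows "\<exists>y. rec p i y"
proof (rule ccontr)
  let ?X = "{i \<in> D. I i \<and> \<not> (\<exists>y\<in>D. rec p i y)}"
  assume "\<nexists>y. rec p i y"
  then have "i \<in> ?X" using assms I_in by auto
  moreover have "?X \<in> \<C>"
    by (rule definable_class_in) (intro rec_par_intros p)
  ultimately have "\<exists>m\<in>?X. \<forall>k\<in>?X. \<not> lt k m" by (intro lt_wf) auto
  then obtain m where m: "m \<in> ?X" "\<forall>k\<in>?X. \<not> lt k m" by (elim bexE) (rule that)
  from m(1) have Im: "I m" and mD: "m \<in> D" by auto
  have ex: "\<exists>y. rec p k y" if "I k" "lt k m" for k
  proof (rule ccontr)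
    assume "\<nexists>y. rec p k y"
    then have "k \<in> ?X" using that(1) I_in by auto
    then show False using m(2)[THEN bspec] that(2) by simp
  qed
  obtain s where s: "s \<in> D" "\<And>k. E k s \<longleftrightarrow> I k \<and> lt k m" using below[OF Im] by auto
  \<comment> \<open>Replacement along the set of indices below \<open>m\<close> collects the earlier
    values in \<open>f\<close>; \<open>h\<close> then adds a value at \<open>m\<close>.\<close>
  have "\<exists>f\<in>D. \<forall>u. E u f \<longleftrightarrow> u \<in> D \<and> (\<exists>k. E k s \<and> (\<exists>y\<in>D. u = pr k y \<and> rec p k y))"
    by (rule replacement_in[OF _ s(1)], intro rec_par_intros p) (use rec_unique p in blast)
  then obtain f where f: "f \<in> D" and "\<And>u. E u f \<longleftrightarrow> u \<in> D \<and> (\<exists>k. E k s \<and> (\<exists>y\<in>D. u = pr k y \<and> rec p k y))"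
    by auto
  then have Ef: "E u f \<longleftrightarrow> (\<exists>k y. u = pr k y \<and> I k \<and> lt k m \<and> rec p k y)" for u
    using s(2) rec_in I_in by (auto intro!: D_mem[OF f])
  obtain y where y: "y \<in> D" "G p m f y" using G_total[OF p Im f] by auto
  obtain h where h: "h \<in> D" "\<And>z. E z h \<longleftrightarrow> z = pr m y \<or> E z f"
    using D_insert[OF _ f, of "pr m y"] mD y(1) by auto
  have total: "\<exists>z\<in>D. E (pr l z) h" if l: "I l" "lt l k" "k = m \<or> (I k \<and> lt k m)" for l k
  proof -
    have "lt l m" using l lt_trans Im by blast
    then obtain z where "rec p l z" using ex l(1) by blast
    then show ?thesis using h(2) Ef l(1) \<open>lt l m\<close> rec_in by blast
  qed
  have "correct p h"
    unfolding correct_def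
  proof (intro ballI impI)
    fix u assume "u \<in> D" "E u h"
    then consider "u = pr m y" | "E u f" using h(2) by blast
    then show "\<exists>k\<in>D. \<exists>y\<in>D. u = pr k y \<and> I k \<and> (\<forall>l\<in>D. I l \<longrightarrow> lt l k \<longrightarrow> (\<exists>z\<in>D. E (pr l z) h)) \<and>
        (\<exists>g\<in>D. restr h k g \<and> G p k g y)"
    proof cases
      case 1
      have "restr h m f"
        unfolding restr_def using h(2) Ef lt_irrefl[OF Im] rec_in I_in by auto
      then show ?thesis using 1 mD y Im f total[of _ m] by (intro bexI[of _ m] bexI[of _ y]) auto
    next
      case 2
      then obtain k z where k: "u = pr k z" "I k" "lt k m" "rec p k z" using Ef by blast
      obtain g where g: "g \<in> D" "\<And>u. E u g \<longleftrightarrow> (\<exists>l z. u = pr l z \<and> I l \<and> lt l k \<and> rec p l z)" "G p k g z"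
        using rec_step[OF p k(4)] by blast
      \<comment> \<open>Hence the new pair at \<open>m\<close> does not enter the restriction of
        \<open>h\<close> to the indices below \<open>k\<close>.\<close>
      have nlt: "\<not> lt m k" using k lt_trans[OF k(2) Im k(2)] lt_irrefl[OF k(2)] by blast
      have "restr h k g"
        unfolding restr_def
      proof
        fix u assume "u \<in> D"
        show "E u g \<longleftrightarrow> E u h \<and> (\<exists>l\<in>D. \<exists>z\<in>D. u = pr l z \<and> I l \<and> lt l k)"
        proof
          assume "E u g"
          then obtain l z where l: "u = pr l z" "I l" "lt l k" "rec p l z" using g by blast
          moreover have "lt l m" using l k lt_trans Im by blast
          ultimately show "E u h \<and> (\<exists>l\<in>D. \<exists>z\<in>D. u = pr l z \<and> I l \<and> lt l k)"
            using h(2) Ef \<open>u \<in> D\<close> by auto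
        next
          assume "E u h \<and> (\<exists>l\<in>D. \<exists>z\<in>D. u = pr l z \<and> I l \<and> lt l k)"
          then obtain l z where l: "u = pr l z" "I l" "lt l k" "E u h" by blast
          then have "l \<noteq> m" using nlt by blast
          then have "rec p l z" using l h(2) Ef by auto
          then show "E u g" using g l by blast
        qed
      qed
      then show ?thesis using k g total[of _ k] rec_in[OF k(4)] I_in by (intro bexI[of _ k] bexI[of _ z]) auto
    qed
  qed
  then have "rec p m y" unfolding rec_def using Im y h by blast
  then show False using m(1) y(1) by blast
qed

end

section \<open>The cumulative hierarchy\<close>

text \<open>Least ordinals replace choice: the relation is thinned to the least
  \<open>\<zeta>\<close> for each \<open>x\<close>, replacement applies, and an ordinal bounds the
  values.\<close>

lemma (in ngb) ordinal_collection:
  assumes "Z \<in> \<C>"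
  shows "\<exists>\<gamma>. ordinal E \<gamma> \<and> (\<forall>x. E x a \<longrightarrow> (\<exists>\<zeta>. ordinal E \<zeta> \<and> pr x \<zeta> \<in> Z) \<longrightarrow> (\<exists>\<zeta>. E \<zeta> \<gamma> \<and> pr x \<zeta> \<in> Z))"
proof -
  let ?P = "\<lambda>x \<zeta>. ordinal E \<zeta> \<and> pr x \<zeta> \<in> Z \<and> (\<forall>\<eta>. E \<eta> \<zeta> \<longrightarrow> pr x \<eta> \<notin> Z)"
  let ?F = "{u. \<exists>x \<zeta>. u = pr x \<zeta> \<and> ?P x \<zeta>}"
  have "?F \<in> \<C>"
    by (rule comprehension) (intro cls_intros ordinal_cls assms)
  moreover have "y = z" if "pr x y \<in> ?F" "pr x z \<in> ?F" for x y z
    using that ordinal_linear[of y z] by auto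
  ultimately have "is_set {\<zeta>. \<exists>x. E x a \<and> pr x \<zeta> \<in> ?F}" by (rule replacement)
  then obtain s where s: "\<And>\<zeta>. E \<zeta> s \<longleftrightarrow> (\<exists>x. E x a \<and> ?P x \<zeta>)" unfolding is_set_iff by auto
  obtain \<gamma> where \<gamma>: "ordinal E \<gamma>" "\<And>\<zeta>. E \<zeta> s \<Longrightarrow> E \<zeta> \<gamma>"
    using ordinal_sup[of s] s by auto
  have "\<exists>\<zeta>. E \<zeta> \<gamma> \<and> pr x \<zeta> \<in> Z" if x: "E x a" "ordinal E \<zeta>" "pr x \<zeta> \<in> Z" for x \<zeta>
  proof -
    have "{\<zeta>. pr x \<zeta> \<in> Z} \<in> \<C>" by (rule comprehension) (intro cls_intros assms)
    then obtain \<eta> where "?P x \<eta>" using ordinal_least[OF _ x(2), of "\<lambda>\<zeta>. pr x \<zeta> \<in> Z"] x(3) by auto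
    moreover from this have "E \<eta> s" using s x(1) by blast
    ultimately show ?thesis using \<gamma>(2) by blast
  qed
  then show ?thesis using \<gamma>(1) by auto
qed

context inner
begin

text \<open>The recursion equation is \<open>V\<^sub>\<zeta> = {x. \<exists>\<eta> < \<zeta>. x \<subseteq> V\<^sub>\<eta>}\<close>.\<close>

definition V_step :: "'v \<Rightarrow> 'v \<Rightarrow> 'v \<Rightarrow> 'v \<Rightarrow> bool" where
  "V_step p i f y \<longleftrightarrow> (\<forall>x\<in>D. E x y \<longleftrightarrow> (\<exists>k\<in>D. \<exists>v\<in>D. E (pr k v) f \<and> (\<forall>z\<in>D. E z x \<longrightarrow> E z v)))"

lemma unique_set:
  assumes "\<exists>s\<in>D. \<forall>x. E x s \<longleftrightarrow> x \<in> D \<and> R x"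
  shows "\<exists>!y. y \<in> D \<and> (\<forall>x\<in>D. E x y \<longleftrightarrow> R x)"
proof -
  obtain s where s: "s \<in> D" "\<And>x. E x s \<longleftrightarrow> x \<in> D \<and> R x" using assms by auto
  show ?thesis
  proof (rule ex1I[of _ s])
    show "s \<in> D \<and> (\<forall>x\<in>D. E x s \<longleftrightarrow> R x)" using s by auto
    show "y = s" if "y \<in> D \<and> (\<forall>x\<in>D. E x y \<longleftrightarrow> R x)" for y
      using that s D_mem by (intro set_eqI) (metis (no_types))
  qed
qed

lemma pr_components: assumes "f \<in> D" obtains w where "w \<in> D" "\<And>x y. E (pr x y) f \<Longrightarrow> E x w \<and> E y w"
proof -
  obtain u where u: "u \<in> D" "\<And>z. E z u \<longleftrightarrow> (\<exists>y. E y f \<and> E z y)" using D_union[OF assms] by auto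
  obtain w where w: "w \<in> D" "\<And>z. E z w \<longleftrightarrow> (\<exists>y. E y u \<and> E z y)" using D_union[OF u(1)] by auto
  have "E x w \<and> E y w" if "E (pr x y) f" for x y
  proof -
    have "E (upair x y) u" using that u(2) unfolding pr_def by (metis E_upair)
    then show ?thesis using w(2) by (metis E_upair)
  qed
  then show ?thesis using that w(1) by blast
qed

sublocale V: recursion E \<C> D "ordinal E" E V_step
proof
  show "fo_definable E D (\<lambda>e. V_step (e 0) (e 1) (e 2) (e 3))"
    unfolding V_step_def by (intro fo_intros)
  show "fo_definable E D (\<lambda>e. ordinal E (e 0))" by (rule fo.ordinal_definable)
  show "fo_definable E D (\<lambda>e. E (e 0) (e 1))" by (rule fo.mem_var)
  show "\<exists>s\<in>D. \<forall>k. E k s \<longleftrightarrow> ordinal E k \<and> E k i" if "ordinal E i" for i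
    using that ordinal_mem ordinal_in by (intro bexI[of _ i]) auto
  show "\<exists>m\<in>X. \<forall>k\<in>X. \<not> E k m" if "X \<in> \<C>" "x \<in> X" for X x
    using foundation that by blast
  show "\<exists>!y. y \<in> D \<and> V_step p i f y" if f: "p \<in> D" "ordinal E i" "f \<in> D" for p i f
    unfolding V_step_def
  proof (rule unique_set)
    obtain w where w: "w \<in> D" "\<And>x y. E (pr x y) f \<Longrightarrow> E x w \<and> E y w" using pr_components[OF f(3)] by blast
    obtain u where u: "u \<in> D" "\<And>z. E z u \<longleftrightarrow> (\<exists>y. E y w \<and> E z y)" using D_union[OF w(1)] by auto
    obtain q where q: "q \<in> D" "\<And>y. E y q \<longleftrightarrow> y \<in> D \<and> ext E y \<subseteq> ext E u" using D_pow[OF u(1)] by auto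
    show "\<exists>s\<in>D. \<forall>x. E x s \<longleftrightarrow> x \<in> D \<and> (\<exists>k\<in>D. \<exists>v\<in>D. E (pr k v) f \<and> (\<forall>z\<in>D. E z x \<longrightarrow> E z v))"
    proof (rule bounded_comprehension[OF _ q(1)])
      show "fo_definable_par E D (\<lambda>e. \<exists>k\<in>D. \<exists>v\<in>D. E (pr k v) f \<and> (\<forall>z\<in>D. E z (e 0) \<longrightarrow> E z v))"
        by (intro par_intros f)
      show "E x q" if x: "\<exists>k\<in>D. \<exists>v\<in>D. E (pr k v) f \<and> (\<forall>z\<in>D. E z x \<longrightarrow> E z v)" "x \<in> D" for x
      proof -
        obtain k v where v: "E (pr k v) f" "\<forall>z\<in>D. E z x \<longrightarrow> E z v" using x(1) by blast
        then have "E z u" if "E z x" for z using D_mem[OF x(2) that] that u(2) w(2)[OF v(1)] by blast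
        then show ?thesis using q(2) x(2) by auto
      qed
    qed
  qed
qed (use ordinal_in ordinal_trans in auto)

definition VV :: "'v \<Rightarrow> 'v" where
  "VV \<zeta> = (THE v. V.rec zero \<zeta> v)"

lemma zero_in: "zero \<in> D"
  using ordinal_in ordinal_zero by blast

lemma V_rec: assumes "ordinal E \<zeta>" shows "V.rec zero \<zeta> v \<longleftrightarrow> v = VV \<zeta>"
  unfolding VV_def using V.rec_exists[OF zero_in assms] V.rec_unique[OF zero_in] by (metis the_equality)

lemma VV_in: assumes "ordinal E \<zeta>" shows "VV \<zeta> \<in> D"
  using V_rec[OF assms, of "VV \<zeta>"] V.rec_in by blast

lemma E_VV: assumes "ordinal E \<zeta>" shows "E x (VV \<zeta>) \<longleftrightarrow> x \<in> D \<and> (\<exists>\<eta>. E \<eta> \<zeta> \<and> ext E x \<subseteq> ext E (VV \<eta>))"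
proof -
  obtain g where g: "g \<in> D" "\<And>u. E u g \<longleftrightarrow> (\<exists>l z. u = pr l z \<and> ordinal E l \<and> E l \<zeta> \<and> V.rec zero l z)"
    "V_step zero \<zeta> g (VV \<zeta>)"
    using V.rec_step[OF zero_in, of \<zeta> "VV \<zeta>"] V_rec[OF assms] by auto
  have Eg: "E (pr l z) g \<longleftrightarrow> E l \<zeta> \<and> z = VV l" for l z
    unfolding g(2) using V_rec ordinal_mem[OF assms] by auto
  have "E x (VV \<zeta>) \<longleftrightarrow> (\<exists>\<eta>. E \<eta> \<zeta> \<and> ext E x \<subseteq> ext E (VV \<eta>))" if x: "x \<in> D"
  proof -
    have *: "(\<forall>z\<in>D. E z x \<longrightarrow> E z v) \<longleftrightarrow> ext E x \<subseteq> ext E v" for v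
      using D_mem[OF x] by auto
    have "E x (VV \<zeta>) \<longleftrightarrow> (\<exists>k\<in>D. \<exists>v\<in>D. E (pr k v) g \<and> ext E x \<subseteq> ext E v)"
      using g(3)[unfolded V_step_def, THEN bspec, OF x] unfolding * .
    also have "\<dots> \<longleftrightarrow> (\<exists>\<eta>. E \<eta> \<zeta> \<and> ext E x \<subseteq> ext E (VV \<eta>))"
      unfolding Eg using ordinal_in VV_in ordinal_mem[OF assms] by blast
    finally show ?thesis .
  qed
  then show ?thesis using D_mem[OF VV_in[OF assms], of x] by auto
qed

lemma VV_mono: "ordinal E \<zeta> \<Longrightarrow> ordinal E \<xi> \<Longrightarrow> ext E \<zeta> \<subseteq> ext E \<xi> \<Longrightarrow> E x (VV \<zeta>) \<Longrightarrow> E x (VV \<xi>)"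
  unfolding E_VV by (metis in_ext_iff subsetD)

lemma VV_mono': assumes "ordinal E \<xi>" "E \<zeta> \<xi>" "E x (VV \<zeta>)" shows "E x (VV \<xi>)"
proof (rule VV_mono[OF ordinal_mem[OF assms(1,2)] assms(1) _ assms(3)])
  show "ext E \<zeta> \<subseteq> ext E \<xi>" using ordinal_trans[OF assms(1,2)] by auto
qed

lemma VV_trans: assumes "ordinal E \<zeta>" "E x (VV \<zeta>)" "E y x" shows "E y (VV \<zeta>)"
proof -
  obtain \<eta> where \<eta>: "E \<eta> \<zeta>" "ext E x \<subseteq> ext E (VV \<eta>)" using assms E_VV by blast
  then have "E y (VV \<eta>)" using assms(3) by auto
  then show ?thesis using VV_mono'[OF assms(1) \<eta>(1)] by blast
qed

lemmas V_fo = fo.subst3[of "V.rec", OF V.rec_def_fo]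

definition V_mem :: "'v \<Rightarrow> 'v \<Rightarrow> bool" where
  "V_mem x \<zeta> \<longleftrightarrow> ordinal E \<zeta> \<and> E x (VV \<zeta>)"

text \<open>The set \<open>zero\<close> handed to the recursion is described by its emptiness, so
  the relation becomes definable without parameters.\<close>

lemma V_mem_alt: "V_mem x \<zeta> \<longleftrightarrow> (\<exists>v\<in>D. \<exists>z\<in>D. (\<forall>u\<in>D. \<not> E u z) \<and> V.rec z \<zeta> v \<and> E x v)"
proof -
  have z: "(\<forall>u\<in>D. \<not> E u z) \<longleftrightarrow> z = zero" if "z \<in> D" for z
    using that D_mem[OF that] E_zero by (metis set_eqI)
  have "(\<exists>v\<in>D. \<exists>z\<in>D. (\<forall>u\<in>D. \<not> E u z) \<and> V.rec z \<zeta> v \<and> E x v) \<longleftrightarrow> (\<exists>v\<in>D. V.rec zero \<zeta> v \<and> E x v)"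
    using z zero_in by blast
  also have "\<dots> \<longleftrightarrow> V_mem x \<zeta>"
  proof (cases "ordinal E \<zeta>")
    case True
    show ?thesis unfolding V_mem_def V_rec[OF True] using True VV_in[OF True] by auto
  next
    case False
    then show ?thesis unfolding V_mem_def using V.rec_in[of zero \<zeta>] by auto
  qed
  finally show ?thesis by simp
qed

lemma V_mem_def_fo: "fo_definable E D (\<lambda>e. V_mem (e 0) (e 1))"
  unfolding V_mem_alt by (intro fo_intros V_fo)

lemmas V_mem_fo = fo.subst2[of V_mem, OF V_mem_def_fo]
lemmas V_mem_par = par.subst2[of V_mem, OF fo_definable_parI, OF V_mem_def_fo]

lemma V_mem_class: "{u. \<exists>x \<zeta>. u = pr x \<zeta> \<and> V_mem x \<zeta>} \<in> \<C>"
proof -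
  have "{u \<in> D. \<exists>x\<in>D. \<exists>\<zeta>\<in>D. u = pr x \<zeta> \<and> V_mem x \<zeta>} \<in> \<C>"
    by (rule definable_class_in) (intro par_intros V_mem_par)
  moreover have "{u \<in> D. \<exists>x\<in>D. \<exists>\<zeta>\<in>D. u = pr x \<zeta> \<and> V_mem x \<zeta>} = {u. \<exists>x \<zeta>. u = pr x \<zeta> \<and> V_mem x \<zeta>}"
  proof -
    have "x \<in> D \<and> \<zeta> \<in> D" if "V_mem x \<zeta>" for x \<zeta>
      using that unfolding V_mem_def using ordinal_in D_mem[OF VV_in] by blast
    then show ?thesis by auto
  qed
  ultimately show ?thesis by simp
qed

text \<open>At a membership-minimal set without a rank all elements have ranks; collecting these
  below some \<open>\<gamma>\<close> puts the set into the level
  \<open>suc \<gamma>\<close>.\<close>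

lemma in_VV: assumes "x \<in> D" shows "\<exists>\<zeta>. V_mem x \<zeta>"
proof (rule ccontr)
  let ?X = "{x \<in> D. \<not> (\<exists>\<zeta>\<in>D. V_mem x \<zeta>)}" and ?Z = "{u. \<exists>x \<zeta>. u = pr x \<zeta> \<and> V_mem x \<zeta>}"
  assume "\<nexists>\<zeta>. V_mem x \<zeta>"
  then have "x \<in> ?X" using assms by auto
  moreover have "?X \<in> \<C>"
    by (rule definable_class_in) (intro par_intros V_mem_par)
  ultimately have "\<exists>m\<in>?X. \<forall>k\<in>?X. \<not> E k m" by (intro foundation)
  then obtain m where m: "m \<in> ?X" "\<forall>k\<in>?X. \<not> E k m" by (elim bexE) (rule that)
  have ex: "\<exists>\<zeta>. V_mem y \<zeta>" if "E y m" for y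
  proof (rule ccontr)
    assume "\<nexists>\<zeta>. V_mem y \<zeta>"
    then have "y \<in> ?X" using that m(1) D_mem by auto
    then show False using m(2)[THEN bspec] that by simp
  qed
  obtain \<gamma> where \<gamma>: "ordinal E \<gamma>"
    "\<forall>y. E y m \<longrightarrow> (\<exists>\<zeta>. ordinal E \<zeta> \<and> pr y \<zeta> \<in> ?Z) \<longrightarrow> (\<exists>\<zeta>. E \<zeta> \<gamma> \<and> pr y \<zeta> \<in> ?Z)"
    using ordinal_collection[OF V_mem_class, of m] by auto
  have "E y (VV \<gamma>)" if "E y m" for y
  proof -
    obtain \<zeta> where "V_mem y \<zeta>" using ex \<open>E y m\<close> by blast
    then have "ordinal E \<zeta> \<and> pr y \<zeta> \<in> ?Z" by (auto simp: V_mem_def)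
    then have "\<exists>\<zeta>. E \<zeta> \<gamma> \<and> pr y \<zeta> \<in> ?Z" using \<gamma>(2) that by blast
    then have "\<exists>\<zeta>. E \<zeta> \<gamma> \<and> V_mem y \<zeta>" by auto
    then show ?thesis using VV_mono'[OF \<gamma>(1)] unfolding V_mem_def by blast
  qed
  then have "V_mem m (suc \<gamma>)"
    using E_VV[OF ordinal_suc[OF \<gamma>(1)], of m] m(1) ordinal_suc[OF \<gamma>(1)] unfolding V_mem_def
    by (auto intro!: exI[of _ \<gamma>])
  then show False using m(1) ordinal_in[OF ordinal_suc[OF \<gamma>(1)]] by auto
qed

text \<open>Scott's trick: \<open>x\<close> is replaced by ordinals \<open>\<zeta>\<close> with
  \<open>x\<close> in \<open>VV \<zeta>\<close>. Here \<open>Z\<close> may be any class, also one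
  that is not definable over \<open>D\<close>, because replacement is taken in the universe, whose
  ordinals all lie in \<open>D\<close>.\<close>

lemma collection:
  assumes "Z \<in> \<C>"
  shows "\<exists>\<gamma>. ordinal E \<gamma> \<and> (\<forall>e. E e a \<longrightarrow> (\<exists>x\<in>D. pr e x \<in> Z) \<longrightarrow> (\<exists>x. E x (VV \<gamma>) \<and> pr e x \<in> Z))"
proof -
  let ?V = "{u. \<exists>x \<zeta>. u = pr x \<zeta> \<and> V_mem x \<zeta>}"
  let ?Z = "{u. \<exists>e \<zeta> x. u = pr e \<zeta> \<and> pr x \<zeta> \<in> ?V \<and> pr e x \<in> Z}"
  have "?Z \<in> \<C>"
    by (rule comprehension) (intro cls_intros V_mem_class assms)
  then obtain \<gamma> where \<gamma>: "ordinal E \<gamma>"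
    "\<forall>e. E e a \<longrightarrow> (\<exists>\<zeta>. ordinal E \<zeta> \<and> pr e \<zeta> \<in> ?Z) \<longrightarrow> (\<exists>\<zeta>. E \<zeta> \<gamma> \<and> pr e \<zeta> \<in> ?Z)"
    using ordinal_collection[of ?Z a] by auto
  have "\<exists>x. E x (VV \<gamma>) \<and> pr e x \<in> Z" if e: "E e a" and x: "x \<in> D" "pr e x \<in> Z" for e x
  proof -
    obtain \<zeta> where "V_mem x \<zeta>" using in_VV x(1) by blast
    then have "ordinal E \<zeta> \<and> pr e \<zeta> \<in> ?Z" using x(2) by (auto simp: V_mem_def)
    then have "\<exists>\<zeta>. E \<zeta> \<gamma> \<and> pr e \<zeta> \<in> ?Z" using \<gamma>(2) e by blast
    then obtain \<eta> y where "E \<eta> \<gamma>" "V_mem y \<eta>" "pr e y \<in> Z" by auto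
    then show ?thesis using VV_mono'[OF \<gamma>(1)] unfolding V_mem_def by blast
  qed
  then show ?thesis using \<gamma>(1) by blast
qed

end

section \<open>Set operations that generate the definable relations\<close>

text \<open>A variant of the Goedel operations. \<open>Diff\<close>, \<open>Prod\<close> and
  \<open>Ran\<close> handle connectives and quantifiers; \<open>Ins\<close>, \<open>FMem\<close>,
  \<open>FCon\<close> and \<open>FEq\<close> handle atomic formulas; \<open>Dom\<close> projects to
  the first coordinate, and \<open>BigUn\<close> unpacks a singleton. All are treated as binary, so
  that one shape of index codes every application.\<close>

datatype gop = Diff | Prod | Ran | Ins | FMem | FCon | FEq | Dom | BigUn

context ngb
begin

text \<open>
  Relations are sets of nested pairs \<open>(x\<^sub>0, (x\<^sub>1, (\<dots>, \<emptyset>)))\<close>.  Only the first two coordinates can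
  be compared; \<open>Ins\<close> inserts a dummy second coordinate.
\<close>

primrec op_set :: "gop \<Rightarrow> 'v set \<Rightarrow> 'v set \<Rightarrow> 'v set" where
  "op_set Diff A B = A - B"
| "op_set Prod A B = {u. \<exists>x\<in>A. \<exists>y\<in>B. u = pr x y}"
| "op_set Ran A B = {u. \<exists>x. pr x u \<in> A}"
| "op_set Ins A B = {u. \<exists>x e. \<exists>y\<in>B. u = pr x (pr y e) \<and> pr x e \<in> A}"
| "op_set FMem A B = {u\<in>A. \<exists>x y e. u = pr x (pr y e) \<and> E x y}"
| "op_set FCon A B = {u\<in>A. \<exists>x y e. u = pr x (pr y e) \<and> E y x}"
| "op_set FEq A B = {u\<in>A. \<exists>x y e. u = pr x (pr y e) \<and> x = y}"
| "op_set Dom A B = {u. \<exists>y. pr u y \<in> A}"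
| "op_set BigUn A B = {u. \<exists>x\<in>A. E u x}"

end

context definability
begin

lemma op_set_definable: "df (\<lambda>e. e 0 \<in> op_set g (ext E (e 1)) (ext E (e 2)))"
proof -
  have m1: "x \<in> D" if "range e \<subseteq> D" "E x (e i)" for e x i
    using that mem_closed[of "e i" x] by auto
  have m2: "x \<in> D \<and> y \<in> D" if "range e \<subseteq> D" "E (pr x y) (e i)" for e x y i
    using m1[OF that] by simp
  have m4: "x \<in> D \<and> y \<in> D \<and> z \<in> D" if "range e \<subseteq> D" "e i = pr x (pr y z)" for e x y z i
    using that by (metis pr_closed_iff rangeI subsetD)
  show ?thesis
  proof (cases g)
    case Diff
    have "df (\<lambda>e. E (e 0) (e 1) \<and> \<not> E (e 0) (e 2))" by (intro intros pr_term)
    then show ?thesis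
      by (rule cong) (simp add: Diff)
  next
    case Prod
    have "df (\<lambda>e. \<exists>x\<in>D. \<exists>y\<in>D. E x (e 1) \<and> E y (e 2) \<and> e 0 = pr x y)" by (intro intros pr_term)
    then show ?thesis
    proof (rule cong)
      fix e :: "nat \<Rightarrow> 'v"
      assume "range e \<subseteq> D"
      note * = m1[OF this]
      show "(\<exists>x\<in>D. \<exists>y\<in>D. E x (e 1) \<and> E y (e 2) \<and> e 0 = pr x y) \<longleftrightarrow> e 0 \<in> op_set g (ext E (e 1)) (ext E (e 2))"
        unfolding Prod op_set.simps mem_Collect_eq Bex_def in_ext_iff using * by blast
    qed
  next
    case Ran
    have "df (\<lambda>e. \<exists>x\<in>D. E (pr x (e 0)) (e 1))" by (intro intros pr_term)
    then show ?thesis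
    proof (rule cong)
      fix e :: "nat \<Rightarrow> 'v"
      assume "range e \<subseteq> D"
      note * = m2[OF this]
      show "(\<exists>x\<in>D. E (pr x (e 0)) (e 1)) \<longleftrightarrow> e 0 \<in> op_set g (ext E (e 1)) (ext E (e 2))"
        unfolding Ran op_set.simps mem_Collect_eq Bex_def in_ext_iff using * by blast
    qed
  next
    case Ins
    have "df (\<lambda>e. \<exists>x\<in>D. \<exists>d\<in>D. \<exists>y\<in>D. E y (e 2) \<and> e 0 = pr x (pr y d) \<and> E (pr x d) (e 1))" by (intro intros pr_term)
    then show ?thesis
    proof (rule cong)
      fix e :: "nat \<Rightarrow> 'v"
      assume "range e \<subseteq> D"
      note * = m4[OF this]
      show "(\<exists>x\<in>D. \<exists>d\<in>D. \<exists>y\<in>D. E y (e 2) \<and> e 0 = pr x (pr y d) \<and> E (pr x d) (e 1)) \<longleftrightarrow> e 0 \<in> op_set g (ext E (e 1)) (ext E (e 2))"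
        unfolding Ins op_set.simps mem_Collect_eq Bex_def in_ext_iff using * by blast
    qed
  next
    case FMem
    have "df (\<lambda>e. E (e 0) (e 1) \<and> (\<exists>x\<in>D. \<exists>y\<in>D. \<exists>d\<in>D. e 0 = pr x (pr y d) \<and> E x y))" by (intro intros pr_term)
    then show ?thesis
    proof (rule cong)
      fix e :: "nat \<Rightarrow> 'v"
      assume "range e \<subseteq> D"
      note * = m4[OF this]
      show "(E (e 0) (e 1) \<and> (\<exists>x\<in>D. \<exists>y\<in>D. \<exists>d\<in>D. e 0 = pr x (pr y d) \<and> E x y)) \<longleftrightarrow> e 0 \<in> op_set g (ext E (e 1)) (ext E (e 2))"
        unfolding FMem op_set.simps mem_Collect_eq Bex_def in_ext_iff using * by blast
    qed
  next
    case FCon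
    have "df (\<lambda>e. E (e 0) (e 1) \<and> (\<exists>x\<in>D. \<exists>y\<in>D. \<exists>d\<in>D. e 0 = pr x (pr y d) \<and> E y x))" by (intro intros pr_term)
    then show ?thesis
    proof (rule cong)
      fix e :: "nat \<Rightarrow> 'v"
      assume "range e \<subseteq> D"
      note * = m4[OF this]
      show "(E (e 0) (e 1) \<and> (\<exists>x\<in>D. \<exists>y\<in>D. \<exists>d\<in>D. e 0 = pr x (pr y d) \<and> E y x)) \<longleftrightarrow> e 0 \<in> op_set g (ext E (e 1)) (ext E (e 2))"
        unfolding FCon op_set.simps mem_Collect_eq Bex_def in_ext_iff using * by blast
    qed
  next
    case FEq
    have "df (\<lambda>e. E (e 0) (e 1) \<and> (\<exists>x\<in>D. \<exists>y\<in>D. \<exists>d\<in>D. e 0 = pr x (pr y d) \<and> x = y))" by (intro intros pr_term)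
    then show ?thesis
    proof (rule cong)
      fix e :: "nat \<Rightarrow> 'v"
      assume "range e \<subseteq> D"
      note * = m4[OF this]
      show "(E (e 0) (e 1) \<and> (\<exists>x\<in>D. \<exists>y\<in>D. \<exists>d\<in>D. e 0 = pr x (pr y d) \<and> x = y)) \<longleftrightarrow> e 0 \<in> op_set g (ext E (e 1)) (ext E (e 2))"
        unfolding FEq op_set.simps mem_Collect_eq Bex_def in_ext_iff using * by blast
    qed
  next
    case Dom
    have "df (\<lambda>e. \<exists>x\<in>D. E (pr (e 0) x) (e 1))" by (intro intros pr_term)
    then show ?thesis
    proof (rule cong)
      fix e :: "nat \<Rightarrow> 'v"
      assume "range e \<subseteq> D"
      note * = m2[OF this]
      show "(\<exists>x\<in>D. E (pr (e 0) x) (e 1)) \<longleftrightarrow> e 0 \<in> op_set g (ext E (e 1)) (ext E (e 2))"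
        unfolding Dom op_set.simps mem_Collect_eq Bex_def in_ext_iff using * by blast
    qed
  next
    case BigUn
    have "df (\<lambda>e. \<exists>x\<in>D. E x (e 1) \<and> E (e 0) x)" by (intro intros pr_term)
    then show ?thesis
    proof (rule cong)
      fix e :: "nat \<Rightarrow> 'v"
      assume "range e \<subseteq> D"
      note * = m1[OF this]
      show "(\<exists>x\<in>D. E x (e 1) \<and> E (e 0) x) \<longleftrightarrow> e 0 \<in> op_set g (ext E (e 1)) (ext E (e 2))"
        unfolding BigUn op_set.simps mem_Collect_eq Bex_def in_ext_iff using * by blast
    qed
  qed
qed

end

context inner
begin

lemma pair_bound:
  assumes "a \<in> D"
  shows "\<exists>w\<in>D. (\<forall>x. E x a \<longrightarrow> E x w) \<and> (\<forall>x y. E x a \<longrightarrow> E y a \<longrightarrow> E (pr x y) w)"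
proof -
  obtain p where p: "p \<in> D" "\<And>y. E y p \<longleftrightarrow> y \<in> D \<and> ext E y \<subseteq> ext E a" using D_pow[OF assms] by auto
  obtain q where q: "q \<in> D" "\<And>y. E y q \<longleftrightarrow> y \<in> D \<and> ext E y \<subseteq> ext E p" using D_pow[OF p(1)] by auto
  obtain w where w: "w \<in> D" "\<And>z. E z w \<longleftrightarrow> E z a \<or> E z q" using D_Un[OF assms q(1)] by auto
  have "E (pr x y) q" if "E x a" "E y a" for x y
  proof -
    have xy: "x \<in> D" "y \<in> D" using that D_mem assms by auto
    then have "E (sing x) p" "E (upair x y) p" unfolding p(2) using that by (auto simp: D_upair)
    then show ?thesis unfolding q(2) using xy by (simp add: pr_def D_upair)
  qed
  then show ?thesis using w by blast
qed

lemma trans_pr: assumes "transitive E (ext E t)" "E (pr x y) t" shows "E x t \<and> E y t"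
proof -
  have "E (upair x y) t" using assms unfolding transitive_def pr_def by (metis E_upair in_ext_iff subsetD)
  then show ?thesis using assms(1) unfolding transitive_def by (metis E_upair in_ext_iff subsetD)
qed

lemma transitive_superset: assumes "a \<in> D" obtains t where "t \<in> D" "E a t" "transitive E (ext E t)"
proof -
  obtain \<zeta> where z: "ordinal E \<zeta>" "E a (VV \<zeta>)" using in_VV[OF assms] by (auto simp: V_mem_def)
  moreover have "transitive E (ext E (VV \<zeta>))"
    unfolding transitive_def using VV_trans[OF z(1)] by auto
  ultimately show ?thesis using that VV_in by blast
qed

text \<open>One bound serves all operations and all operands from \<open>t\<close>. The enumeration
  step needs this uniformity, since it searches its operands among all earlier values.\<close>

lemma op_bound:
  assumes "t \<in> D" and t: "transitive E (ext E t)"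
  shows "\<exists>w\<in>D. \<forall>g X Y u. E X t \<longrightarrow> E Y t \<longrightarrow> u \<in> op_set g (ext E X) (ext E Y) \<longrightarrow> E u w"
proof -
  obtain v where v: "v \<in> D" "\<And>x. E x t \<Longrightarrow> E x v" "\<And>x y. E x t \<Longrightarrow> E y t \<Longrightarrow> E (pr x y) v"
    using pair_bound[OF assms(1)] by auto
  \<comment> \<open>A second round of pairing accommodates \<open>Ins\<close>, whose elements
    \<open>pr x (pr y e)\<close> are nested pairs.\<close>
  obtain w where w: "w \<in> D" "\<And>x. E x v \<Longrightarrow> E x w" "\<And>x y. E x v \<Longrightarrow> E y v \<Longrightarrow> E (pr x y) w"
    using pair_bound[OF v(1)] by auto
  have tr: "E z t" if "E z X" "E X t" for z X
    using t that unfolding transitive_def by (metis in_ext_iff subsetD)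
  have "E u w" if X: "E X t" and Y: "E Y t" and u: "u \<in> op_set g (ext E X) (ext E Y)" for g X Y u
  proof (cases g)
    case Prod
    then show ?thesis using u v(2,3) w(2,3) tr[OF _ X] tr[OF _ Y] by auto
  next
    case Ran
    then obtain x where "E (pr x u) X" using u by auto
    then show ?thesis using trans_pr[OF t] tr[OF _ X] v(2) w(2) by blast
  next
    case Dom
    then obtain x where "E (pr u x) X" using u by auto
    then show ?thesis using trans_pr[OF t] tr[OF _ X] v(2) w(2) by blast
  next
    case Ins
    then obtain x e y where "u = pr x (pr y e)" "E y Y" "E (pr x e) X" using u by auto
    then show ?thesis using trans_pr[OF t, of x e] tr[OF _ X] tr[OF _ Y] v(2,3) w(2,3) by auto
  next
    case BigUn
    then show ?thesis using u tr[OF _ X] tr v(2) w(2) by auto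
  qed (use u tr[OF _ X] v(2) w(2) in auto)
  then show ?thesis using w(1) by blast
qed

lemma op_closed:
  assumes "X \<in> D" "Y \<in> D"
  shows "\<exists>Z\<in>D. ext E Z = op_set g (ext E X) (ext E Y)"
proof -
  obtain t where t: "t \<in> D" "E (pr X Y) t" "transitive E (ext E t)"
    using transitive_superset[of "pr X Y"] assms by auto
  then have XY: "E X t" "E Y t" using trans_pr by blast+
  obtain w where w: "w \<in> D" "\<And>g X Y u. E X t \<Longrightarrow> E Y t \<Longrightarrow> u \<in> op_set g (ext E X) (ext E Y) \<Longrightarrow> E u w"
    using op_bound[OF t(1,3)] by auto
  have "fo_definable_par E D (\<lambda>e. e 0 \<in> op_set g (ext E X) (ext E Y))"
    by (rule par.subst3[of "\<lambda>u X Y. u \<in> op_set g (ext E X) (ext E Y)", OF par.op_set_definable])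
      (intro par_intros assms)+
  from separation[OF this w(1)] obtain Z where "Z \<in> D"
    "\<And>u. E u Z \<longleftrightarrow> E u w \<and> u \<in> op_set g (ext E X) (ext E Y)" by auto
  then show ?thesis using w(2)[OF XY] by (intro bexI[of _ Z]) auto
qed

end

section \<open>Solution sets of formulas\<close>

primrec fv_below :: "fm \<Rightarrow> nat \<Rightarrow> bool" where
  "fv_below (Mem i k) n \<longleftrightarrow> i < n \<and> k < n"
| "fv_below (Eq i k) n \<longleftrightarrow> i < n \<and> k < n"
| "fv_below (Neg \<phi>) n \<longleftrightarrow> fv_below \<phi> n"
| "fv_below (Conj \<phi> \<psi>) n \<longleftrightarrow> fv_below \<phi> n \<and> fv_below \<psi> n"
| "fv_below (Forall \<phi>) n \<longleftrightarrow> fv_below \<phi> (Suc n)"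

lemma fv_below_mono: "fv_below \<phi> m \<Longrightarrow> m \<le> n \<Longrightarrow> fv_below \<phi> n"
  by (induction \<phi> arbitrary: m n) auto

lemma fv_below_exists: "\<exists>n. fv_below \<phi> n"
proof (induction \<phi>)
  case (Mem i k)
  then show ?case by (auto intro!: exI[of _ "Suc (i + k)"])
next
  case (Eq i k)
  then show ?case by (auto intro!: exI[of _ "Suc (i + k)"])
next
  case (Conj \<phi> \<psi>)
  then obtain m n where "fv_below \<phi> m" "fv_below \<psi> n" by auto
  then show ?case using fv_below_mono[of _ _ "max m n"] by (auto intro!: exI[of _ "max m n"])
next
  case (Forall \<phi>)
  then obtain n where "fv_below \<phi> n" by auto
  then show ?case using fv_below_mono[of \<phi> n "Suc n"] by auto
qed auto

lemma asg_Cons: "case_nat x (asg c xs) = asg c (x # xs)"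
  by (rule HOL.ext) (auto simp: asg_def split: nat.split)

text \<open>Variables beyond the list denote \<open>b\<close> anyway. Hence a list can be lengthened
  until it covers the free variables of a formula.\<close>

lemma asg_pad: "asg b (xs @ replicate n b) = asg b xs"
  by (rule HOL.ext) (auto simp: asg_def nth_append)

context ngb
begin

primrec tup :: "'v list \<Rightarrow> 'v" where
  "tup [] = zero"
| "tup (x # xs) = pr x (tup xs)"

lemma tup_inject: "length xs = length ys \<Longrightarrow> tup xs = tup ys \<longleftrightarrow> xs = ys"
  by (induction xs ys rule: list_induct2) auto

definition env :: "'v list \<Rightarrow> 'v set" where
  "env vs = {tup xs |xs. list_all2 E xs vs}"

definition sol :: "'v set \<Rightarrow> 'v \<Rightarrow> fm \<Rightarrow> 'v list \<Rightarrow> 'v set" where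
  "sol U c \<phi> vs = {tup xs |xs. list_all2 E xs vs \<and> sat E U (asg c xs) \<phi>}"

text \<open>A set that can stand in for \<open>U\<close> as the range of a universal quantifier,
  uniformly for all tuples from \<open>vs\<close>. Counterexamples are used because
  \<open>Forall\<close> is the primitive quantifier.\<close>

definition bounds :: "'v set \<Rightarrow> 'v \<Rightarrow> fm \<Rightarrow> 'v \<Rightarrow> 'v list \<Rightarrow> bool" where
  "bounds U c \<phi> w vs \<longleftrightarrow> ext E w \<subseteq> U \<and> (\<forall>xs. list_all2 E xs vs \<longrightarrow>
    (\<exists>x\<in>U. \<not> sat E U (asg c (x # xs)) \<phi>) \<longrightarrow> (\<exists>x. E x w \<and> \<not> sat E U (asg c (x # xs)) \<phi>))"

definition atom :: "('v \<Rightarrow> 'v \<Rightarrow> bool) \<Rightarrow> nat \<Rightarrow> nat \<Rightarrow> 'v list \<Rightarrow> 'v set" where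
  "atom r i k vs = {tup xs |xs. list_all2 E xs vs \<and> r (xs ! i) (xs ! k)}"

lemma tup_in_sol:
  assumes "length xs = length vs"
  shows "tup xs \<in> sol U c \<phi> vs \<longleftrightarrow> list_all2 E xs vs \<and> sat E U (asg c xs) \<phi>"
proof
  assume "tup xs \<in> sol U c \<phi> vs"
  then obtain ys where ys: "tup xs = tup ys" "list_all2 E ys vs" "sat E U (asg c ys) \<phi>"
    unfolding sol_def by blast
  then have "xs = ys" using tup_inject[of xs ys] list_all2_lengthD[OF ys(2)] assms by simp
  then show "list_all2 E xs vs \<and> sat E U (asg c xs) \<phi>" using ys by simp
qed (auto simp: sol_def)

lemma sol_Mem: assumes "i < length vs" "k < length vs" shows "sol U c (Mem i k) vs = atom E i k vs"
proof -
  have "list_all2 E xs vs \<and> sat E U (asg c xs) (Mem i k) \<longleftrightarrow> list_all2 E xs vs \<and> E (xs ! i) (xs ! k)" for xs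
    using list_all2_lengthD[of E xs vs] assms by (cases "list_all2 E xs vs") (simp_all add: asg_def)
  then show ?thesis unfolding sol_def atom_def by simp
qed

lemma sol_Eq: assumes "i < length vs" "k < length vs" shows "sol U c (Eq i k) vs = atom (=) i k vs"
proof -
  have "list_all2 E xs vs \<and> sat E U (asg c xs) (Eq i k) \<longleftrightarrow> list_all2 E xs vs \<and> xs ! i = xs ! k" for xs
    using list_all2_lengthD[of E xs vs] assms by (cases "list_all2 E xs vs") (simp_all add: asg_def)
  then show ?thesis unfolding sol_def atom_def by simp
qed

lemma env_sol: "env vs = sol U c (Neg (Conj \<phi> (Neg \<phi>))) vs"
  by (auto simp: env_def sol_def)

lemma tup_in_env: "length xs = length vs \<Longrightarrow> tup xs \<in> env vs \<longleftrightarrow> list_all2 E xs vs"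
  unfolding env_sol[of vs UNIV undefined undefined] by (subst tup_in_sol) auto

lemma sol_subset_env: "sol U c \<phi> vs \<subseteq> env vs"
  by (auto simp: env_def sol_def)

lemma env_eqI:
  assumes "A \<subseteq> env vs" "B \<subseteq> env vs"
    and "\<And>xs. length xs = length vs \<Longrightarrow> list_all2 E xs vs \<Longrightarrow> tup xs \<in> A \<longleftrightarrow> tup xs \<in> B"
  shows "A = B"
proof -
  have "u \<in> A \<longleftrightarrow> u \<in> B" if "u \<in> env vs" for u
    using that assms(3) list_all2_lengthD unfolding env_def by blast
  then show ?thesis using assms(1,2) by blast
qed

lemma env_Nil: "env [] = {zero}"
  by (auto simp: env_def)

lemma env_Cons: "env (v # vs) = op_set Prod (ext E v) (env vs)"
  by (force simp: env_def list_all2_Cons2)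

lemma atom_Suc: "atom r (Suc i) (Suc k) (v # vs) = op_set Prod (ext E v) (atom r i k vs)"
  by (force simp: atom_def list_all2_Cons2)

text \<open>The second coordinate takes no part in the comparison: it is left out, which lowers the
  other compared position by one, and \<open>Ins\<close> puts it back.\<close>

lemma atom_0_Suc: "atom r 0 (Suc (Suc k)) (v # w # vs) = op_set Ins (atom r 0 (Suc k) (v # vs)) (ext E w)"
proof (rule Set.set_eqI)
  fix u
  show "u \<in> atom r 0 (Suc (Suc k)) (v # w # vs) \<longleftrightarrow> u \<in> op_set Ins (atom r 0 (Suc k) (v # vs)) (ext E w)"
  proof
    assume "u \<in> atom r 0 (Suc (Suc k)) (v # w # vs)"
    then obtain x y xs where "u = pr x (pr y (tup xs))" "E x v" "E y w" "list_all2 E xs vs" "r x (xs ! k)"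
      by (auto simp: atom_def list_all2_Cons2)
    moreover from this have "pr x (tup xs) \<in> atom r 0 (Suc k) (v # vs)"
      unfolding atom_def by (auto intro!: exI[of _ "x # xs"])
    ultimately show "u \<in> op_set Ins (atom r 0 (Suc k) (v # vs)) (ext E w)" by auto
  next
    assume "u \<in> op_set Ins (atom r 0 (Suc k) (v # vs)) (ext E w)"
    then obtain x e y where u: "u = pr x (pr y e)" "E y w" "pr x e \<in> atom r 0 (Suc k) (v # vs)" by auto
    then obtain xs where "e = tup xs" "E x v" "list_all2 E xs vs" "r x (xs ! k)"
      by (auto simp: atom_def list_all2_Cons2)
    then show "u \<in> atom r 0 (Suc (Suc k)) (v # w # vs)"
      unfolding atom_def using u by (auto intro!: exI[of _ "x # y # xs"])
  qed
qed

lemma atom_0_1: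
  assumes "\<And>A B. op_set g A B = {u\<in>A. \<exists>x y e. u = pr x (pr y e) \<and> r x y}"
  shows "atom r 0 (Suc 0) (v # w # vs) = op_set g (env (v # w # vs)) X"
  unfolding assms atom_def env_def by (force simp: list_all2_Cons2)

text \<open>A universal quantifier is the complement of the projection of a complement; the bound
  \<open>w\<close> makes its range a set.\<close>

lemma sol_Forall:
  assumes "bounds U c \<phi> w vs"
  shows "sol U c (Forall \<phi>) vs =
    env vs - op_set Ran (op_set Prod (ext E w) (env vs) - sol U c \<phi> (w # vs)) {}"
proof (rule Set.set_eqI)
  fix u
  show "u \<in> sol U c (Forall \<phi>) vs \<longleftrightarrow>
    u \<in> env vs - op_set Ran (op_set Prod (ext E w) (env vs) - sol U c \<phi> (w # vs)) {}"
  proof (cases "u \<in> env vs")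
    case True
    then obtain xs where xs: "u = tup xs" "list_all2 E xs vs" by (auto simp: env_def)
    have len: "length xs = length vs" using xs(2) by (rule list_all2_lengthD)
    have "u \<in> op_set Ran (op_set Prod (ext E w) (env vs) - sol U c \<phi> (w # vs)) {} \<longleftrightarrow>
        (\<exists>x. E x w \<and> tup (x # xs) \<notin> sol U c \<phi> (w # vs))"
      using True xs by auto
    also have "\<dots> \<longleftrightarrow> (\<exists>x. E x w \<and> \<not> sat E U (asg c (x # xs)) \<phi>)"
      using xs(2) len by (subst tup_in_sol) auto
    also have "\<dots> \<longleftrightarrow> \<not> sat E U (asg c xs) (Forall \<phi>)"
      using assms xs(2) unfolding bounds_def by (auto simp: asg_Cons)
    finally show ?thesis using True xs tup_in_sol[OF len] by auto
  next
    case False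
    then show ?thesis by (auto simp: sol_def env_def)
  qed
qed

end

text \<open>\<open>\<kappa>\<close> relates pairs of sets and is closed under the operations applied
  in parallel. The identity on the enumerated sets gives closure under solution sets; the graph of
  \<open>j\<close> shows that \<open>j\<close> maps solution sets to solution sets. The assumption
  \<open>bound\<close> is handed what the induction already knows about \<open>\<phi>\<close>,
  because bounding a quantifier for the graph of \<open>j\<close> depends on it.\<close>

locale op_family = ngb E \<C> for E :: "'v mem" and \<C> +
  fixes \<kappa> :: "'v \<Rightarrow> 'v \<Rightarrow> bool" and U U' :: "'v set" and c c' :: 'v
  assumes ops: "\<kappa> X X' \<Longrightarrow> \<kappa> Y Y' \<Longrightarrow> \<exists>Z Z'. \<kappa> Z Z' \<and>
      ext E Z = op_set g (ext E X) (ext E Y) \<and> ext E Z' = op_set g (ext E X') (ext E Y')"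
    and one: "\<kappa> (sing zero) (sing zero)"
    and bound: "list_all2 \<kappa> vs vs' \<Longrightarrow> fv_below \<phi> (Suc (length vs)) \<Longrightarrow>
      (\<And>w w'. \<kappa> w w' \<Longrightarrow> \<exists>Z Z'. \<kappa> Z Z' \<and> ext E Z = sol U c \<phi> (w # vs) \<and> ext E Z' = sol U' c' \<phi> (w' # vs')) \<Longrightarrow>
      (\<exists>Z Z'. \<kappa> Z Z' \<and> ext E Z = env vs \<and> ext E Z' = env vs') \<Longrightarrow>
      \<exists>w w'. \<kappa> w w' \<and> bounds U c \<phi> w vs \<and> bounds U' c' \<phi> w' vs'"
begin

definition rep :: "'v set \<Rightarrow> 'v set \<Rightarrow> bool" where
  "rep A A' \<longleftrightarrow> (\<exists>Z Z'. \<kappa> Z Z' \<and> ext E Z = A \<and> ext E Z' = A')"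

lemma rep_ext: "\<kappa> Z Z' \<Longrightarrow> rep (ext E Z) (ext E Z')"
  unfolding rep_def by blast

lemma rep_op: assumes "rep A A'" "rep B B'" shows "rep (op_set g A B) (op_set g A' B')"
proof -
  obtain X X' Y Y' where "\<kappa> X X'" "\<kappa> Y Y'" "A = ext E X" "A' = ext E X'" "B = ext E Y" "B' = ext E Y'"
    using assms unfolding rep_def by blast
  then show ?thesis using ops[of X X' Y Y' g] unfolding rep_def by blast
qed

lemma rep_diff: "rep A A' \<Longrightarrow> rep B B' \<Longrightarrow> rep (A - B) (A' - B')"
  using rep_op[of A A' B B' Diff] by simp

lemma rep_empty: "rep {} {}"
  using rep_diff[OF rep_ext[OF one] rep_ext[OF one]] by simp

lemma rep_env: "list_all2 \<kappa> vs vs' \<Longrightarrow> rep (env vs) (env vs')"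
proof (induction vs vs' rule: list_all2_induct)
  case Nil
  then show ?case using rep_ext[OF one] by (simp add: env_Nil)
next
  case (Cons v vs v' vs')
  then show ?case unfolding env_Cons by (intro rep_op rep_ext)
qed

lemma rep_atom_0:
  assumes g: "\<And>A B. op_set g A B = {u\<in>A. \<exists>x y e. u = pr x (pr y e) \<and> r x y}"
  shows "list_all2 \<kappa> vs vs' \<Longrightarrow> Suc k < length vs \<Longrightarrow> rep (atom r 0 (Suc k) vs) (atom r 0 (Suc k) vs')"
proof (induction k arbitrary: vs vs')
  case 0
  then obtain v w vs1 v' w' vs1' where vs: "vs = v # w # vs1" "vs' = v' # w' # vs1'"
    by (cases vs; cases vs'; cases "tl vs"; cases "tl vs'") auto
  show ?case
    using rep_op[OF rep_env[OF 0(1)] rep_empty, of g]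
    unfolding vs atom_0_1[OF g, of _ _ _ "{}"] One_nat_def .
next
  case (Suc k)
  then obtain v w vs1 v' w' vs1' where vs: "vs = v # w # vs1" "vs' = v' # w' # vs1'"
    by (cases vs; cases vs'; cases "tl vs"; cases "tl vs'") auto
  have \<kappa>: "\<kappa> w w'" "list_all2 \<kappa> (v # vs1) (v' # vs1')" using Suc.prems(1) unfolding vs by auto
  show ?case
    unfolding vs atom_0_Suc using Suc.IH[OF \<kappa>(2)] Suc.prems(2) rep_ext[OF \<kappa>(1)]
    by (intro rep_op) (auto simp: vs)
qed

text \<open>\<open>Prod\<close> restores leading coordinates until the first compared variable is 0,
  where \<open>rep_atom_0\<close> takes over.\<close>

lemma rep_atom:
  assumes g: "\<And>A B. op_set g A B = {u\<in>A. \<exists>x y e. u = pr x (pr y e) \<and> r x y}"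
  shows "list_all2 \<kappa> vs vs' \<Longrightarrow> i < k \<Longrightarrow> k < length vs \<Longrightarrow> rep (atom r i k vs) (atom r i k vs')"
proof (induction i arbitrary: k vs vs')
  case 0
  then show ?case using rep_atom_0[OF g, of vs vs' "k - 1"] by simp
next
  case (Suc i)
  then obtain v vs1 v' vs1' where vs: "vs = v # vs1" "vs' = v' # vs1'" "\<kappa> v v'" "list_all2 \<kappa> vs1 vs1'"
    by (cases vs; cases vs') auto
  obtain l where l: "k = Suc l" using Suc.prems(2) by (cases k) auto
  show ?case
    unfolding vs l atom_Suc using Suc.IH[OF vs(4), of l] Suc.prems l vs rep_ext[OF vs(3)]
    by (intro rep_op) auto
qed

lemma rep_mem:
  assumes "list_all2 \<kappa> vs vs'" "i < length vs" "k < length vs"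
  shows "rep (atom E i k vs) (atom E i k vs')"
proof -
  consider "i < k" | "k < i" | "i = k" by linarith
  then show ?thesis
  proof cases
    case 1
    then show ?thesis using rep_atom[of FMem E] assms by simp
  next
    case 2
    \<comment> \<open>The compared coordinates come in the opposite order; this is the purpose of
      \<open>FCon\<close>.\<close>
    have "atom E i k = atom (\<lambda>x y. E y x) k i" by (simp add: atom_def fun_eq_iff)
    then show ?thesis using rep_atom[of FCon "\<lambda>x y. E y x", OF _ assms(1) 2] assms by simp
  next
    case 3
    then have "atom E i k vs = {}" "atom E i k vs' = {}" by (auto simp: atom_def)
    then show ?thesis using rep_empty by simp
  qed
qed

lemma rep_eq:
  assumes "list_all2 \<kappa> vs vs'" "i < length vs" "k < length vs"
  shows "rep (atom (=) i k vs) (atom (=) i k vs')"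
proof -
  consider "i < k" | "k < i" | "i = k" by linarith
  then show ?thesis
  proof cases
    case 1
    then show ?thesis using rep_atom[of FEq "(=)"] assms by simp
  next
    case 2
    have "atom (=) i k = atom (=) k i" by (auto simp: atom_def fun_eq_iff)
    then show ?thesis using rep_atom[of FEq "(=)", OF _ assms(1) 2] assms by simp
  next
    case 3
    then have "atom (=) i k vs = env vs" "atom (=) i k vs' = env vs'" by (auto simp: atom_def env_def)
    then show ?thesis using rep_env[OF assms(1)] by simp
  qed
qed

theorem rep_sol: "list_all2 \<kappa> vs vs' \<Longrightarrow> fv_below \<phi> (length vs) \<Longrightarrow> rep (sol U c \<phi> vs) (sol U' c' \<phi> vs')"
proof (induction \<phi> arbitrary: vs vs')
  case (Mem i k)
  then show ?case
    using rep_mem[OF Mem(1)] list_all2_lengthD[OF Mem(1)] by (simp add: sol_Mem)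
next
  case (Eq i k)
  then show ?case
    using rep_eq[OF Eq(1)] list_all2_lengthD[OF Eq(1)] by (simp add: sol_Eq)
next
  case (Neg \<phi>)
  have "sol U c (Neg \<phi>) vs = env vs - sol U c \<phi> vs" for U c vs
    by (rule env_eqI[of _ vs]) (auto simp: tup_in_sol tup_in_env intro: sol_subset_env[THEN subsetD])
  then show ?case using rep_diff[OF rep_env[OF Neg(2)] Neg.IH[OF Neg(2)]] Neg(3) by simp
next
  case (Conj \<phi> \<psi>)
  have "sol U c (Conj \<phi> \<psi>) vs = sol U c \<phi> vs - (sol U c \<phi> vs - sol U c \<psi> vs)" for U c vs
    by (rule env_eqI[of _ vs]) (auto simp: tup_in_sol tup_in_env intro: sol_subset_env[THEN subsetD])
  then show ?case
    using rep_diff[OF Conj.IH(1)[OF Conj(3)] rep_diff[OF Conj.IH(1)[OF Conj(3)] Conj.IH(2)[OF Conj(3)]]]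
      Conj(4) by simp
next
  case (Forall \<phi>)
  have "rep (sol U c \<phi> (w # vs)) (sol U' c' \<phi> (w' # vs'))" if "\<kappa> w w'" for w w'
    using Forall.IH[of "w # vs" "w' # vs'"] Forall.prems that by simp
  then obtain w w' where w: "\<kappa> w w'" "bounds U c \<phi> w vs" "bounds U' c' \<phi> w' vs'"
    using bound[OF Forall.prems(1), of \<phi>] Forall.prems(2) rep_env[OF Forall.prems(1)] unfolding rep_def by auto
  show ?case
    unfolding sol_Forall[OF w(2)] sol_Forall[OF w(3)]
    by (intro rep_diff rep_env rep_op rep_ext rep_empty Forall w) (use Forall.prems w in auto)
qed

end

section \<open>Bounding quantifiers\<close>

context ngb
begin

text \<open>A quantifier over HOL lists of a fixed length \<open>n\<close> amounts to
  \<open>n\<close> quantifiers over sets.\<close>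

lemma tup_definable:
  assumes "predicative E \<C> P"
  shows "predicative E \<C> (\<lambda>e. \<exists>xs. length xs = n \<and> e 0 = tup xs \<and>
    P (\<lambda>i. if i < n then xs ! i else e (Suc i - n)))"
  using assms
proof (induction n arbitrary: P)
  case 0
  have "predicative E \<C> (\<lambda>e. e 0 = zero \<and> P (\<lambda>i. e (Suc i)))"
    by (intro cls.conj cls.eq cls.var cls_const cls.ren[OF 0])
  then show ?case by simp
next
  case (Suc n)
  \<comment> \<open>The head of the longer list is passed as variable 1 of the assignment, which the
    statement for \<open>n\<close> reads at position \<open>n\<close>, right after the tail.
    \<open>f\<close> reroutes the variables of \<open>P\<close> accordingly.\<close>
  define f where "f = case_nat n (\<lambda>k. if k < n then k else Suc k)"
  define Q where "Q e \<longleftrightarrow> (\<exists>xs. length xs = n \<and> e 0 = tup xs \<and>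
    P (\<lambda>i. if f i < n then xs ! f i else e (Suc (f i) - n)))" for e
  have Q: "predicative E \<C> Q"
    unfolding Q_def by (rule Suc.IH[of "\<lambda>e. P (\<lambda>i. e (f i))"]) (rule cls.ren, rule Suc.prems)
  have 1: "predicative E \<C> (\<lambda>e. Q (case_nat (e 0) (case_nat (e 1) (\<lambda>i. e (Suc (Suc (Suc i)))))))"
  proof (rule cls.cong[OF cls.ren[OF Q, of "\<lambda>i. if i < 2 then i else Suc i"]])
    fix e :: "nat \<Rightarrow> 'v"
    have "(\<lambda>i. e (if i < 2 then i else Suc i)) = case_nat (e 0) (case_nat (e 1) (\<lambda>i. e (Suc (Suc (Suc i)))))"
      by (rule HOL.ext) (auto split: nat.split simp: numeral_2_eq_2)
    then show "Q (\<lambda>i. e (if i < 2 then i else Suc i)) \<longleftrightarrow>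
        Q (case_nat (e 0) (case_nat (e 1) (\<lambda>i. e (Suc (Suc (Suc i))))))" by (rule arg_cong)
  qed
  have 2: "predicative E \<C> (\<lambda>e. \<exists>y. \<exists>r. e 0 = pr y r \<and> Q (case_nat r (case_nat y (\<lambda>i. e (Suc i)))))"
  proof (rule cls_ex, rule cls_ex, rule cls.conj)
    show "predicative E \<C> (\<lambda>e. e (Suc (Suc 0)) = pr (e (Suc 0)) (e 0))"
      by (intro cls_intros)
    show "predicative E \<C> (\<lambda>e. Q (case_nat (e 0) (case_nat (e (Suc 0)) (\<lambda>i. e (Suc (Suc (Suc i)))))))"
      using 1 by simp
  qed
  show ?case
  proof (rule cls.cong[OF 2])
    fix e :: "nat \<Rightarrow> 'v"
    have env: "(\<lambda>i. if f i < n then xs ! f i else case_nat r (case_nat y (\<lambda>i. e (Suc i))) (Suc (f i) - n)) =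
        (\<lambda>i. if i < Suc n then (y # xs) ! i else e (Suc i - Suc n))" if "length xs = n" for xs :: "'v list" and y r
    proof (rule HOL.ext)
      fix i
      show "(if f i < n then xs ! f i else case_nat r (case_nat y (\<lambda>i. e (Suc i))) (Suc (f i) - n)) =
        (if i < Suc n then (y # xs) ! i else e (Suc i - Suc n))"
      proof (cases i)
        case (Suc k)
        have "Suc (Suc k) - n = Suc (Suc (k - n))" "Suc k - n = Suc (k - n)" if "\<not> k < n" using that by simp_all
        then show ?thesis using Suc by (simp add: f_def)
      qed (simp add: f_def)
    qed
    show "(\<exists>y r. e 0 = pr y r \<and> Q (case_nat r (case_nat y (\<lambda>i. e (Suc i))))) \<longleftrightarrow>
      (\<exists>xs. length xs = Suc n \<and> e 0 = tup xs \<and> P (\<lambda>i. if i < Suc n then xs ! i else e (Suc i - Suc n)))"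
    proof
      assume "\<exists>y r. e 0 = pr y r \<and> Q (case_nat r (case_nat y (\<lambda>i. e (Suc i))))"
      then obtain y r xs where xs: "e 0 = pr y r" "length xs = n" "r = tup xs"
        "P (\<lambda>i. if f i < n then xs ! f i else case_nat r (case_nat y (\<lambda>i. e (Suc i))) (Suc (f i) - n))"
        unfolding Q_def by auto
      from xs(4)[unfolded env[OF xs(2)]] xs(1-3)
      show "\<exists>xs. length xs = Suc n \<and> e 0 = tup xs \<and> P (\<lambda>i. if i < Suc n then xs ! i else e (Suc i - Suc n))"
        by (intro exI[of _ "y # xs"]) simp
    next
      assume "\<exists>xs. length xs = Suc n \<and> e 0 = tup xs \<and> P (\<lambda>i. if i < Suc n then xs ! i else e (Suc i - Suc n))"
      then obtain ys where ys: "length ys = Suc n" "e 0 = tup ys"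
        "P (\<lambda>i. if i < Suc n then ys ! i else e (Suc i - Suc n))" by blast
      then obtain y xs where y: "ys = y # xs" "length xs = n" by (cases ys) auto
      have "Q (case_nat (tup xs) (case_nat y (\<lambda>i. e (Suc i))))"
        unfolding Q_def using ys(3)[unfolded y(1), folded env[OF y(2), of "tup xs" y]] y(2)
        by (intro exI[of _ xs]) simp
      then show "\<exists>y r. e 0 = pr y r \<and> Q (case_nat r (case_nat y (\<lambda>i. e (Suc i))))"
        using ys(2) y(1) by (intro exI[of _ y] exI[of _ "tup xs"]) simp
    qed
  qed
qed

text \<open>This is the relation to which collection is applied when a quantifier gets bounded.
  \<open>U\<close> can be an inner model or a stage of the iteration.\<close>

lemma refuted_class:
  assumes "U \<in> \<C>"
  shows "{u. \<exists>d x. u = pr d x \<and> (\<exists>xs. length xs = n \<and> d = tup xs \<and> x \<in> U \<and> \<not> sat E U (asg c (x # xs)) \<phi>)} \<in> \<C>"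
proof -
  define R where "R d x \<longleftrightarrow> (\<exists>xs. length xs = n \<and> d = tup xs \<and> x \<in> U \<and> \<not> sat E U (asg c (x # xs)) \<phi>)" for d x
  \<comment> \<open>Positions below \<open>n\<close> hold the decoded tuple and position
    \<open>n\<close> holds \<open>x\<close>; \<open>t\<close> turns this layout into
    \<open>asg c (x # xs)\<close>.\<close>
  define t where "t i e = (if i = 0 then e n else if i \<le> n then e (i - 1) else c)" for i and e :: "nat \<Rightarrow> 'v"
  define P where "P e \<longleftrightarrow> e n \<in> U \<and> \<not> sat E {x. x \<in> U} (\<lambda>i. t i e) \<phi>" for e
  have t: "cls.definable_term (t i)" for i
    unfolding t_def by (cases "i = 0"; cases "i \<le> n") (auto intro: cls.var cls_const)
  have P: "predicative E \<C> P"
    unfolding P_def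
    by (intro cls.conj cls.neg cls.sat_definable cls_in cls.var t assms) simp
  have R: "predicative E \<C> (\<lambda>e. R (e 0) (e 1))"
  proof (rule cls.cong[OF cls.ren[OF tup_definable[OF P, of n], of "\<lambda>i. if i = 0 then 0 else 1"]])
    fix e :: "nat \<Rightarrow> 'v"
    have "P (\<lambda>i. if i < n then xs ! i else e (if Suc i - n = 0 then 0 else 1)) \<longleftrightarrow>
        e 1 \<in> U \<and> \<not> sat E U (asg c (e 1 # xs)) \<phi>" if "length xs = n" for xs
    proof -
      have "(\<lambda>i. t i (\<lambda>i. if i < n then xs ! i else e (if Suc i - n = 0 then 0 else 1))) = asg c (e 1 # xs)"
        using that by (intro HOL.ext) (auto simp: t_def asg_def nth_Cons split: nat.split)
      then show ?thesis unfolding P_def by simp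
    qed
    then show "(\<exists>xs. length xs = n \<and> e (if (0 :: nat) = 0 then 0 else 1) = tup xs \<and>
        P (\<lambda>i. if i < n then xs ! i else e (if Suc i - n = 0 then 0 else 1))) \<longleftrightarrow> R (e 0) (e 1)"
      unfolding R_def by (simp cong: conj_cong)
  qed
  have "predicative E \<C> (\<lambda>e. \<exists>d x. e 0 = pr d x \<and> R d x)"
    by (intro cls_intros cls.subst2[of R, OF R])
  then show ?thesis unfolding R_def by (rule comprehension)
qed

end

section \<open>Lexicographic orders\<close>

context ngb
begin

definition prod_pred :: "('v \<Rightarrow> bool) \<Rightarrow> ('v \<Rightarrow> bool) \<Rightarrow> 'v \<Rightarrow> bool" where
  "prod_pred A B u \<longleftrightarrow> (\<exists>x y. u = pr x y \<and> A x \<and> B y)"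

definition lex :: "('v \<Rightarrow> 'v \<Rightarrow> bool) \<Rightarrow> ('v \<Rightarrow> 'v \<Rightarrow> bool) \<Rightarrow> 'v \<Rightarrow> 'v \<Rightarrow> bool" where
  "lex r s u v \<longleftrightarrow> (\<exists>x y x' y'. u = pr x y \<and> v = pr x' y' \<and> (r x x' \<or> x = x' \<and> s y y'))"

lemma lex_pr [simp]: "lex r s (pr x y) (pr x' y') \<longleftrightarrow> r x x' \<or> x = x' \<and> s y y'"
  by (auto simp: lex_def)

text \<open>Minimal elements are demanded for classes of the universe only; foundation provides no
  more for arbitrary subsets in HOL.\<close>

definition class_wo :: "('v \<Rightarrow> bool) \<Rightarrow> ('v \<Rightarrow> 'v \<Rightarrow> bool) \<Rightarrow> bool" where
  "class_wo A r \<longleftrightarrow>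
    (\<forall>x y z. A x \<longrightarrow> A y \<longrightarrow> A z \<longrightarrow> r x y \<longrightarrow> r y z \<longrightarrow> r x z) \<and> (\<forall>x. A x \<longrightarrow> \<not> r x x) \<and>
    (\<forall>x y. A x \<longrightarrow> A y \<longrightarrow> r x y \<or> x = y \<or> r y x) \<and>
    (\<forall>X\<in>\<C>. X \<noteq> {} \<longrightarrow> (\<forall>x\<in>X. A x) \<longrightarrow> (\<exists>m\<in>X. \<forall>k\<in>X. \<not> r k m))"

lemma class_wo_trans: "class_wo A r \<Longrightarrow> A x \<Longrightarrow> A y \<Longrightarrow> A z \<Longrightarrow> r x y \<Longrightarrow> r y z \<Longrightarrow> r x z"
  unfolding class_wo_def by (drule conjunct1) blast

lemma class_wo_irrefl: "class_wo A r \<Longrightarrow> A x \<Longrightarrow> \<not> r x x"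
  unfolding class_wo_def by (drule conjunct2, drule conjunct1) blast

lemma class_wo_linear: "class_wo A r \<Longrightarrow> A x \<Longrightarrow> A y \<Longrightarrow> r x y \<or> x = y \<or> r y x"
  unfolding class_wo_def by (drule conjunct2, drule conjunct2, drule conjunct1) blast

lemma class_wo_wf:
  "class_wo A r \<Longrightarrow> X \<in> \<C> \<Longrightarrow> x \<in> X \<Longrightarrow> (\<And>x. x \<in> X \<Longrightarrow> A x) \<Longrightarrow> \<exists>m\<in>X. \<forall>k\<in>X. \<not> r k m"
  unfolding class_wo_def by (drule conjunct2, drule conjunct2, drule conjunct2) blast

lemma class_woI:
  assumes "\<And>x y z. A x \<Longrightarrow> A y \<Longrightarrow> A z \<Longrightarrow> r x y \<Longrightarrow> r y z \<Longrightarrow> r x z" "\<And>x. A x \<Longrightarrow> \<not> r x x"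
    "\<And>x y. A x \<Longrightarrow> A y \<Longrightarrow> r x y \<or> x = y \<or> r y x"
    "\<And>X. X \<in> \<C> \<Longrightarrow> X \<noteq> {} \<Longrightarrow> (\<forall>x\<in>X. A x) \<Longrightarrow> \<exists>m\<in>X. \<forall>k\<in>X. \<not> r k m"
  shows "class_wo A r"
  unfolding class_wo_def by (intro conjI allI ballI impI; fact assms)

lemma class_wo_subset:
  assumes wo: "class_wo A r" and sub: "\<And>x. B x \<Longrightarrow> A x"
  shows "class_wo B r"
proof -
  have "\<forall>x y z. B x \<longrightarrow> B y \<longrightarrow> B z \<longrightarrow> r x y \<longrightarrow> r y z \<longrightarrow> r x z"
    by (intro allI impI) (rule class_wo_trans[OF wo], (rule sub, assumption)+)
  moreover have "\<forall>x. B x \<longrightarrow> \<not> r x x"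
    by (intro allI impI) (rule class_wo_irrefl[OF wo sub])
  moreover have "\<forall>x y. B x \<longrightarrow> B y \<longrightarrow> r x y \<or> x = y \<or> r y x"
    by (intro allI impI) (rule class_wo_linear[OF wo sub sub])
  moreover have "\<forall>X\<in>\<C>. X \<noteq> {} \<longrightarrow> (\<forall>x\<in>X. B x) \<longrightarrow> (\<exists>m\<in>X. \<forall>k\<in>X. \<not> r k m)"
  proof (intro ballI impI)
    fix X assume X: "X \<in> \<C>" "X \<noteq> {}" "\<forall>x\<in>X. B x"
    then obtain x where "x \<in> X" by blast
    then show "\<exists>m\<in>X. \<forall>k\<in>X. \<not> r k m" by (rule class_wo_wf[OF wo X(1)]) (use X(3) sub in blast)
  qed
  ultimately show ?thesis unfolding class_wo_def by (intro conjI)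
qed

lemma class_wo_ordinal: "class_wo (ordinal E) E"
proof (rule class_woI)
  show "\<exists>m\<in>X. \<forall>k\<in>X. \<not> E k m" if "X \<in> \<C>" "X \<noteq> {}" for X using foundation[OF that(1)] that(2) by blast
  show "E x z" if "ordinal E z" "E x y" "E y z" for x y z using ordinal_trans[OF that(1,3,2)] .
  show "\<not> E x x" for x by simp
  show "E x y \<or> x = y \<or> E y x" if "ordinal E x" "ordinal E y" for x y by (rule ordinal_linear[OF that])
qed

lemma class_wo_lex:
  assumes A: "class_wo A r" and B: "class_wo B s"
  shows "class_wo (prod_pred A B) (lex r s)"
proof -
  have "lex r s u w" if u: "prod_pred A B u" "prod_pred A B v" "prod_pred A B w" "lex r s u v" "lex r s v w" for u v w
  proof -
    obtain x y x' y' x'' y'' where eq: "u = pr x y" "v = pr x' y'" "w = pr x'' y''"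
      and m: "A x" "A x'" "A x''" "B y" "B y'" "B y''"
      using u(1-3) unfolding prod_pred_def by auto
    have "r x x' \<Longrightarrow> r x' x'' \<Longrightarrow> r x x''" by (rule class_wo_trans[OF A m(1-3)])
    moreover have "s y y' \<Longrightarrow> s y' y'' \<Longrightarrow> s y y''" by (rule class_wo_trans[OF B m(4-6)])
    ultimately show ?thesis using u(4,5) unfolding eq lex_pr by auto
  qed
  moreover have "\<not> lex r s u u" if "prod_pred A B u" for u
    using that class_wo_irrefl[OF A] class_wo_irrefl[OF B] unfolding prod_pred_def by auto
  moreover have "lex r s u v \<or> u = v \<or> lex r s v u" if u: "prod_pred A B u" "prod_pred A B v" for u v
  proof -
    obtain x y x' y' where eq: "u = pr x y" "v = pr x' y'" and m: "A x" "A x'" "B y" "B y'"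
      using u unfolding prod_pred_def by auto
    have "r x x' \<or> x = x' \<or> r x' x" by (rule class_wo_linear[OF A m(1,2)])
    moreover have "s y y' \<or> y = y' \<or> s y' y" by (rule class_wo_linear[OF B m(3,4)])
    ultimately show ?thesis unfolding eq lex_pr by auto
  qed
  moreover have "\<exists>m\<in>X. \<forall>k\<in>X. \<not> lex r s k m" if X: "X \<in> \<C>" "X \<noteq> {}" "\<forall>x\<in>X. prod_pred A B x" for X
  proof -
    let ?X = "{x. \<exists>y. pr x y \<in> X}"
    obtain u where u: "u \<in> X" using X(2) by blast
    obtain x y where "u = pr x y" using X(3) u unfolding prod_pred_def by blast
    then have x: "x \<in> ?X" using u by auto
    have "?X \<in> \<C>" by (rule comprehension) (intro cls_intros X)
    moreover note x
    moreover have "A x" if "x \<in> ?X" for x using that X(3) unfolding prod_pred_def by auto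
    ultimately have "\<exists>m\<in>?X. \<forall>k\<in>?X. \<not> r k m" by (rule class_wo_wf[OF A])
    then obtain m where m: "m \<in> ?X" "\<forall>k\<in>?X. \<not> r k m" by (elim bexE) (rule that)
    let ?Y = "{y. pr m y \<in> X}"
    have "?Y \<in> \<C>" by (rule comprehension) (intro cls_intros X)
    moreover obtain y where "y \<in> ?Y" using m(1) by auto
    moreover have "B y" if "y \<in> ?Y" for y using that X(3) unfolding prod_pred_def by auto
    ultimately have "\<exists>n\<in>?Y. \<forall>k\<in>?Y. \<not> s k n" by (rule class_wo_wf[OF B])
    then obtain n where n: "n \<in> ?Y" "\<forall>k\<in>?Y. \<not> s k n" by (elim bexE) (rule that)
    have "\<not> lex r s u (pr m n)" if uX: "u \<in> X" for u
    proof -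
      obtain x y where u: "u = pr x y" using X(3) uX unfolding prod_pred_def by blast
      then have "\<not> r x m" using m(2) uX by auto
      moreover have "\<not> s y n" if "x = m" using n(2) \<open>u \<in> X\<close> u that by auto
      ultimately show ?thesis unfolding u lex_pr by auto
    qed
    then show ?thesis using n(1) by auto
  qed
  ultimately show ?thesis by (rule class_woI)
qed

section \<open>Numerals and the indices of the enumeration\<close>

primrec num :: "nat \<Rightarrow> 'v" where
  "num 0 = zero"
| "num (Suc n) = suc (num n)"

lemma ordinal_num: "ordinal E (num n)"
  by (induction n) (auto simp: ordinal_zero ordinal_suc)

lemma num_less: "m < n \<Longrightarrow> E (num m) (num n)"
  by (induction n) (auto simp: less_Suc_eq)

lemma num_inject [simp]: "num m = num n \<longleftrightarrow> m = n"
  using num_less[of m n] num_less[of n m] by (metis E_irrefl linorder_neqE_nat)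

text \<open>
  The leading component \<open>\<mu>\<close> of an index makes the lexicographic order set-like and leaves room for
  indices above any given ones.
\<close>

definition quad :: "'v \<Rightarrow> 'v \<Rightarrow> 'v \<Rightarrow> 'v \<Rightarrow> 'v" where
  "quad \<mu> \<nu> \<xi> \<eta> = pr \<mu> (pr \<nu> (pr \<xi> \<eta>))"

lemma quad_inject [simp]: "quad \<mu> \<nu> \<xi> \<eta> = quad \<mu>' \<nu>' \<xi>' \<eta>' \<longleftrightarrow> \<mu> = \<mu>' \<and> \<nu> = \<nu>' \<and> \<xi> = \<xi>' \<and> \<eta> = \<eta>'"
  by (simp add: quad_def)

definition index :: "'v \<Rightarrow> bool" where
  "index i \<longleftrightarrow> (\<exists>\<mu> \<nu> \<xi> \<eta>. i = quad \<mu> \<nu> \<xi> \<eta> \<and> ordinal E \<mu> \<and> E \<nu> \<mu> \<and> E \<xi> \<mu> \<and> E \<eta> \<mu>)"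

definition index_less :: "'v \<Rightarrow> 'v \<Rightarrow> bool" where
  "index_less = lex E (lex E (lex E E))"

lemma class_wo_index: "class_wo index index_less"
proof -
  let ?O = "prod_pred (ordinal E) (prod_pred (ordinal E) (prod_pred (ordinal E) (ordinal E)))"
  have wo: "class_wo ?O index_less"
    unfolding index_less_def by (intro class_wo_lex class_wo_ordinal)
  have "?O i" if i: "index i" for i
  proof -
    obtain \<mu> \<nu> \<xi> \<eta> where "i = pr \<mu> (pr \<nu> (pr \<xi> \<eta>))" "ordinal E \<mu>" "E \<nu> \<mu>" "E \<xi> \<mu>" "E \<eta> \<mu>"
      using i unfolding index_def quad_def by blast
    then show ?thesis using ordinal_mem[of \<mu>] unfolding prod_pred_def by auto
  qed
  then show ?thesis by (rule class_wo_subset[OF wo])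
qed

end

context definability
begin

lemma quad_closed_iff [simp]: "quad \<mu> \<nu> \<xi> \<eta> \<in> D \<longleftrightarrow> \<mu> \<in> D \<and> \<nu> \<in> D \<and> \<xi> \<in> D \<and> \<eta> \<in> D"
  by (simp add: quad_def)

lemma quad_term:
  "definable_term t \<Longrightarrow> definable_term u \<Longrightarrow> definable_term v \<Longrightarrow> definable_term w \<Longrightarrow>
    definable_term (\<lambda>e. quad (t e) (u e) (v e) (w e))"
  unfolding quad_def by (intro pr_term)

lemma lex_definable:
  assumes "df (\<lambda>e. r (e 0) (e 1))" "df (\<lambda>e. s (e 0) (e 1))"
  shows "df (\<lambda>e. lex r s (e 0) (e 1))"
proof -
  have "df (\<lambda>e. \<exists>x\<in>D. \<exists>y\<in>D. \<exists>x'\<in>D. \<exists>y'\<in>D. e 0 = pr x y \<and> e 1 = pr x' y' \<and> (r x x' \<or> x = x' \<and> s y y'))"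
    by (intro intros pr_term subst2[of r, OF assms(1)] subst2[of s, OF assms(2)])
  then show ?thesis
  proof (rule cong)
    fix e :: "nat \<Rightarrow> 'v"
    assume "range e \<subseteq> D"
    then have "e 0 \<in> D" "e 1 \<in> D" by auto
    then have *: "e 0 = pr x y \<Longrightarrow> x \<in> D \<and> y \<in> D" "e 1 = pr x y \<Longrightarrow> x \<in> D \<and> y \<in> D" for x y by auto
    show "(\<exists>x\<in>D. \<exists>y\<in>D. \<exists>x'\<in>D. \<exists>y'\<in>D. e 0 = pr x y \<and> e 1 = pr x' y' \<and> (r x x' \<or> x = x' \<and> s y y')) \<longleftrightarrow>
        lex r s (e 0) (e 1)"
      unfolding lex_def using * by blast
  qed
qed

lemma index_definable: "df (\<lambda>e. index (e 0))"
proof -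
  have "df (\<lambda>e. \<exists>\<mu>\<in>D. \<exists>\<nu>\<in>D. \<exists>\<xi>\<in>D. \<exists>\<eta>\<in>D. e 0 = quad \<mu> \<nu> \<xi> \<eta> \<and> ordinal E \<mu> \<and> E \<nu> \<mu> \<and> E \<xi> \<mu> \<and> E \<eta> \<mu>)"
    by (intro intros quad_term subst1[of "ordinal E", OF ordinal_definable])
  then show ?thesis
  proof (rule cong)
    fix e :: "nat \<Rightarrow> 'v"
    assume "range e \<subseteq> D"
    then have "e 0 \<in> D" by auto
    then have *: "e 0 = quad \<mu> \<nu> \<xi> \<eta> \<Longrightarrow> \<mu> \<in> D \<and> \<nu> \<in> D \<and> \<xi> \<in> D \<and> \<eta> \<in> D" for \<mu> \<nu> \<xi> \<eta> by auto
    show "(\<exists>\<mu>\<in>D. \<exists>\<nu>\<in>D. \<exists>\<xi>\<in>D. \<exists>\<eta>\<in>D. e 0 = quad \<mu> \<nu> \<xi> \<eta> \<and> ordinal E \<mu> \<and> E \<nu> \<mu> \<and> E \<xi> \<mu> \<and> E \<eta> \<mu>) \<longleftrightarrow>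
        index (e 0)"
      unfolding index_def using * by blast
  qed
qed

lemma index_less_definable: "df (\<lambda>e. index_less (e 0) (e 1))"
  unfolding index_less_def by (intro lex_definable mem_var)

lemma num_term: "zero \<in> D \<Longrightarrow> (\<And>x. x \<in> D \<Longrightarrow> suc x \<in> D) \<Longrightarrow> definable_term (\<lambda>e. num n)"
  by (induction n) (auto intro: zero_term suc_term)

end

section \<open>A definable enumeration of the ordinal definable sets\<close>

text \<open>The codes 9, 10 and 11 are left for the generators {\<xi>}, {b} and V_\<xi> in
  \<open>enum_val\<close>.\<close>

primrec op_num :: "gop \<Rightarrow> nat" where
  "op_num Diff = 0"
| "op_num Prod = 1"
| "op_num Ran = 2"
| "op_num Ins = 3"
| "op_num FMem = 4"
| "op_num FCon = 5"
| "op_num FEq = 6"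
| "op_num Dom = 7"
| "op_num BigUn = 8"

lemma op_num_inject [simp]: "op_num g = op_num h \<longleftrightarrow> g = h"
  by (cases g; cases h) simp_all

lemma op_num_less: "op_num g < 9"
  by (cases g) simp_all

text \<open>Turns the HOL quantifier over operations in \<open>enum_val\<close> into a finite
  disjunction, which is first order.\<close>

lemma ex_gop: "(\<exists>g. P g) \<longleftrightarrow>
    P Diff \<or> P Prod \<or> P Ran \<or> P Ins \<or> P FMem \<or> P FCon \<or> P FEq \<or> P Dom \<or> P BigUn"
  by (metis gop.exhaust)

context inner
begin

lemma suc_in: "x \<in> D \<Longrightarrow> suc x \<in> D"
proof -
  assume "x \<in> D"
  then obtain u where "u \<in> D" "\<And>z. E z u \<longleftrightarrow> z = x \<or> E z x" using D_insert[of x x] by auto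
  moreover from this have "u = suc x" by (intro set_eqI) simp
  ultimately show ?thesis by simp
qed

lemma index_in: assumes "index i" shows "i \<in> D"
proof -
  obtain \<mu> \<nu> \<xi> \<eta> where i: "i = quad \<mu> \<nu> \<xi> \<eta>" "ordinal E \<mu>" "E \<nu> \<mu>" "E \<xi> \<mu>" "E \<eta> \<mu>"
    using assms unfolding index_def by blast
  then show ?thesis using ordinal_in[OF i(2)] D_mem by simp
qed

lemma index_below:
  assumes "index i" shows "\<exists>s\<in>D. \<forall>k. E k s \<longleftrightarrow> index k \<and> index_less k i"
proof -
  obtain \<mu> \<nu> \<xi> \<eta> where i: "i = quad \<mu> \<nu> \<xi> \<eta>" "ordinal E \<mu>" "E \<nu> \<mu>" "E \<xi> \<mu>" "E \<eta> \<mu>"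
    using assms unfolding index_def by blast
  note iD = index_in[OF assms]
  \<comment> \<open>All components of a smaller index are at most \<open>\<mu>\<close>, hence
    elements of \<open>suc \<mu>\<close>. A quadruple is three nested pairs, so three rounds of
    \<open>pair_bound\<close> follow.\<close>
  have "suc \<mu> \<in> D" using ordinal_in[OF i(2)] by (rule suc_in)
  from pair_bound[OF this] obtain a where a: "a \<in> D" "\<And>x. E x (suc \<mu>) \<Longrightarrow> E x a"
    "\<And>x y. E x (suc \<mu>) \<Longrightarrow> E y (suc \<mu>) \<Longrightarrow> E (pr x y) a" by auto
  from pair_bound[OF a(1)] obtain c where c: "c \<in> D" "\<And>x. E x a \<Longrightarrow> E x c"
    "\<And>x y. E x a \<Longrightarrow> E y a \<Longrightarrow> E (pr x y) c" by auto
  from pair_bound[OF c(1)] obtain w where w: "w \<in> D"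
    "\<And>x y. E x c \<Longrightarrow> E y c \<Longrightarrow> E (pr x y) w" by auto
  have "\<exists>s\<in>D. \<forall>k. E k s \<longleftrightarrow> k \<in> D \<and> index k \<and> index_less k i"
  proof (rule bounded_comprehension[OF _ w(1)])
    show "fo_definable_par E D (\<lambda>e. index (e 0) \<and> index_less (e 0) i)"
      by (intro par_intros par.subst1[of index, OF par.index_definable]
        par.subst2[of index_less, OF par.index_less_definable] iD)
    show "E k w" if k: "index k \<and> index_less k i" for k
    proof -
      obtain \<mu>' \<nu>' \<xi>' \<eta>' where q: "k = quad \<mu>' \<nu>' \<xi>' \<eta>'" "ordinal E \<mu>'" "E \<nu>' \<mu>'" "E \<xi>' \<mu>'" "E \<eta>' \<mu>'"
        using k unfolding index_def by blast
      have "E \<mu>' (suc \<mu>)" using k unfolding q(1) i(1) index_less_def quad_def by auto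
      moreover from this have "E z (suc \<mu>)" if "E z \<mu>'" for z
        using ordinal_trans[OF ordinal_suc[OF i(2)]] that by blast
      ultimately show ?thesis unfolding q(1) quad_def using q a c w by auto
    qed
  qed
  then show ?thesis using index_in by blast
qed

definition enum_val :: "'v \<Rightarrow> 'v \<Rightarrow> 'v \<Rightarrow> 'v \<Rightarrow> bool" where
  "enum_val b i f u \<longleftrightarrow> (\<exists>\<mu>\<in>D. \<exists>\<nu>\<in>D. \<exists>\<xi>\<in>D. \<exists>\<eta>\<in>D. i = quad \<mu> \<nu> \<xi> \<eta> \<and>
    ((\<exists>g. \<nu> = num (op_num g) \<and> (\<exists>k\<in>D. \<exists>X\<in>D. \<exists>l\<in>D. \<exists>Y\<in>D. E (pr k (pr \<xi> X)) f \<and> E (pr l (pr \<eta> Y)) f \<and>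
        u \<in> op_set g (ext E X) (ext E Y))) \<or>
     \<nu> = num 9 \<and> u = \<xi> \<or> \<nu> = num 10 \<and> u = b \<or> \<nu> = num 11 \<and> V_mem u \<xi>))"

text \<open>
  The value at index \<open>i\<close> is a pair: the ordinal naming \<open>i\<close>, which is the set of the names of the
  smaller indices, and the set enumerated at \<open>i\<close>.  An index \<open>(\<mu>, \<nu>, \<xi>, \<eta>)\<close> applies the operation
  coded by \<open>\<nu>\<close> to the sets named \<open>\<xi>\<close> and \<open>\<eta>\<close>.
\<close>

definition enum_step :: "'v \<Rightarrow> 'v \<Rightarrow> 'v \<Rightarrow> 'v \<Rightarrow> bool" where
  "enum_step b i f y \<longleftrightarrow> (\<exists>n\<in>D. \<exists>x\<in>D. y = pr n x \<and>
    (\<forall>u\<in>D. E u n \<longleftrightarrow> (\<exists>k\<in>D. \<exists>z\<in>D. E (pr k (pr u z)) f)) \<and> (\<forall>u\<in>D. E u x \<longleftrightarrow> enum_val b i f u))"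

lemmas num_fo = fo.num_term[OF zero_in suc_in]
lemmas op_fo = fo.subst3[of "\<lambda>u X Y. u \<in> op_set g (ext E X) (ext E Y)" for g, OF fo.op_set_definable]

lemma enum_val_fo: "fo_definable E D (\<lambda>e. enum_val (e 0) (e 1) (e 2) (e 3))"
  unfolding enum_val_def ex_gop by (intro fo_intros fo.quad_term num_fo op_fo V_mem_fo)

lemma enum_step_fo: "fo_definable E D (\<lambda>e. enum_step (e 0) (e 1) (e 2) (e 3))"
  unfolding enum_step_def by (intro fo_intros fo.subst4[of enum_val, OF enum_val_fo])

lemma enum_step_total:
  assumes b: "b \<in> D" and i: "index i" and f: "f \<in> D"
  shows "\<exists>!y. y \<in> D \<and> enum_step b i f y"
proof -
  obtain \<mu> \<nu> \<xi> \<eta> where q: "i = quad \<mu> \<nu> \<xi> \<eta>" "ordinal E \<mu>" "E \<nu> \<mu>" "E \<xi> \<mu>" "E \<eta> \<mu>"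
    using i unfolding index_def by blast
  have o: "ordinal E \<xi>" using q ordinal_mem by blast
  have iD: "i \<in> D" "\<xi> \<in> D" using index_in[OF i] ordinal_in[OF o] by auto
  \<comment> \<open>One transitive set holds \<open>b\<close>, \<open>\<xi>\<close>, and the names
    and operands occurring in \<open>f\<close>. Adjoining the results of the operations and V_\<xi>
    gives a bound for the new value.\<close>
  obtain t where t: "t \<in> D" "E (pr f (pr \<xi> b)) t" "transitive E (ext E t)"
    using transitive_superset[of "pr f (pr \<xi> b)"] f iD b by auto
  then have ft: "E f t" "E \<xi> t" "E b t" using trans_pr[OF t(3)] by blast+
  have tr: "E x t \<and> E y t" if "E (pr x y) f" for x y
    using trans_pr[OF t(3), of x y] t(3) ft(1) that unfolding transitive_def by (metis in_ext_iff subsetD)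
  obtain w where w: "w \<in> D" "\<And>g X Y u. E X t \<Longrightarrow> E Y t \<Longrightarrow> u \<in> op_set g (ext E X) (ext E Y) \<Longrightarrow> E u w"
    using op_bound[OF t(1,3)] by auto
  obtain w1 where w1: "w1 \<in> D" "\<And>z. E z w1 \<longleftrightarrow> E z w \<or> E z t" using D_Un[OF w(1) t(1)] by auto
  obtain w2 where w2: "w2 \<in> D" "\<And>z. E z w2 \<longleftrightarrow> E z w1 \<or> E z (VV \<xi>)" using D_Un[OF w1(1) VV_in[OF o]] by auto
  have "\<exists>n\<in>D. \<forall>u. E u n \<longleftrightarrow> u \<in> D \<and> (\<exists>k\<in>D. \<exists>z\<in>D. E (pr k (pr u z)) f)"
  proof (rule bounded_comprehension[OF _ t(1)])
    show "fo_definable_par E D (\<lambda>e. \<exists>k\<in>D. \<exists>z\<in>D. E (pr k (pr (e 0) z)) f)" by (intro par_intros f)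
    show "E u t" if "\<exists>k\<in>D. \<exists>z\<in>D. E (pr k (pr u z)) f" for u
      using that tr trans_pr[OF t(3)] by blast
  qed
  from unique_set[OF this] obtain n where n: "n \<in> D" "\<forall>u\<in>D. E u n \<longleftrightarrow> (\<exists>k\<in>D. \<exists>z\<in>D. E (pr k (pr u z)) f)"
    "\<And>m. m \<in> D \<Longrightarrow> \<forall>u\<in>D. E u m \<longleftrightarrow> (\<exists>k\<in>D. \<exists>z\<in>D. E (pr k (pr u z)) f) \<Longrightarrow> m = n"
    by (elim ex1E conjE) blast
  have "\<exists>x\<in>D. \<forall>u. E u x \<longleftrightarrow> u \<in> D \<and> enum_val b i f u"
  proof (rule bounded_comprehension[OF _ w2(1)])
    show "fo_definable_par E D (\<lambda>e. enum_val b i f (e 0))"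
      by (rule par.subst4[of enum_val, OF fo_definable_parI, OF enum_val_fo]) (intro par_intros b f iD)+
    show "E u w2" if "enum_val b i f u" for u
    proof -
      have "(\<exists>g k X l Y. E (pr k (pr \<xi> X)) f \<and> E (pr l (pr \<eta> Y)) f \<and> u \<in> op_set g (ext E X) (ext E Y)) \<or>
          u = \<xi> \<or> u = b \<or> V_mem u \<xi>"
        using that unfolding enum_val_def q(1) quad_inject by blast
      moreover have "E u w" if "E (pr k (pr \<xi> X)) f" "E (pr l (pr \<eta> Y)) f" "u \<in> op_set g (ext E X) (ext E Y)" for g k X l Y
        using w(2) that trans_pr[OF t(3)] tr by blast
      ultimately show ?thesis unfolding w2(2) w1(2) V_mem_def using ft by blast
    qed
  qed
  from unique_set[OF this] obtain x where x: "x \<in> D" "\<forall>u\<in>D. E u x \<longleftrightarrow> enum_val b i f u"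
    "\<And>m. m \<in> D \<Longrightarrow> \<forall>u\<in>D. E u m \<longleftrightarrow> enum_val b i f u \<Longrightarrow> m = x"
    by (elim ex1E conjE) blast
  show ?thesis
  proof (rule ex1I[of _ "pr n x"])
    show "pr n x \<in> D \<and> enum_step b i f (pr n x)"
      unfolding enum_step_def using n(1,2) x(1,2) by (intro conjI bexI[of _ n] bexI[of _ x]) auto
    fix y assume "y \<in> D \<and> enum_step b i f y"
    then obtain m z where "y = pr m z" "m \<in> D" "z \<in> D"
      "\<forall>u\<in>D. E u m \<longleftrightarrow> (\<exists>k\<in>D. \<exists>z\<in>D. E (pr k (pr u z)) f)" "\<forall>u\<in>D. E u z \<longleftrightarrow> enum_val b i f u"
      unfolding enum_step_def by blast
    then show "y = pr n x" using n(3) x(3) by simp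
  qed
qed

sublocale F: recursion E \<C> D index index_less enum_step
proof
  show "fo_definable E D (\<lambda>e. index (e 0))" by (rule fo.index_definable)
  show "fo_definable E D (\<lambda>e. index_less (e 0) (e 1))" by (rule fo.index_less_definable)
  show "fo_definable E D (\<lambda>e. enum_step (e 0) (e 1) (e 2) (e 3))" by (rule enum_step_fo)
  show "i \<in> D" if "index i" for i
    using index_in[OF that] .
  show "index_less i l" if "index i" "index k" "index l" "index_less i k" "index_less k l" for i k l
    using class_wo_trans[OF class_wo_index] that by blast
  show "\<not> index_less i i" if "index i" for i
    using class_wo_irrefl[OF class_wo_index] that by blast
  show "\<exists>s\<in>D. \<forall>k. E k s \<longleftrightarrow> index k \<and> index_less k i" if "index i" for i
    using index_below[OF that] .
  show "\<exists>m\<in>X. \<forall>k\<in>X. \<not> index_less k m" if X: "X \<in> \<C>" "x \<in> X" "\<And>i. i \<in> X \<Longrightarrow> index i" for X x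
    by (rule class_wo_wf[OF class_wo_index X])
  show "\<exists>!y. y \<in> D \<and> enum_step p i f y" if "p \<in> D" "index i" "f \<in> D" for p i f
    using enum_step_total[OF that] .
qed

definition enum :: "'v \<Rightarrow> 'v \<Rightarrow> 'v \<Rightarrow> bool" where
  "enum b \<gamma> x \<longleftrightarrow> (\<exists>i\<in>D. F.rec b i (pr \<gamma> x))"

lemma enum_fo: "fo_definable E D (\<lambda>e. enum (e 0) (e 1) (e 2))"
  unfolding enum_def by (intro fo_intros fo.subst3[of F.rec, OF F.rec_def_fo])

end

locale inner_param = inner E \<C> D for E :: "'v mem" and \<C> D +
  fixes b :: 'v
  assumes b_in: "b \<in> D"
begin

lemma rec_pair: assumes "F.rec b i y" obtains \<gamma> x where "y = pr \<gamma> x" "\<gamma> \<in> D" "x \<in> D"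
  using F.rec_step[OF b_in assms] that unfolding enum_step_def by blast

lemma rec_val:
  assumes "F.rec b i (pr \<gamma> x)"
  shows "\<exists>f. (\<forall>k \<delta> z. E (pr k (pr \<delta> z)) f \<longleftrightarrow> index_less k i \<and> F.rec b k (pr \<delta> z)) \<and>
    (\<forall>u. E u \<gamma> \<longleftrightarrow> (\<exists>k z. index_less k i \<and> F.rec b k (pr u z))) \<and>
    (\<forall>u. E u x \<longleftrightarrow> u \<in> D \<and> enum_val b i f u)"
proof -
  obtain f where f: "\<And>u. E u f \<longleftrightarrow> (\<exists>l z. u = pr l z \<and> index l \<and> index_less l i \<and> F.rec b l z)"
    and s: "enum_step b i f (pr \<gamma> x)" using F.rec_step[OF b_in assms] by blast
  have Ef: "E (pr k (pr \<delta> z)) f \<longleftrightarrow> index_less k i \<and> F.rec b k (pr \<delta> z)" for k \<delta> z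
    unfolding f using F.rec_in by auto
  have in_D: "k \<in> D \<and> u \<in> D \<and> z \<in> D" if "F.rec b k (pr u z)" for k u z
    using F.rec_in[OF that] F.I_in by auto
  have s': "\<forall>u\<in>D. E u \<gamma> \<longleftrightarrow> (\<exists>k\<in>D. \<exists>z\<in>D. E (pr k (pr u z)) f)" "\<forall>u\<in>D. E u x \<longleftrightarrow> enum_val b i f u" "\<gamma> \<in> D" "x \<in> D"
    using s unfolding enum_step_def by auto
  have "E u \<gamma> \<longleftrightarrow> (\<exists>k z. index_less k i \<and> F.rec b k (pr u z))" for u
    using s'(1) D_mem[OF s'(3)] in_D unfolding Ef by blast
  moreover have "E u x \<longleftrightarrow> u \<in> D \<and> enum_val b i f u" for u
    using s'(2) D_mem[OF s'(4)] by blast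
  ultimately show ?thesis using Ef by (intro exI[of _ f]) simp
qed

lemma rec_name:
  assumes "F.rec b i (pr \<gamma> x)" shows "E u \<gamma> \<longleftrightarrow> (\<exists>k z. index_less k i \<and> F.rec b k (pr u z))"
  using rec_val[OF assms] by (elim exE conjE) simp

lemma rec_less: assumes "F.rec b i (pr \<gamma> x)" "F.rec b k (pr \<delta> y)" "index_less k i" shows "E \<delta> \<gamma>"
  using rec_name[OF assms(1)] assms(2,3) by blast

text \<open>Names are the Mostowski collapse of the order of indices: by minimality along that
  order, each is a transitive set of ordinals.\<close>

lemma rec_ordinal: assumes "F.rec b i (pr \<gamma> x)" shows "ordinal E \<gamma>"
proof (rule ccontr)
  let ?X = "{i \<in> D. index i \<and> (\<exists>\<gamma>\<in>D. \<exists>x\<in>D. F.rec b i (pr \<gamma> x) \<and> \<not> ordinal E \<gamma>)}"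
  assume "\<not> ordinal E \<gamma>"
  then have "i \<in> ?X" using F.rec_in[OF assms] F.I_in assms by auto
  moreover have "?X \<in> \<C>"
    by (rule definable_class_in)
      (intro F.rec_par_intros b_in)
  ultimately have "\<exists>m\<in>?X. \<forall>k\<in>?X. \<not> index_less k m" by (intro F.lt_wf) auto
  then obtain m where m: "m \<in> ?X" "\<forall>k\<in>?X. \<not> index_less k m" by (elim bexE) (rule that)
  then obtain \<gamma> x where g: "F.rec b m (pr \<gamma> x)" "\<not> ordinal E \<gamma>" by blast
  note f = rec_name[OF g(1)]
  have "ordinal E \<gamma>"
  proof (rule transitive_set_of_ordinals)
    fix u assume "E u \<gamma>"
    then obtain k z where k: "index_less k m" "F.rec b k (pr u z)" using f by blast
    show "ordinal E u"
    proof (rule ccontr)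
      assume "\<not> ordinal E u"
      then have "k \<in> ?X" using F.rec_in[OF k(2)] F.I_in k(2) by auto
      then show False using m(2) k(1) by blast
    qed
    fix v assume "E v u"
    note rec_name[OF k(2)]
    then obtain l z' where l: "index_less l k" "F.rec b l (pr v z')" using \<open>E v u\<close> by blast
    have "index_less l m"
      by (rule F.lt_trans[OF _ _ _ l(1) k(1)]) (use F.rec_in l k g in blast)+
    then show "E v \<gamma>" using f l(2) by blast
  qed
  then show False using g(2) by blast
qed

lemma enum_ordinal: "enum b \<gamma> x \<Longrightarrow> ordinal E \<gamma>"
  unfolding enum_def using rec_ordinal by blast

lemma enum_in: "enum b \<gamma> x \<Longrightarrow> x \<in> D"
  unfolding enum_def using F.rec_in[of b _ "pr \<gamma> x"] by auto

text \<open>Names increase strictly with the index, so a name determines its index.\<close>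

lemma enum_unique: assumes "enum b \<gamma> x" "enum b \<gamma> y" shows "x = y"
proof -
  obtain i k where ik: "F.rec b i (pr \<gamma> x)" "F.rec b k (pr \<gamma> y)" using assms unfolding enum_def by blast
  have "index_less i k \<or> i = k \<or> index_less k i"
    by (rule class_wo_linear[OF class_wo_index]) (use F.rec_in[OF ik(1)] F.rec_in[OF ik(2)] in simp_all)
  then have "i = k" using rec_less[OF ik(1,2)] rec_less[OF ik(2,1)] by auto
  then have "pr \<gamma> x = pr \<gamma> y" using F.rec_unique[OF b_in] ik by blast
  then show ?thesis by simp
qed

definition K :: "'v \<Rightarrow> bool" where
  "K x \<longleftrightarrow> (\<exists>\<gamma>. enum b \<gamma> x)"

lemma enum_at:
  assumes "index i"
  shows "\<exists>f \<gamma> x. enum b \<gamma> x \<and>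
    (\<forall>k \<delta> z. E (pr k (pr \<delta> z)) f \<longleftrightarrow> index_less k i \<and> F.rec b k (pr \<delta> z)) \<and>
    (\<forall>u. E u x \<longleftrightarrow> u \<in> D \<and> enum_val b i f u)"
proof -
  obtain y where y: "F.rec b i y" using F.rec_exists[OF b_in assms] by blast
  obtain \<gamma> x where gx: "y = pr \<gamma> x" by (rule rec_pair[OF y])
  have "enum b \<gamma> x" unfolding enum_def using y gx F.I_in[OF assms] by blast
  then show ?thesis using rec_val[OF y[unfolded gx]] by (elim exE conjE) (intro exI conjI)
qed

lemma ordinals_bounded:
  assumes "\<forall>x\<in>set xs. ordinal E x" shows "\<exists>\<mu>. ordinal E \<mu> \<and> (\<forall>x\<in>set xs. E x \<mu>)"
proof -
  have "is_set (set xs)" by (induction xs) (auto intro: is_set_insert)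
  then obtain s where "\<And>x. E x s \<longleftrightarrow> x \<in> set xs" unfolding is_set_iff by auto
  then show ?thesis using ordinal_sup[of s] assms by auto
qed

text \<open>The leading component \<open>\<mu>\<close> is chosen above those of indices of
  \<open>X\<close> and \<open>Y\<close>, above their names and above the code. The quadruple is then
  an index at which both operands are already enumerated.\<close>

lemma K_op:
  assumes "K X" "K Y" shows "\<exists>Z. K Z \<and> ext E Z = op_set g (ext E X) (ext E Y)"
proof -
  obtain \<gamma> \<delta> where gd: "enum b \<gamma> X" "enum b \<delta> Y" using assms unfolding K_def by blast
  obtain i k where i: "F.rec b i (pr \<gamma> X)" and k: "F.rec b k (pr \<delta> Y)" using gd unfolding enum_def by blast
  obtain \<mu>1 m1 where m1: "i = pr \<mu>1 m1" "ordinal E \<mu>1"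
    using F.rec_in[OF i] unfolding index_def quad_def by blast
  obtain \<mu>2 m2 where m2: "k = pr \<mu>2 m2" "ordinal E \<mu>2"
    using F.rec_in[OF k] unfolding index_def quad_def by blast
  obtain \<mu> where \<mu>: "ordinal E \<mu>" "E \<mu>1 \<mu>" "E \<mu>2 \<mu>" "E \<gamma> \<mu>" "E \<delta> \<mu>" "E (num (op_num g)) \<mu>"
    using ordinals_bounded[of "[\<mu>1, \<mu>2, \<gamma>, \<delta>, num (op_num g)]"] m1 m2 enum_ordinal gd ordinal_num by auto
  let ?q = "quad \<mu> (num (op_num g)) \<gamma> \<delta>"
  have q: "index ?q" unfolding index_def using \<mu> by blast
  obtain f \<zeta> Z where Z: "enum b \<zeta> Z"
    and f: "\<forall>k \<delta> z. E (pr k (pr \<delta> z)) f \<longleftrightarrow> index_less k ?q \<and> F.rec b k (pr \<delta> z)"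
    and EZ: "\<forall>u. E u Z \<longleftrightarrow> u \<in> D \<and> enum_val b ?q f u" using enum_at[OF q] by (elim exE conjE) (rule that)
  note f = f[rule_format]
  have if': "E (pr i (pr \<gamma> X)) f" "E (pr k (pr \<delta> Y)) f"
    unfolding f using i k \<mu> by (auto simp: m1(1) m2(1) index_less_def quad_def)
  have uniq: "z = X" if "E (pr l (pr \<gamma> z)) f" for l z
    using that enum_unique[OF _ gd(1), of z] F.rec_in[of b l "pr \<gamma> z"] F.I_in unfolding f enum_def by blast
  have uniq': "z = Y" if "E (pr l (pr \<delta> z)) f" for l z
    using that enum_unique[OF _ gd(2), of z] F.rec_in[of b l "pr \<delta> z"] F.I_in unfolding f enum_def by blast
  have D: "i \<in> D" "k \<in> D" "X \<in> D" "Y \<in> D" "\<mu> \<in> D" "\<gamma> \<in> D" "\<delta> \<in> D" "num (op_num g) \<in> D"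
    using F.rec_in[OF i] F.rec_in[OF k] F.I_in ordinal_in \<mu> ordinal_num by auto
  have "enum_val b ?q f u \<longleftrightarrow> u \<in> op_set g (ext E X) (ext E Y)" for u
  proof
    have ne: "num (op_num g) \<noteq> num 9" "num (op_num g) \<noteq> num 10" "num (op_num g) \<noteq> num 11"
      using op_num_less[of g] by auto
    assume "enum_val b ?q f u"
    then obtain g' l z l' z' where "num (op_num g) = num (op_num g')" "E (pr l (pr \<gamma> z)) f" "E (pr l' (pr \<delta> z')) f"
      "u \<in> op_set g' (ext E z) (ext E z')"
      unfolding enum_val_def quad_inject using ne by blast
    then show "u \<in> op_set g (ext E X) (ext E Y)" using uniq uniq' by simp
  next
    assume "u \<in> op_set g (ext E X) (ext E Y)"
    then show "enum_val b ?q f u"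
      unfolding enum_val_def quad_inject using if' D by blast
  qed
  \<comment> \<open>The enumerated value contains only elements of \<open>D\<close>; closure of
    \<open>D\<close> under the operations shows that nothing is cut off.\<close>
  moreover obtain Z' where "Z' \<in> D" "ext E Z' = op_set g (ext E X) (ext E Y)"
    using op_closed[OF D(3,4)] by blast
  moreover from this have "u \<in> D" if "u \<in> op_set g (ext E X) (ext E Y)" for u
    using D_mem[of Z' u] that by (metis in_ext_iff)
  ultimately have "ext E Z = op_set g (ext E X) (ext E Y)" using EZ by auto
  then show ?thesis using Z unfolding K_def by blast
qed

lemma K_gen:
  fixes n :: nat
  assumes \<xi>: "ordinal E \<xi>" and n: "9 \<le> n"
    and S: "\<And>u. u \<in> D \<Longrightarrow> E u S \<longleftrightarrow> n = 9 \<and> u = \<xi> \<or> n = 10 \<and> u = b \<or> n = 11 \<and> V_mem u \<xi>" "S \<in> D"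
  shows "K S"
proof -
  obtain \<mu> where \<mu>: "ordinal E \<mu>" "E \<xi> \<mu>" "E (num n) \<mu>"
    using ordinals_bounded[of "[\<xi>, num n]"] \<xi> ordinal_num by auto
  let ?q = "quad \<mu> (num n) \<xi> \<xi>"
  have q: "index ?q" unfolding index_def using \<mu> by blast
  obtain f \<zeta> Z where Z: "enum b \<zeta> Z" and EZ: "\<forall>u. E u Z \<longleftrightarrow> u \<in> D \<and> enum_val b ?q f u"
    using enum_at[OF q] by (elim exE conjE) (rule that)
  have D: "\<mu> \<in> D" "\<xi> \<in> D" "num n \<in> D" using ordinal_in \<mu> \<xi> ordinal_num by auto
  have ne: "num n \<noteq> num (op_num g)" for g using op_num_less[of g] n by auto
  have "enum_val b ?q f u \<longleftrightarrow> n = 9 \<and> u = \<xi> \<or> n = 10 \<and> u = b \<or> n = 11 \<and> V_mem u \<xi>" for u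
    unfolding enum_val_def quad_inject using ne D by auto
  then have "Z = S" using EZ S D_mem[OF S(2)] by (intro set_eqI) blast
  then show ?thesis using Z unfolding K_def by blast
qed

lemma K_sing: "ordinal E \<xi> \<Longrightarrow> K (sing \<xi>)"
  by (rule K_gen[of \<xi> 9]) (auto simp: ordinal_in)

lemma K_sing_b: "K (sing b)"
  by (rule K_gen[OF ordinal_zero, of 10]) (auto simp: b_in)

lemma K_VV: "ordinal E \<xi> \<Longrightarrow> K (VV \<xi>)"
  by (rule K_gen[of \<xi> 11]) (auto simp: V_mem_def VV_in)

lemma K_in: "K x \<Longrightarrow> x \<in> D"
  unfolding K_def using enum_in by blast

sublocale KF: op_family E \<C> "\<lambda>v v'. v = v' \<and> K v" D D b b
proof
  show "\<exists>Z Z'. (Z = Z' \<and> K Z) \<and> ext E Z = op_set g (ext E X) (ext E Y) \<and> ext E Z' = op_set g (ext E X') (ext E Y')"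
    if "X = X' \<and> K X" "Y = Y' \<and> K Y" for g X X' Y Y'
    using K_op[of X Y g] that by auto
  show "sing zero = sing zero \<and> K (sing zero)" using K_sing[OF ordinal_zero] by simp
  show "\<exists>w w'. (w = w' \<and> K w) \<and> bounds D b \<phi> w vs \<and> bounds D b \<phi> w' vs'"
    if vs: "list_all2 (\<lambda>v v'. v = v' \<and> K v) vs vs'"
      and Z: "\<exists>Z Z'. (Z = Z' \<and> K Z) \<and> ext E Z = env vs \<and> ext E Z' = env vs'" for \<phi> vs vs'
  proof -
    let ?R = "{u. \<exists>d x. u = pr d x \<and> (\<exists>xs. length xs = length vs \<and> d = tup xs \<and> x \<in> D \<and> \<not> sat E D (asg b (x # xs)) \<phi>)}"
    have eq: "vs = vs'" using vs by (induction vs vs' rule: list_all2_induct) auto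
    obtain a where a: "ext E a = env vs" using Z by blast
    obtain \<gamma> where \<gamma>: "ordinal E \<gamma>" "\<forall>e. E e a \<longrightarrow> (\<exists>x\<in>D. pr e x \<in> ?R) \<longrightarrow> (\<exists>x. E x (VV \<gamma>) \<and> pr e x \<in> ?R)"
      using collection[OF refuted_class[OF D_class, of "length vs" b \<phi>], of a] by blast
    have "bounds D b \<phi> (VV \<gamma>) vs"
      unfolding bounds_def
    proof (intro conjI allI impI)
      show "ext E (VV \<gamma>) \<subseteq> D" using D_mem[OF VV_in[OF \<gamma>(1)]] by auto
      fix xs assume xs: "list_all2 E xs vs" and "\<exists>x\<in>D. \<not> sat E D (asg b (x # xs)) \<phi>"
      then obtain x where x: "x \<in> D" "\<not> sat E D (asg b (x # xs)) \<phi>" by blast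
      have len: "length xs = length vs" using xs by (rule list_all2_lengthD)
      have "E (tup xs) a" using tup_in_env[OF len] xs a by (metis in_ext_iff)
      moreover have "pr (tup xs) x \<in> ?R" using x len by auto
      ultimately obtain y where y: "E y (VV \<gamma>)" "pr (tup xs) y \<in> ?R" using \<gamma>(2) x(1) by blast
      then obtain ys where ys: "length ys = length vs" "tup xs = tup ys" "\<not> sat E D (asg b (y # ys)) \<phi>" by auto
      then have "xs = ys" using tup_inject[of xs ys] len by simp
      then show "\<exists>x. E x (VV \<gamma>) \<and> \<not> sat E D (asg b (x # xs)) \<phi>" using y ys by blast
    qed
    then show ?thesis using K_VV[OF \<gamma>(1)] eq by blast
  qed
qed

end

section \<open>Ordinal definability\<close>

lemma trcl_mono: "A \<subseteq> B \<Longrightarrow> trcl E \<C> A \<subseteq> trcl E \<C> B"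
  unfolding trcl_def by blast

lemma trcl_least: "T \<in> \<C> \<Longrightarrow> A \<subseteq> T \<Longrightarrow> transitive E T \<Longrightarrow> trcl E \<C> A \<subseteq> T"
  unfolding trcl_def by blast

lemma well_orders_cong:
  assumes "well_orders E D R W" and R: "\<And>x y. x \<in> W \<Longrightarrow> y \<in> W \<Longrightarrow> R' x y \<longleftrightarrow> R x y"
  shows "well_orders E D R' W"
proof -
  have "irreflp_on W R'" using assms by (simp add: well_orders_def irreflp_on_def)
  moreover have "transp_on W R'" using assms unfolding well_orders_def transp_on_def by (metis (no_types))
  moreover have "totalp_on W R'" using assms by (simp add: well_orders_def totalp_on_def)
  moreover have "\<exists>m\<in>ext E u. \<forall>x\<in>ext E u. x = m \<or> R' m x" if u: "u \<in> D" "ext E u \<subseteq> W \<and> ext E u \<noteq> {}" for u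
  proof -
    obtain m where m: "m \<in> ext E u" "\<forall>x\<in>ext E u. x = m \<or> R m x"
      using assms(1) u unfolding well_orders_def by blast
    then show ?thesis using R u(2) by (intro bexI[of _ m]) blast+
  qed
  ultimately show ?thesis unfolding well_orders_def by blast
qed

context inner
begin

lemma sat_fo:
  assumes "\<And>i. fo.definable_term (t i)" shows "fo_definable E D (\<lambda>e. sat E D (\<lambda>i. t i e) \<phi>)"
proof -
  have "fo_definable E D (\<lambda>e. sat E {x. x \<in> D} (\<lambda>i. t i e) \<phi>)"
    by (rule fo.sat_definable[of "\<lambda>x e. x \<in> D"]) (auto intro: fo.in_dom fo.var assms)
  then show ?thesis by simp
qed

lemma asg_term1:
  "fo.definable_term t \<Longrightarrow> fo.definable_term u \<Longrightarrow> fo.definable_term (\<lambda>e. asg (u e) [t e] i)"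
  by (cases "i = 0") (simp_all add: asg_def)

lemma asg_term2:
  "fo.definable_term t \<Longrightarrow> fo.definable_term t' \<Longrightarrow> fo.definable_term u \<Longrightarrow>
    fo.definable_term (\<lambda>e. asg (u e) [t e, t' e] i)"
  by (cases "i = 0"; cases "i = 1") (simp_all add: asg_def)

lemma sat1_fo: "fo.definable_term t \<Longrightarrow> fo.definable_term u \<Longrightarrow> fo_definable E D (\<lambda>e. sat E D (asg (u e) [t e]) \<phi>)"
  using sat_fo[of "\<lambda>i e. asg (u e) [t e] i"] asg_term1 by simp

lemma sat2_fo: "fo.definable_term t \<Longrightarrow> fo.definable_term t' \<Longrightarrow> fo.definable_term u \<Longrightarrow>
    fo_definable E D (\<lambda>e. sat E D (asg (u e) [t e, t' e]) \<phi>)"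
  using sat_fo[of "\<lambda>i e. asg (u e) [t e, t' e] i"] asg_term2 by simp

section \<open>Transitive closures and hereditary definability inside an inner model\<close>

definition trans_in :: "'v \<Rightarrow> bool" where
  "trans_in t \<longleftrightarrow> (\<forall>y\<in>D. E y t \<longrightarrow> (\<forall>z\<in>D. E z y \<longrightarrow> E z t))"

lemma trans_in: assumes "t \<in> D" shows "trans_in t \<longleftrightarrow> (\<forall>y z. E y t \<longrightarrow> E z y \<longrightarrow> E z t)"
proof -
  have "y \<in> D \<and> z \<in> D" if "E y t" "E z y" for y z using D_mem[OF assms that(1)] D_mem that(2) by blast
  then show ?thesis unfolding trans_in_def by blast
qed

text \<open>First-order substitute for the transitive closure of \<open>{a}\<close>: an intersection
  of transitive sets of \<open>D\<close>, free of any recursion on natural numbers.\<close>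

definition tc :: "'v \<Rightarrow> 'v \<Rightarrow> bool" where
  "tc a x \<longleftrightarrow> (\<forall>t\<in>D. trans_in t \<longrightarrow> E a t \<longrightarrow> E x t)"

lemma trans_in_fo: "fo_definable E D (\<lambda>e. trans_in (e 0))"
  unfolding trans_in_def by (intro fo_intros)

lemma tc_fo: "fo_definable E D (\<lambda>e. tc (e 0) (e 1))"
  unfolding tc_def by (intro fo_intros fo.subst1[of trans_in, OF trans_in_fo])

lemmas tc_par = par.subst2[of tc, OF fo_definable_parI, OF tc_fo]

lemma tc_refl: "tc a a"
  unfolding tc_def by blast

lemma tc_step: assumes "tc a x" "E y x" shows "tc a y"
  unfolding tc_def
proof (intro ballI impI)
  fix t assume t: "t \<in> D" "trans_in t" "E a t"
  then have "E x t" using assms(1) unfolding tc_def by blast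
  then show "E y t" using trans_in[OF t(1)] t(2) assms(2) by blast
qed

lemma transitive_superset': assumes "a \<in> D" shows "\<exists>t\<in>D. E a t \<and> (\<forall>x y. E x t \<longrightarrow> E y x \<longrightarrow> E y t)"
proof -
  obtain t where t: "t \<in> D" "E a t" "transitive E (ext E t)" by (rule transitive_superset[OF assms])
  then have "E y t" if "E x t" "E y x" for x y
    using that unfolding transitive_def by (metis in_ext_iff subsetD)
  then show ?thesis using t(1,2) by blast
qed

lemma tc_class: "{x \<in> D. tc a x} \<in> \<C>" if "a \<in> D"
  by (rule definable_class_in) (intro par_intros tc_par that)

lemma tc_transitive: "transitive E {x \<in> D. tc a x}"
  unfolding transitive_def by (auto intro: tc_step dest: D_mem)

text \<open>\<open>T\<close> is an arbitrary class, so its intersection with a set of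
  \<open>D\<close> may fail to be in \<open>D\<close>. Instead the proof goes by induction along
  membership: \<open>m\<close> and the closures of its elements form a transitive set of
  \<open>D\<close>, so everything in the closure of \<open>m\<close> is \<open>m\<close> itself or
  lies in the closure of an element.\<close>

lemma tc_subset:
  assumes "T \<in> \<C>" and T: "transitive E T" and "a \<in> D" "a \<in> T" "x \<in> D" "tc a x"
  shows "x \<in> T"
proof (rule ccontr)
  let ?P = "{u \<in> D. \<exists>a\<in>D. \<exists>x\<in>D. u = pr a x \<and> tc a x}"
  let ?X = "{a. a \<in> D \<and> a \<in> T \<and> (\<exists>x. pr a x \<in> ?P \<and> x \<notin> T)}"
  assume "x \<notin> T"
  then have "a \<in> ?X" using assms by auto
  moreover have "?P \<in> \<C>" by (rule definable_class_in) (intro par_intros tc_par)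
  then have "?X \<in> \<C>"
    by (intro comprehension) (intro cls_intros assms D_class)
  ultimately have "\<exists>m\<in>?X. \<forall>k\<in>?X. \<not> E k m" by (intro foundation)
  then obtain m where m: "m \<in> ?X" "\<forall>k\<in>?X. \<not> E k m" by (elim bexE) (rule that)
  then obtain y where y: "m \<in> D" "m \<in> T" "y \<in> D" "tc m y" "y \<notin> T" by auto
  have sub: "z \<in> T" if c: "E c m" and z: "tc c z" "z \<in> D" for c z
  proof (rule ccontr)
    assume "z \<notin> T"
    moreover have "c \<in> T" using T y(2) c unfolding transitive_def by (metis in_ext_iff subsetD)
    ultimately have "c \<in> ?X" using D_mem[OF y(1) c] z by auto
    then show False using m(2) c by blast
  qed
  obtain t where t: "t \<in> D" "E m t" "\<forall>x y. E x t \<longrightarrow> E y x \<longrightarrow> E y t"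
    using transitive_superset'[OF y(1)] by (elim bexE conjE) (rule that)
  have "\<exists>s\<in>D. \<forall>x. E x s \<longleftrightarrow> E x t \<and> (x = m \<or> (\<exists>c\<in>D. E c m \<and> tc c x))"
    by (rule separation[OF _ t(1)]) (intro par_intros tc_par y)
  then obtain s where s: "s \<in> D" "\<forall>x. E x s \<longleftrightarrow> E x t \<and> (x = m \<or> (\<exists>c\<in>D. E c m \<and> tc c x))" by (elim bexE) (rule that)
  have "E z s" if x: "E x s" and z: "E z x" for x z
  proof -
    have "E z t" using x z s(2) t(3) by blast
    moreover have "\<exists>c\<in>D. E c m \<and> tc c z"
    proof (cases "x = m")
      case True
      then show ?thesis using z D_mem[OF y(1)] tc_refl by blast
    next
      case False
      then obtain c where "c \<in> D" "E c m" "tc c x" using x s(2) by blast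
      then show ?thesis using tc_step z by blast
    qed
    ultimately show ?thesis using s(2) by blast
  qed
  then have "trans_in s" using trans_in[OF s(1)] by blast
  moreover have "E m s" using s(2) t(2) by blast
  ultimately have "E y s" using y(4) s(1) unfolding tc_def by blast
  then have "y = m \<or> (\<exists>c\<in>D. E c m \<and> tc c y)" using s(2) by blast
  then show False using y sub by blast
qed

lemma trcl_sing: assumes "a \<in> D" shows "trcl E \<C> {a} = {x \<in> D. tc a x}"
proof
  show "trcl E \<C> {a} \<subseteq> {x \<in> D. tc a x}"
    by (rule trcl_least[OF tc_class[OF assms] _ tc_transitive]) (use assms tc_refl in blast)
  show "{x \<in> D. tc a x} \<subseteq> trcl E \<C> {a}"
    unfolding trcl_def using tc_subset assms by blast
qed

lemma trcl_definable:
  assumes "fo_definable_par E D (\<lambda>e. A (e 0))"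
  shows "trcl E \<C> {x \<in> D. A x} = {x \<in> D. \<exists>a\<in>D. A a \<and> tc a x}"
proof
  have "{x \<in> D. \<exists>a\<in>D. A a \<and> tc a x} \<in> \<C>"
    by (rule definable_class_in) (intro par_intros tc_par par.subst1[of A, OF assms])
  then show "trcl E \<C> {x \<in> D. A x} \<subseteq> {x \<in> D. \<exists>a\<in>D. A a \<and> tc a x}"
  proof (rule trcl_least)
    show "{x \<in> D. A x} \<subseteq> {x \<in> D. \<exists>a\<in>D. A a \<and> tc a x}" using tc_refl by blast
    show "transitive E {x \<in> D. \<exists>a\<in>D. A a \<and> tc a x}"
      unfolding transitive_def by (auto dest: D_mem) (metis tc_step)
  qed
  show "{x \<in> D. \<exists>a\<in>D. A a \<and> tc a x} \<subseteq> trcl E \<C> {x \<in> D. A x}"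
  proof
    fix x assume "x \<in> {x \<in> D. \<exists>a\<in>D. A a \<and> tc a x}"
    then obtain a where a: "x \<in> D" "a \<in> D" "A a" "tc a x" by blast
    then have "x \<in> trcl E \<C> {a}" using trcl_sing by blast
    then show "x \<in> trcl E \<C> {x \<in> D. A x}" using trcl_mono[of "{a}" "{x \<in> D. A x}"] a by blast
  qed
qed

definition KK :: "'v \<Rightarrow> 'v \<Rightarrow> bool" where
  "KK b x \<longleftrightarrow> (\<exists>\<gamma>\<in>D. enum b \<gamma> x)"

lemma KK_fo: "fo_definable E D (\<lambda>e. KK (e 0) (e 1))"
  unfolding KK_def by (intro fo_intros fo.subst3[of enum, OF enum_fo])

text \<open>First-order form of \<open>HOD\<close>: a transitive set of enumerated sets replaces the
  transitive closure, and the parameter stays a variable.\<close>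

definition HK :: "'v \<Rightarrow> 'v \<Rightarrow> bool" where
  "HK b x \<longleftrightarrow> (\<exists>t\<in>D. trans_in t \<and> E x t \<and> (\<forall>y\<in>D. E y t \<longrightarrow> KK b y))"

lemma HK_fo: "fo_definable E D (\<lambda>e. HK (e 0) (e 1))"
  unfolding HK_def by (intro fo_intros fo.subst1[of trans_in, OF trans_in_fo] fo.subst2[of KK, OF KK_fo])

end

context inner_param
begin

lemma KK_iff: "KK b x \<longleftrightarrow> K x"
  unfolding KK_def K_def using enum_ordinal ordinal_in by blast

lemma range_asg: "set xs \<subseteq> D \<Longrightarrow> range (asg b xs) \<subseteq> D"
  using b_in by (auto simp: asg_def)

lemma OD_I:
  assumes "fo_definable E D (\<lambda>e. R (e 0) (e 1) (e 2))" "ordinal E \<gamma>" "x \<in> D"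
    and R: "\<And>y. y \<in> D \<Longrightarrow> R y \<gamma> b \<longleftrightarrow> y = x"
  shows "x \<in> OD E D b"
proof -
  obtain \<phi> where \<phi>: "\<forall>e. range e \<subseteq> D \<longrightarrow> (sat E D e \<phi> \<longleftrightarrow> R (e 0) (e 1) (e 2))"
    using assms(1) unfolding fo_definable_def by (elim exE)
  have "sat E D (asg b (y # [\<gamma>])) \<phi> \<longleftrightarrow> y = x" if "y \<in> D" for y
  proof -
    have "range (asg b [y, \<gamma>]) \<subseteq> D" using that ordinal_in[OF assms(2)] by (intro range_asg) simp
    then have "sat E D (asg b [y, \<gamma>]) \<phi> \<longleftrightarrow> R y \<gamma> b" using \<phi> by (simp add: asg_def)
    then show ?thesis using R[OF that] by simp
  qed
  then show ?thesis
    unfolding OD_def using assms(2,3) ordinal_in[OF assms(2)]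
    by (intro CollectI conjI exI[of _ \<phi>] exI[of _ "[\<gamma>]"]) simp_all
qed

lemma K_OD: assumes "K x" shows "x \<in> OD E D b"
proof -
  obtain \<gamma> where \<gamma>: "enum b \<gamma> x" using assms unfolding K_def by blast
  show ?thesis
  proof (rule OD_I[of "\<lambda>y \<gamma> b. enum b \<gamma> y"])
    show "fo_definable E D (\<lambda>e. enum (e 2) (e 1) (e 0))"
      by (intro fo.subst3[of enum, OF enum_fo] fo.var)
    show "ordinal E \<gamma>" "x \<in> D" using enum_ordinal[OF \<gamma>] enum_in[OF \<gamma>] .
    show "enum b \<gamma> y \<longleftrightarrow> y = x" for y using \<gamma> enum_unique by blast
  qed
qed

lemma list_all2_sing: "list_all2 E xs (map sing as) \<longleftrightarrow> xs = as"
  by (simp add: list_all2_map2 list.rel_eq)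

text \<open>On the product of some V_\<zeta> containing \<open>x\<close> with the singletons of the
  parameters, the defining formula has a single solution, a tuple beginning with \<open>x\<close>;
  \<open>Dom\<close> and \<open>BigUn\<close> extract \<open>x\<close>. All factors are enumerated,
  and factors {b} cover the remaining free variables.\<close>

lemma OD_K: assumes "x \<in> OD E D b" shows "K x"
proof -
  obtain \<phi> \<alpha>s where x: "x \<in> D" and \<alpha>s: "set \<alpha>s \<subseteq> {\<alpha> \<in> D. ordinal E \<alpha>}"
    and \<phi>: "\<forall>y\<in>D. sat E D (asg b (y # \<alpha>s)) \<phi> \<longleftrightarrow> y = x"
    using assms unfolding OD_def by blast
  obtain n where n: "fv_below \<phi> n" using fv_below_exists by blast
  obtain \<zeta> where \<zeta>: "ordinal E \<zeta>" "E x (VV \<zeta>)" using in_VV[OF x] unfolding V_mem_def by blast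
  define as where "as = \<alpha>s @ replicate n b"
  define vs where "vs = VV \<zeta> # map sing as"
  have "K v" if "v \<in> set vs" for v
    using that \<alpha>s K_VV[OF \<zeta>(1)] K_sing K_sing_b unfolding vs_def as_def by auto
  then have "list_all2 (\<lambda>v v'. v = v' \<and> K v) vs vs" by (simp add: list.rel_refl_strong)
  moreover have "fv_below \<phi> (length vs)"
    by (rule fv_below_mono[OF n]) (simp add: vs_def as_def)
  ultimately have "KF.rep (sol D b \<phi> vs) (sol D b \<phi> vs)" by (rule KF.rep_sol)
  then obtain Z where Z: "K Z" "ext E Z = sol D b \<phi> vs" unfolding KF.rep_def by blast
  have sat: "sat E D (asg b (y # as)) \<phi> \<longleftrightarrow> y = x" if "y \<in> D" for y
    using \<phi> that asg_pad[of b "y # \<alpha>s" n] unfolding as_def by simp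
  have "sol D b \<phi> vs = {pr x (tup as)}"
  proof
    show "sol D b \<phi> vs \<subseteq> {pr x (tup as)}"
    proof
      fix u assume "u \<in> sol D b \<phi> vs"
      then obtain y where y: "u = pr y (tup as)" "E y (VV \<zeta>)" "sat E D (asg b (y # as)) \<phi>"
        unfolding sol_def vs_def by (auto simp: list_all2_Cons2 list_all2_sing)
      then have "y = x" using sat D_mem[OF VV_in[OF \<zeta>(1)]] by blast
      then show "u \<in> {pr x (tup as)}" using y by simp
    qed
    show "{pr x (tup as)} \<subseteq> sol D b \<phi> vs"
      unfolding sol_def vs_def using sat[OF x] \<zeta>(2)
      by (auto simp: list_all2_sing intro!: exI[of _ "x # as"])
  qed
  then have EZ: "ext E Z = {pr x (tup as)}" using Z(2) by simp
  obtain Y where Y: "K Y" "ext E Y = op_set Dom (ext E Z) (ext E Z)" using K_op[OF Z(1) Z(1)] by blast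
  then have EY: "ext E Y = {x}" unfolding EZ by auto
  obtain X where X: "K X" "ext E X = op_set BigUn (ext E Y) (ext E Y)" using K_op[OF Y(1) Y(1)] by blast
  then have "ext E X = ext E x" unfolding EY by auto
  then show ?thesis using X(1) by simp
qed

lemma OD_iff: "x \<in> OD E D b \<longleftrightarrow> K x"
  using OD_K K_OD by blast

lemma HK_class: "{x \<in> D. HK b x} \<in> \<C>"
  by (rule definable_class_in) (intro par.subst2[of HK, OF fo_definable_parI, OF HK_fo] par_intros b_in)

lemma HK_K: "HK b x \<Longrightarrow> x \<in> D \<Longrightarrow> K x"
  unfolding HK_def KK_iff by blast

lemma HK_mem: assumes "HK b x" "E y x" shows "HK b y"
proof -
  obtain t where t: "t \<in> D" "trans_in t" "E x t" "\<forall>y\<in>D. E y t \<longrightarrow> KK b y"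
    using assms(1) unfolding HK_def by blast
  then have "E y t" using trans_in[OF t(1)] assms(2) by blast
  then show ?thesis using t unfolding HK_def by blast
qed

text \<open>\<open>HOD\<close> refers to a closure formed by classes, \<open>HK\<close> to a set of
  \<open>D\<close>. Separation inside a transitive superset shows that the closure is such a
  set.\<close>

lemma HOD_iff: "x \<in> HOD E \<C> D b \<longleftrightarrow> x \<in> D \<and> HK b x"
proof (cases "x \<in> D")
  case True
  have "HK b x" if HOD: "trcl E \<C> {x} \<subseteq> OD E D b"
  proof -
    obtain t where t: "t \<in> D" "E x t" "\<forall>x y. E x t \<longrightarrow> E y x \<longrightarrow> E y t"
      using transitive_superset'[OF True] by (elim bexE conjE) (rule that)
    have "\<exists>s\<in>D. \<forall>y. E y s \<longleftrightarrow> E y t \<and> tc x y"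
      by (rule separation[OF _ t(1)]) (intro par_intros tc_par True)
    then obtain s where s: "s \<in> D" "\<forall>y. E y s \<longleftrightarrow> E y t \<and> tc x y" by (elim bexE) (rule that)
    have "trans_in s" unfolding trans_in[OF s(1)] using s(2) t(3) tc_step by blast
    moreover have "E x s" using s(2) t(2) tc_refl by blast
    moreover have "KK b y" if "y \<in> D" "E y s" for y
      using HOD that s(2) unfolding trcl_sing[OF True] KK_iff OD_iff[symmetric] by blast
    ultimately show ?thesis unfolding HK_def using s(1) by blast
  qed
  moreover have "trcl E \<C> {x} \<subseteq> OD E D b" if HK: "HK b x"
  proof -
    obtain t where t: "t \<in> D" "trans_in t" "E x t" "\<forall>y\<in>D. E y t \<longrightarrow> KK b y" using HK unfolding HK_def by blast
    have "trcl E \<C> {x} \<subseteq> ext E t"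
      by (rule trcl_least) (use t trans_in[OF t(1)] in \<open>auto simp: transitive_def\<close>)
    then show ?thesis using t(4) D_mem[OF t(1)] unfolding KK_iff OD_iff[symmetric] by auto
  qed
  ultimately show ?thesis unfolding HOD_def using True by blast
qed (simp add: HOD_def)

text \<open>A set can have many names; for enumerated sets this compares the least ones.\<close>

definition enum_less :: "'v \<Rightarrow> 'v \<Rightarrow> bool" where
  "enum_less x y \<longleftrightarrow> (\<exists>\<gamma>\<in>D. enum b \<gamma> x \<and> (\<forall>\<delta>\<in>D. enum b \<delta> y \<longrightarrow> E \<gamma> \<delta>))"

lemma enum_class: "u \<in> D \<Longrightarrow> {\<gamma> \<in> D. \<exists>x\<in>D. E x u \<and> enum b \<gamma> x} \<in> \<C>"
  by (rule definable_class_in) (intro par_intros par.subst3[of enum, OF fo_definable_parI, OF enum_fo] b_in)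

lemma least_name:
  assumes "u \<in> D" "E x u" "K x"
  shows "\<exists>\<gamma> m. E m u \<and> enum b \<gamma> m \<and> (\<forall>\<delta> y. E y u \<longrightarrow> enum b \<delta> y \<longrightarrow> E \<gamma> \<delta> \<or> \<gamma> = \<delta> \<and> y = m)"
proof -
  obtain \<gamma> where "enum b \<gamma> x" using assms(3) unfolding K_def by blast
  moreover from this have "ordinal E \<gamma>" "x \<in> D" using enum_ordinal enum_in by auto
  moreover have "{\<gamma>. \<gamma> \<in> D \<and> (\<exists>x\<in>D. E x u \<and> enum b \<gamma> x)} \<in> \<C>" using enum_class[OF assms(1)] by simp
  ultimately have "\<exists>\<gamma>. ordinal E \<gamma> \<and> (\<gamma> \<in> D \<and> (\<exists>x\<in>D. E x u \<and> enum b \<gamma> x)) \<and>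
      (\<forall>\<delta>. E \<delta> \<gamma> \<longrightarrow> \<not> (\<delta> \<in> D \<and> (\<exists>x\<in>D. E x u \<and> enum b \<delta> x)))"
    using assms(2) ordinal_in by (intro ordinal_least) auto
  then obtain \<gamma> m where g: "ordinal E \<gamma>" "E m u" "enum b \<gamma> m" "\<forall>\<delta>. E \<delta> \<gamma> \<longrightarrow> \<not> (\<delta> \<in> D \<and> (\<exists>x\<in>D. E x u \<and> enum b \<delta> x))"
    by blast
  have "E \<gamma> \<delta> \<or> \<gamma> = \<delta> \<and> y = m" if y: "E y u" "enum b \<delta> y" for \<delta> y
  proof -
    have o: "ordinal E \<delta>" using enum_ordinal y(2) by blast
    have "\<not> E \<delta> \<gamma>" using g(4) y enum_in[OF y(2)] ordinal_in[OF o] by blast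
    then have "E \<gamma> \<delta> \<or> \<gamma> = \<delta>" using ordinal_linear[OF g(1) o] by blast
    then show ?thesis using enum_unique g(3) y(2) by blast
  qed
  then show ?thesis using g by blast
qed

lemma least_name_of:
  assumes "K x" shows "\<exists>\<gamma>. enum b \<gamma> x \<and> (\<forall>\<delta>. enum b \<delta> x \<longrightarrow> E \<gamma> \<delta> \<or> \<gamma> = \<delta>)"
  using least_name[of "sing x" x] assms K_in[OF assms] by auto

lemma enum_less_wo:
  assumes "\<And>x. x \<in> W \<Longrightarrow> K x"
  shows "well_orders E D enum_less W"
proof -
  \<comment> \<open>Least names are unique, so \<open>SOME\<close> merely provides a notation for
    them.\<close>
  define ix where "ix x = (SOME \<gamma>. enum b \<gamma> x \<and> (\<forall>\<delta>. enum b \<delta> x \<longrightarrow> E \<gamma> \<delta> \<or> \<gamma> = \<delta>))" for x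
  have ix: "enum b (ix x) x \<and> (\<forall>\<delta>. enum b \<delta> x \<longrightarrow> E (ix x) \<delta> \<or> ix x = \<delta>)" if "K x" for x
    unfolding ix_def by (rule someI_ex[OF least_name_of[OF that]])
  have ord: "ordinal E (ix x)" if "K x" for x using ix[OF that] enum_ordinal by blast
  have less: "enum_less x y \<longleftrightarrow> E (ix x) (ix y)" if x: "K x" and y: "K y" for x y
  proof
    assume "enum_less x y"
    then obtain \<gamma> where g: "enum b \<gamma> x" "\<forall>\<delta>\<in>D. enum b \<delta> y \<longrightarrow> E \<gamma> \<delta>" unfolding enum_less_def by blast
    have "E \<gamma> (ix y)" using g(2) ix[OF y] ordinal_in[OF ord[OF y]] by blast
    moreover have "E (ix x) \<gamma> \<or> ix x = \<gamma>" using ix[OF x] g(1) by blast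
    ultimately show "E (ix x) (ix y)" using ordinal_trans[OF ord[OF y]] by blast
  next
    assume l: "E (ix x) (ix y)"
    have "E (ix x) \<delta>" if "enum b \<delta> y" for \<delta>
      using ix[OF y] that l ordinal_trans[OF enum_ordinal[OF that], of "ix y" "ix x"] by blast
    then show "enum_less x y" unfolding enum_less_def using ix[OF x] ordinal_in[OF ord[OF x]] by blast
  qed
  have irr: "\<not> enum_less x x" if "K x" for x using less[OF that that] by simp
  have tr: "enum_less x z" if "K x" "K y" "K z" "enum_less x y" "enum_less y z" for x y z
    using that(4,5) ordinal_trans[OF ord[OF that(3)], of "ix y" "ix x"]
    unfolding less[OF that(1,2)] less[OF that(2,3)] less[OF that(1,3)] by blast
  have tot: "enum_less x y \<or> enum_less y x" if "K x" "K y" "x \<noteq> y" for x y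
  proof -
    have "ix x \<noteq> ix y" using ix[OF that(1)] ix[OF that(2)] enum_unique that(3) by metis
    then show ?thesis
      using ordinal_linear[OF ord[OF that(1)] ord[OF that(2)]]
      unfolding less[OF that(1,2)] less[OF that(2,1)] by blast
  qed
  have "\<exists>m\<in>ext E u. \<forall>x\<in>ext E u. x = m \<or> enum_less m x" if u: "u \<in> D" "ext E u \<subseteq> W" "ext E u \<noteq> {}" for u
  proof -
    have Ku: "K x" if "E x u" for x using assms u(2) that by auto
    obtain x where "E x u" using u(3) by auto
    then have "\<exists>\<gamma> m. E m u \<and> enum b \<gamma> m \<and> (\<forall>\<delta> y. E y u \<longrightarrow> enum b \<delta> y \<longrightarrow> E \<gamma> \<delta> \<or> \<gamma> = \<delta> \<and> y = m)"
      by (intro least_name[OF u(1)] Ku)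
    then obtain \<gamma> m where m: "E m u" "enum b \<gamma> m" "\<forall>\<delta> y. E y u \<longrightarrow> enum b \<delta> y \<longrightarrow> E \<gamma> \<delta> \<or> \<gamma> = \<delta> \<and> y = m"
      by (elim exE conjE) (rule that)
    have "x = m \<or> enum_less m x" if "E x u" for x
      unfolding enum_less_def using m that ordinal_in[OF enum_ordinal[OF m(2)]] by blast
    then show ?thesis using m(1) by (intro bexI[of _ m]) auto
  qed
  then show ?thesis
    unfolding well_orders_def irreflp_on_def transp_on_def totalp_on_def
    using irr tr tot assms by (intro conjI ballI impI) (blast | simp)+
qed

theorem trcl_definably_well_ordered_iff:
  assumes A: "A = definable_class E D b \<phi>"
  shows "trcl_definably_well_ordered E \<C> D b A \<longleftrightarrow> A \<subseteq> HOD E \<C> D b"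
proof
  have Apar: "fo_definable_par E D (\<lambda>e. sat E D (asg b [e 0]) \<phi>)"
    by (rule par.subst2[of "\<lambda>x c. sat E D (asg c [x]) \<phi>", OF fo_definable_parI])
      (intro sat1_fo fo.var par.var par_const b_in)+
  have AD: "A = {x \<in> D. sat E D (asg b [x]) \<phi>}" by (simp add: A definable_class_def)
  have trclA: "trcl E \<C> A = {x \<in> D. \<exists>a\<in>D. sat E D (asg b [a]) \<phi> \<and> tc a x}"
    unfolding AD by (rule trcl_definable[OF Apar])
  {
    assume "trcl_definably_well_ordered E \<C> D b A"
    then obtain \<psi> where wo: "well_orders E D (\<lambda>x y. sat E D (asg b [x, y]) \<psi>) (trcl E \<C> A)"
      unfolding trcl_definably_well_ordered_def by blast
    define r where "r c x y \<longleftrightarrow> sat E D (asg c [x, y]) \<psi>" for c x y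
    define P where "P c \<zeta> z \<longleftrightarrow> V_mem z \<zeta> \<and> (\<exists>a\<in>D. sat E D (asg c [a]) \<phi> \<and> tc a z) \<and> \<not> KK c z" for c \<zeta> z
    define Q where "Q y \<zeta> c \<longleftrightarrow> P c \<zeta> y \<and> (\<forall>z\<in>D. P c \<zeta> z \<longrightarrow> z = y \<or> r c y z)" for y \<zeta> c
    have P_fo: "fo_definable E D (\<lambda>e. P (e 0) (e 1) (e 2))"
      unfolding P_def
      by (intro fo_intros V_mem_fo sat1_fo fo.subst2[of tc, OF tc_fo] fo.subst2[of KK, OF KK_fo])
    have Q_fo: "fo_definable E D (\<lambda>e. Q (e 0) (e 1) (e 2))"
      unfolding Q_def r_def by (intro fo_intros fo.subst3[of P, OF P_fo] sat2_fo)
    have "K x" if x: "x \<in> trcl E \<C> A" for x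
    proof (rule ccontr)
      assume nK: "\<not> K x"
      have xD: "x \<in> D" using x trclA by blast
      obtain \<zeta> where \<zeta>: "V_mem x \<zeta>" using in_VV[OF xD] by blast
      then have o: "ordinal E \<zeta>" unfolding V_mem_def by blast
      \<comment> \<open>\<open>well_orders\<close> gives least elements for sets of \<open>D\<close>
        only, hence the restriction to V_\<zeta>.\<close>
      have "\<exists>u\<in>D. \<forall>z. E z u \<longleftrightarrow> z \<in> D \<and> P b \<zeta> z"
        by (rule bounded_comprehension[OF _ VV_in[OF o]])
          (intro par.subst3[of P, OF fo_definable_parI, OF P_fo] par_intros b_in ordinal_in o, simp add: P_def V_mem_def)
      then obtain u where u: "u \<in> D" "\<forall>z. E z u \<longleftrightarrow> z \<in> D \<and> P b \<zeta> z" by (elim bexE) (rule that)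
      have uW: "z \<in> trcl E \<C> A" if "E z u" for z using that u(2) unfolding trclA P_def by blast
      have "P b \<zeta> x" using x \<zeta> nK unfolding P_def trclA KK_iff by blast
      then have "E x u" using u(2) xD by blast
      then have "ext E u \<subseteq> trcl E \<C> A \<and> ext E u \<noteq> {}" using uW by auto
      then obtain m where m: "E m u" "\<forall>z. E z u \<longrightarrow> z = m \<or> r b m z"
        using wo u(1) unfolding well_orders_def r_def by (metis in_ext_iff)
      have irr: "\<not> r b z z" if "E z u" for z
        using wo uW[OF that] unfolding well_orders_def irreflp_on_def r_def by blast
      have tr: "r b y z \<Longrightarrow> r b z y \<Longrightarrow> False" if "E y u" "E z u" for y z
        using wo uW[OF that(1)] uW[OF that(2)] irr[OF that(1)] unfolding well_orders_def transp_on_def r_def by blast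
      have Qm: "Q y \<zeta> b \<longleftrightarrow> y = m" if "y \<in> D" for y
      proof
        assume "Q y \<zeta> b"
        then have y: "E y u" "\<forall>z\<in>D. P b \<zeta> z \<longrightarrow> z = y \<or> r b y z" using u(2) that unfolding Q_def by blast+
        then have "m = y \<or> r b y m" using m(1) u(2) by blast
        then show "y = m" using m(2) y(1) tr[OF y(1) m(1)] by blast
      next
        assume "y = m"
        then show "Q y \<zeta> b" using m u(2) unfolding Q_def by blast
      qed
      have mD: "m \<in> D" using D_mem u(1) m(1) by blast
      have "m \<in> OD E D b" by (rule OD_I[OF Q_fo o mD Qm])
      moreover have "\<not> K m" using m(1) u(2) unfolding P_def KK_iff by blast
      ultimately show False using OD_K by blast
    qed
    then have sub: "trcl E \<C> A \<subseteq> OD E D b" using K_OD by blast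
    show "A \<subseteq> HOD E \<C> D b"
    proof
      fix a assume a: "a \<in> A"
      then have "trcl E \<C> {a} \<subseteq> trcl E \<C> A" by (intro trcl_mono) simp
      then show "a \<in> HOD E \<C> D b" using sub a AD unfolding HOD_def by blast
    qed
  next
    assume "A \<subseteq> HOD E \<C> D b"
    then have "A \<subseteq> {x \<in> D. HK b x}" using HOD_iff by blast
    moreover have "transitive E {x \<in> D. HK b x}"
      unfolding transitive_def by (auto intro: HK_mem dest: D_mem)
    ultimately have sub: "trcl E \<C> A \<subseteq> {x \<in> D. HK b x}" by (rule trcl_least[OF HK_class])
    have "fo_definable E D (\<lambda>e. \<exists>\<gamma>\<in>D. enum (e 2) \<gamma> (e 0) \<and> (\<forall>\<delta>\<in>D. enum (e 2) \<delta> (e 1) \<longrightarrow> E \<gamma> \<delta>))"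
      by (intro fo_intros fo.subst3[of enum, OF enum_fo])
    then obtain \<psi> where \<psi>: "\<forall>e. range e \<subseteq> D \<longrightarrow> (sat E D e \<psi> \<longleftrightarrow>
        (\<exists>\<gamma>\<in>D. enum (e 2) \<gamma> (e 0) \<and> (\<forall>\<delta>\<in>D. enum (e 2) \<delta> (e 1) \<longrightarrow> E \<gamma> \<delta>)))"
      unfolding fo_definable_def by (elim exE)
    have \<psi>': "sat E D (asg b [x, y]) \<psi> \<longleftrightarrow> enum_less x y" if "x \<in> D" "y \<in> D" for x y
    proof -
      have "range (asg b [x, y]) \<subseteq> D" using that by (intro range_asg) simp
      then show ?thesis using \<psi> unfolding enum_less_def by (simp add: asg_def)
    qed
    have W: "x \<in> D \<and> K x" if "x \<in> trcl E \<C> A" for x using that sub HK_K by blast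
    have "well_orders E D enum_less (trcl E \<C> A)" by (rule enum_less_wo) (use W in blast)
    then have "well_orders E D (\<lambda>x y. sat E D (asg b [x, y]) \<psi>) (trcl E \<C> A)"
      by (rule well_orders_cong) (use \<psi>' W in blast)
    then show "trcl_definably_well_ordered E \<C> D b A"
      unfolding trcl_definably_well_ordered_def by blast
  }
qed

end

section \<open>Bounded formulas\<close>

lemma rename_BForall: "rename f (BForall i \<phi>) = BForall (f i) (rename (case_nat 0 (\<lambda>i. Suc (f i))) \<phi>)"
  by (simp add: BForall_def)

lemma delta0_rename: "delta0 \<phi> \<Longrightarrow> delta0 (rename f \<phi>)"
proof (induction arbitrary: f rule: delta0.induct)
  case (5 \<phi> i)
  then show ?case unfolding rename_BForall by (intro delta0.intros)
qed (auto intro: delta0.intros)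

context ngb
begin

text \<open>Bounded definability and absoluteness in one: the same formula works in every transitive
  class, so that elementarity between \<open>M\<close> and \<open>N\<close> becomes a statement
  about \<open>P\<close> itself.\<close>

definition d0 :: "((nat \<Rightarrow> 'v) \<Rightarrow> bool) \<Rightarrow> bool" where
  "d0 P \<longleftrightarrow> (\<exists>\<phi>. delta0 \<phi> \<and> (\<forall>D e. transitive E D \<longrightarrow> range e \<subseteq> D \<longrightarrow> (sat E D e \<phi> \<longleftrightarrow> P e)))"

lemma d0I: "delta0 \<phi> \<Longrightarrow> (\<And>D e. transitive E D \<Longrightarrow> range e \<subseteq> D \<Longrightarrow> sat E D e \<phi> \<longleftrightarrow> P e) \<Longrightarrow> d0 P"
  unfolding d0_def by blast

lemma d0_mem: "d0 (\<lambda>e. E (e i) (e k))"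
  by (rule d0I[of "Mem i k"]) (auto intro: delta0.intros)

lemma d0_eq: "d0 (\<lambda>e. e i = e k)"
  by (rule d0I[of "Eq i k"]) (auto intro: delta0.intros)

lemma d0_neg: assumes "d0 P" shows "d0 (\<lambda>e. \<not> P e)"
proof -
  obtain \<phi> where "delta0 \<phi>" "\<forall>D e. transitive E D \<longrightarrow> range e \<subseteq> D \<longrightarrow> (sat E D e \<phi> \<longleftrightarrow> P e)"
    using assms unfolding d0_def by (elim exE conjE)
  then show ?thesis by (intro d0I[of "Neg \<phi>"]) (auto intro: delta0.intros)
qed

lemma d0_conj: assumes "d0 P" "d0 Q" shows "d0 (\<lambda>e. P e \<and> Q e)"
proof -
  obtain \<phi> where "delta0 \<phi>" "\<forall>D e. transitive E D \<longrightarrow> range e \<subseteq> D \<longrightarrow> (sat E D e \<phi> \<longleftrightarrow> P e)"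
    using assms(1) unfolding d0_def by (elim exE conjE)
  moreover obtain \<psi> where "delta0 \<psi>" "\<forall>D e. transitive E D \<longrightarrow> range e \<subseteq> D \<longrightarrow> (sat E D e \<psi> \<longleftrightarrow> Q e)"
    using assms(2) unfolding d0_def by (elim exE conjE)
  ultimately show ?thesis by (intro d0I[of "Conj \<phi> \<psi>"]) (auto intro: delta0.intros)
qed

lemma d0_imp: "d0 P \<Longrightarrow> d0 Q \<Longrightarrow> d0 (\<lambda>e. P e \<longrightarrow> Q e)"
  using d0_neg[OF d0_conj[OF _ d0_neg], of P Q] by simp

lemma d0_disj: "d0 P \<Longrightarrow> d0 Q \<Longrightarrow> d0 (\<lambda>e. P e \<or> Q e)"
  using d0_neg[OF d0_conj[OF d0_neg d0_neg], of P Q] by simp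

lemma d0_ren: assumes "d0 P" shows "d0 (\<lambda>e. P (\<lambda>i. e (f i)))"
proof -
  obtain \<phi> where \<phi>: "delta0 \<phi>" "\<forall>D e. transitive E D \<longrightarrow> range e \<subseteq> D \<longrightarrow> (sat E D e \<phi> \<longleftrightarrow> P e)"
    using assms unfolding d0_def by (elim exE conjE)
  show ?thesis
  proof (rule d0I[OF delta0_rename[OF \<phi>(1), of f]])
    fix D and e :: "nat \<Rightarrow> 'v"
    assume D: "transitive E D" and e: "range e \<subseteq> D"
    show "sat E D e (rename f \<phi>) \<longleftrightarrow> P (\<lambda>i. e (f i))"
      unfolding sat_rename using \<phi>(2)[rule_format, OF D range_renamed[OF e]] .
  qed
qed

lemma d0_ball: assumes "d0 (\<lambda>e. R (e 0) (\<lambda>i. e (Suc i)))" shows "d0 (\<lambda>e. \<forall>x. E x (e i) \<longrightarrow> R x e)"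
proof -
  obtain \<phi> where \<phi>: "delta0 \<phi>"
    "\<forall>D e. transitive E D \<longrightarrow> range e \<subseteq> D \<longrightarrow> (sat E D e \<phi> \<longleftrightarrow> R (e 0) (\<lambda>i. e (Suc i)))"
    using assms unfolding d0_def by (elim exE conjE)
  show ?thesis
  proof (rule d0I[OF delta0.intros(5)[OF \<phi>(1), of i]])
    fix D and e :: "nat \<Rightarrow> 'v"
    assume D: "transitive E D" and e: "range e \<subseteq> D"
    have sub: "x \<in> D" if "E x (e i)" for x
      using D e that unfolding transitive_def by (metis in_ext_iff rangeI subsetD)
    have "sat E D (case_nat x e) \<phi> \<longleftrightarrow> R x e" if "x \<in> D" for x
      using \<phi>(2)[rule_format, OF D, of "case_nat x e"] e that by simp
    then show "sat E D e (BForall i \<phi>) \<longleftrightarrow> (\<forall>x. E x (e i) \<longrightarrow> R x e)"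
      unfolding BForall_def using sub by auto
  qed
qed

lemma d0_bex: "d0 (\<lambda>e. R (e 0) (\<lambda>i. e (Suc i))) \<Longrightarrow> d0 (\<lambda>e. \<exists>x. E x (e i) \<and> R x e)"
  using d0_neg[OF d0_ball[of "\<lambda>x e. \<not> R x e" i], OF d0_neg] by simp

lemmas d0_intros = d0_conj d0_disj d0_imp d0_neg d0_ball d0_bex d0_mem d0_eq

lemma d0_sing: "d0 (\<lambda>e. e i = sing (e k))"
proof -
  have "d0 (\<lambda>e. E (e k) (e i) \<and> (\<forall>x. E x (e i) \<longrightarrow> x = e k))" by (intro d0_intros)
  moreover have "E y z \<and> (\<forall>x. E x z \<longrightarrow> x = y) \<longleftrightarrow> z = sing y" for y z
    using set_eqI[of z "sing y"] by auto
  ultimately show ?thesis by simp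
qed

lemma d0_upair: "d0 (\<lambda>e. e i = upair (e k) (e l))"
proof -
  have "d0 (\<lambda>e. E (e k) (e i) \<and> E (e l) (e i) \<and> (\<forall>x. E x (e i) \<longrightarrow> x = e k \<or> x = e l))" by (intro d0_intros)
  moreover have "E y z \<and> E y' z \<and> (\<forall>x. E x z \<longrightarrow> x = y \<or> x = y') \<longleftrightarrow> z = upair y y'" for y y' z
    using set_eqI[of z "upair y y'"] by auto
  ultimately show ?thesis by simp
qed

lemma d0_pr: "d0 (\<lambda>e. e i = pr (e k) (e l))"
proof -
  have "d0 (\<lambda>e. (\<exists>s. E s (e i) \<and> s = sing (e k)) \<and> (\<exists>s. E s (e i) \<and> s = upair (e k) (e l)) \<and>
      (\<forall>x. E x (e i) \<longrightarrow> x = sing (e k) \<or> x = upair (e k) (e l)))" by (intro d0_intros d0_sing d0_upair)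
  moreover have "(\<exists>s. E s z \<and> s = sing x) \<and> (\<exists>s. E s z \<and> s = upair x y) \<and>
      (\<forall>u. E u z \<longrightarrow> u = sing x \<or> u = upair x y) \<longleftrightarrow> z = pr x y" for x y z
    using set_eqI[of z "pr x y"] unfolding pr_def by auto
  ultimately show ?thesis by simp
qed

text \<open>The components of a pair are elements of its element \<open>upair x y\<close>, so the
  quantifiers over them are bounded.\<close>

lemma d0_ex_pr:
  assumes "d0 (\<lambda>e. R (e 1) (e 0) (\<lambda>i. e (Suc (Suc i))))" shows "d0 (\<lambda>e. \<exists>x y. e i = pr x y \<and> R x y e)"
proof -
  have "d0 (\<lambda>e. R (e 1) (e 0) (\<lambda>i. e (Suc (Suc (Suc i)))))"
    using d0_ren[OF assms, of "\<lambda>i. if i < 2 then i else Suc i"] by simp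
  then have "d0 (\<lambda>e. \<exists>s. E s (e i) \<and> (\<exists>x. E x s \<and> (\<exists>y. E y s \<and> e i = pr x y \<and> R x y e)))"
    by (intro d0_intros d0_pr) simp
  moreover have "(\<exists>s. E s z \<and> (\<exists>x. E x s \<and> (\<exists>y. E y s \<and> z = pr x y \<and> R x y e))) \<longleftrightarrow> (\<exists>x y. z = pr x y \<and> R x y e)" for z e
  proof -
    have "E (upair x y) (pr x y)" for x y unfolding pr_def by simp
    then show ?thesis by (metis E_upair)
  qed
  ultimately show ?thesis by simp
qed

lemma d0_all_pr:
  assumes "d0 (\<lambda>e. R (e 1) (e 0) (\<lambda>i. e (Suc (Suc i))))" shows "d0 (\<lambda>e. \<forall>x y. e i = pr x y \<longrightarrow> R x y e)"
  using d0_neg[OF d0_ex_pr[of "\<lambda>x y e. \<not> R x y e" i], OF d0_neg[OF assms]] by simp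

text \<open>By this, preservation of bounded formulas suffices for \<open>j\<close> to commute with
  the set operations.\<close>

lemma d0_op: "d0 (\<lambda>e. ext E (e 0) = op_set g (ext E (e 1)) (ext E (e 2)))"
proof -
  have flt: "d0 (\<lambda>e. (\<forall>u. E u (e 0) \<longrightarrow> E u (e 1) \<and> (\<exists>x q. u = pr x q \<and> (\<exists>y d. q = pr y d \<and> r x y))) \<and>
      (\<forall>u. E u (e 1) \<longrightarrow> (\<forall>x q. u = pr x q \<longrightarrow> (\<forall>y d. q = pr y d \<longrightarrow> r x y \<longrightarrow> E u (e 0)))))"
    if "\<And>i k. d0 (\<lambda>e. r (e i) (e k))" for r
    by (intro d0_intros d0_ex_pr d0_all_pr that)
  have flt': "(\<forall>u. E u Z \<longrightarrow> E u X \<and> (\<exists>x q. u = pr x q \<and> (\<exists>y d. q = pr y d \<and> r x y))) \<and>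
      (\<forall>u. E u X \<longrightarrow> (\<forall>x q. u = pr x q \<longrightarrow> (\<forall>y d. q = pr y d \<longrightarrow> r x y \<longrightarrow> E u Z))) \<longleftrightarrow>
      ext E Z = {u \<in> ext E X. \<exists>x y d. u = pr x (pr y d) \<and> r x y}" for Z X r
    unfolding set_eq_iff in_ext_iff mem_Collect_eq by blast
  show ?thesis
  proof (cases g)
    case Diff
    have "d0 (\<lambda>e. (\<forall>u. E u (e 0) \<longrightarrow> E u (e 1) \<and> \<not> E u (e 2)) \<and> (\<forall>u. E u (e 1) \<longrightarrow> \<not> E u (e 2) \<longrightarrow> E u (e 0)))"
      by (intro d0_intros)
    moreover have "(\<forall>u. E u Z \<longrightarrow> E u X \<and> \<not> E u Y) \<and> (\<forall>u. E u X \<longrightarrow> \<not> E u Y \<longrightarrow> E u Z) \<longleftrightarrow>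
        ext E Z = op_set g (ext E X) (ext E Y)" for X Y Z
      unfolding Diff op_set.simps set_eq_iff Diff_iff in_ext_iff by blast
    ultimately show ?thesis by simp
  next
    case Prod
    have "d0 (\<lambda>e. (\<forall>u. E u (e 0) \<longrightarrow> (\<exists>x y. u = pr x y \<and> E x (e 1) \<and> E y (e 2))) \<and>
        (\<forall>x. E x (e 1) \<longrightarrow> (\<forall>y. E y (e 2) \<longrightarrow> (\<exists>u. E u (e 0) \<and> u = pr x y))))"
      by (intro d0_intros d0_ex_pr d0_pr)
    moreover have "(\<forall>u. E u Z \<longrightarrow> (\<exists>x y. u = pr x y \<and> E x X \<and> E y Y)) \<and>
        (\<forall>x. E x X \<longrightarrow> (\<forall>y. E y Y \<longrightarrow> (\<exists>u. E u Z \<and> u = pr x y))) \<longleftrightarrow>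
        ext E Z = op_set g (ext E X) (ext E Y)" for X Y Z
      unfolding Prod op_set.simps set_eq_iff mem_Collect_eq in_ext_iff Bex_def by blast
    ultimately show ?thesis by simp
  next
    case Ran
    have "d0 (\<lambda>e. (\<forall>u. E u (e 0) \<longrightarrow> (\<exists>p. E p (e 1) \<and> (\<exists>x y. p = pr x y \<and> y = u))) \<and>
        (\<forall>p. E p (e 1) \<longrightarrow> (\<forall>x y. p = pr x y \<longrightarrow> E y (e 0))))"
      by (intro d0_intros d0_ex_pr d0_all_pr)
    moreover have "(\<forall>u. E u Z \<longrightarrow> (\<exists>p. E p X \<and> (\<exists>x y. p = pr x y \<and> y = u))) \<and>
        (\<forall>p. E p X \<longrightarrow> (\<forall>x y. p = pr x y \<longrightarrow> E y Z)) \<longleftrightarrow>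
        ext E Z = op_set g (ext E X) (ext E Y)" for X Y Z
      unfolding Ran op_set.simps set_eq_iff mem_Collect_eq in_ext_iff by blast
    ultimately show ?thesis by simp
  next
    case Dom
    have "d0 (\<lambda>e. (\<forall>u. E u (e 0) \<longrightarrow> (\<exists>p. E p (e 1) \<and> (\<exists>x y. p = pr x y \<and> x = u))) \<and>
        (\<forall>p. E p (e 1) \<longrightarrow> (\<forall>x y. p = pr x y \<longrightarrow> E x (e 0))))"
      by (intro d0_intros d0_ex_pr d0_all_pr)
    moreover have "(\<forall>u. E u Z \<longrightarrow> (\<exists>p. E p X \<and> (\<exists>x y. p = pr x y \<and> x = u))) \<and>
        (\<forall>p. E p X \<longrightarrow> (\<forall>x y. p = pr x y \<longrightarrow> E x Z)) \<longleftrightarrow>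
        ext E Z = op_set g (ext E X) (ext E Y)" for X Y Z
      unfolding Dom op_set.simps set_eq_iff mem_Collect_eq in_ext_iff by blast
    ultimately show ?thesis by simp
  next
    case Ins
    have "d0 (\<lambda>e. (\<forall>u. E u (e 0) \<longrightarrow> (\<exists>x q. u = pr x q \<and> (\<exists>y d. q = pr y d \<and> E y (e 2) \<and> (\<exists>p. E p (e 1) \<and> p = pr x d)))) \<and>
        (\<forall>p. E p (e 1) \<longrightarrow> (\<forall>x d. p = pr x d \<longrightarrow> (\<forall>y. E y (e 2) \<longrightarrow>
          (\<exists>u. E u (e 0) \<and> (\<exists>x' q. u = pr x' q \<and> x' = x \<and> q = pr y d))))))"
      by (intro d0_intros d0_ex_pr d0_all_pr d0_pr)
    moreover have "(\<forall>u. E u Z \<longrightarrow> (\<exists>x q. u = pr x q \<and> (\<exists>y d. q = pr y d \<and> E y Y \<and> (\<exists>p. E p X \<and> p = pr x d)))) \<and>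
        (\<forall>p. E p X \<longrightarrow> (\<forall>x d. p = pr x d \<longrightarrow> (\<forall>y. E y Y \<longrightarrow>
          (\<exists>u. E u Z \<and> (\<exists>x' q. u = pr x' q \<and> x' = x \<and> q = pr y d))))) \<longleftrightarrow>
        ext E Z = op_set g (ext E X) (ext E Y)" for X Y Z
    proof -
      have "(\<forall>u. E u Z \<longrightarrow> (\<exists>x q. u = pr x q \<and> (\<exists>y d. q = pr y d \<and> E y Y \<and> (\<exists>p. E p X \<and> p = pr x d)))) \<longleftrightarrow>
          ext E Z \<subseteq> op_set Ins (ext E X) (ext E Y)" by auto
      moreover have "(\<forall>p. E p X \<longrightarrow> (\<forall>x d. p = pr x d \<longrightarrow> (\<forall>y. E y Y \<longrightarrow>
          (\<exists>u. E u Z \<and> (\<exists>x' q. u = pr x' q \<and> x' = x \<and> q = pr y d))))) \<longleftrightarrow>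
          op_set Ins (ext E X) (ext E Y) \<subseteq> ext E Z" by (auto simp: subset_iff Bex_def)
      ultimately show ?thesis unfolding Ins by (simp only: set_eq_subset)
    qed
    ultimately show ?thesis by simp
  next
    case FMem
    show ?thesis using flt[of E, OF d0_mem] unfolding flt' FMem op_set.simps .
  next
    case FCon
    show ?thesis using flt[of "\<lambda>x y. E y x", OF d0_mem] unfolding flt' FCon op_set.simps .
  next
    case FEq
    show ?thesis using flt[of "(=)", OF d0_eq] unfolding flt' FEq op_set.simps .
  next
    case BigUn
    have "d0 (\<lambda>e. (\<forall>u. E u (e 0) \<longrightarrow> (\<exists>x. E x (e 1) \<and> E u x)) \<and> (\<forall>x. E x (e 1) \<longrightarrow> (\<forall>u. E u x \<longrightarrow> E u (e 0))))"
      by (intro d0_intros)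
    moreover have "(\<forall>u. E u Z \<longrightarrow> (\<exists>x. E x X \<and> E u x)) \<and> (\<forall>x. E x X \<longrightarrow> (\<forall>u. E u x \<longrightarrow> E u Z)) \<longleftrightarrow>
        ext E Z = op_set g (ext E X) (ext E Y)" for X Y Z
      unfolding BigUn op_set.simps set_eq_iff mem_Collect_eq in_ext_iff Bex_def by blast
    ultimately show ?thesis by simp
  qed
qed

lemma d0_ordinal: "d0 (\<lambda>e. ordinal E (e 0))"
proof -
  have "d0 (\<lambda>e. (\<forall>y. E y (e 0) \<longrightarrow> (\<forall>z. E z y \<longrightarrow> E z (e 0))) \<and>
    (\<forall>y. E y (e 0) \<longrightarrow> (\<forall>z. E z (e 0) \<longrightarrow> E y z \<or> y = z \<or> E z y)))" by (intro d0_intros)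
  then show ?thesis unfolding ordinal_iff by simp
qed

end

section \<open>Iterating the embedding\<close>

locale embedding = ngb E \<C> for E :: "'v mem" and \<C> +
  fixes M N :: "'v set" and j :: "'v \<Rightarrow> 'v" and b :: 'v and \<psi> :: fm
  assumes M_inner: "inner_model E \<C> M" and N_inner: "inner_model E \<C> N" and M_N: "M \<subseteq> N"
    and elem: "elementary_embedding E \<C> j M N" and b_M: "b \<in> M" and j_b: "j b = b"
    and M_def: "M = definable_class E N b \<psi>"
begin

sublocale Mi: inner E \<C> M
  by unfold_locales (rule M_inner)

sublocale Ni: inner_param E \<C> N b
  by unfold_locales (use N_inner b_M M_N in auto)

lemma j_in: "x \<in> M \<Longrightarrow> j x \<in> N"
  using elem unfolding elementary_embedding_def by blast

lemma j_cofinal: "y \<in> N \<Longrightarrow> \<exists>x\<in>M. E y (j x)"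
  using elem unfolding elementary_embedding_def by blast

lemma d0_transfer: assumes "d0 P" "range e \<subseteq> M" shows "P e \<longleftrightarrow> P (j \<circ> e)"
proof -
  obtain \<phi> where \<phi>: "delta0 \<phi>" "\<forall>D e. transitive E D \<longrightarrow> range e \<subseteq> D \<longrightarrow> (sat E D e \<phi> \<longleftrightarrow> P e)"
    using assms(1) unfolding d0_def by (elim exE conjE)
  have "\<forall>\<phi> e. delta0 \<phi> \<longrightarrow> range e \<subseteq> M \<longrightarrow> (sat E M e \<phi> \<longleftrightarrow> sat E N (j \<circ> e) \<phi>)"
    using elem unfolding elementary_embedding_def by (elim conjE)
  then have "sat E M e \<phi> \<longleftrightarrow> sat E N (j \<circ> e) \<phi>" using \<phi>(1) assms(2) by blast
  moreover have "sat E M e \<phi> \<longleftrightarrow> P e" using \<phi>(2)[rule_format, OF Mi.D_trans assms(2)] .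
  moreover have "range (j \<circ> e) \<subseteq> N" using assms(2) j_in by auto
  then have "sat E N (j \<circ> e) \<phi> \<longleftrightarrow> P (j \<circ> e)" using \<phi>(2)[rule_format, OF Ni.D_trans] by blast
  ultimately show ?thesis by simp
qed

lemma d0_transfer3:
  assumes "d0 (\<lambda>e. R (e 0) (e 1) (e 2))" "x \<in> M" "y \<in> M" "z \<in> M"
  shows "R x y z \<longleftrightarrow> R (j x) (j y) (j z)"
  using d0_transfer[OF assms(1), of "case_nat x (case_nat y (\<lambda>_. z))"] assms(2-4)
  by (simp add: numeral_2_eq_2)

lemma d0_transfer2:
  assumes "d0 (\<lambda>e. R (e 0) (e 1))" "x \<in> M" "y \<in> M" shows "R x y \<longleftrightarrow> R (j x) (j y)"
  using d0_transfer3[of "\<lambda>x y z. R x y", OF assms(1,2,3,3)] .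

lemma d0_transfer1: assumes "d0 (\<lambda>e. R (e 0))" "x \<in> M" shows "R x \<longleftrightarrow> R (j x)"
  using d0_transfer3[of "\<lambda>x y z. R x", OF assms(1,2,2,2)] .

lemma j_mem: "x \<in> M \<Longrightarrow> y \<in> M \<Longrightarrow> E (j x) (j y) \<longleftrightarrow> E x y"
  using d0_transfer2[of E, OF d0_mem] by blast

lemma j_inject: "x \<in> M \<Longrightarrow> y \<in> M \<Longrightarrow> j x = j y \<longleftrightarrow> x = y"
  using d0_transfer2[of "(=)", OF d0_eq] by blast

lemma j_ordinal: "x \<in> M \<Longrightarrow> ordinal E (j x) \<longleftrightarrow> ordinal E x"
  using d0_transfer1[of "ordinal E", OF d0_ordinal] by blast

lemma j_sing: "x \<in> M \<Longrightarrow> j (sing x) = sing (j x)"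
  using d0_transfer2[of "\<lambda>z x. z = sing x", OF d0_sing, of "sing x" x] by simp

lemma j_zero: "j zero = zero"
proof -
  have "d0 (\<lambda>e. \<forall>x. E x (e 0) \<longrightarrow> x \<noteq> x)" by (intro d0_intros)
  then have "\<forall>x. E x (j zero) \<longrightarrow> x \<noteq> x"
    using d0_transfer1[of "\<lambda>z. \<forall>x. E x z \<longrightarrow> x \<noteq> x" zero] Mi.zero_in by simp
  then show ?thesis by (intro set_eqI) simp
qed

lemma j_empty: assumes "x \<in> M" shows "ext E (j x) = {} \<longleftrightarrow> ext E x = {}"
proof -
  have "(\<forall>y. E y x \<longrightarrow> y \<noteq> y) \<longleftrightarrow> (\<forall>y. E y (j x) \<longrightarrow> y \<noteq> y)"
    by (rule d0_transfer1[OF _ assms]) (intro d0_intros)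
  then show ?thesis by auto
qed

lemma j_subset: assumes "x \<in> M" "y \<in> M" "ext E x \<subseteq> ext E y" shows "ext E (j x) \<subseteq> ext E (j y)"
proof -
  have "(\<forall>z. E z x \<longrightarrow> E z y) \<longleftrightarrow> (\<forall>z. E z (j x) \<longrightarrow> E z (j y))"
    by (rule d0_transfer2[OF _ assms(1,2)]) (intro d0_intros)
  then show ?thesis using assms(3) by auto
qed

text \<open>\<open>j\<close> is a function of HOL. Predicative formulas express
  \<open>z = j x\<close>, for \<open>x\<close> in \<open>M\<close>, by membership of
  \<open>pr x z\<close> in this class.\<close>

definition J :: "'v set" where
  "J = {p. \<exists>x\<in>M. p = pr x (j x)}"

lemma J_class: "J \<in> \<C>"
  using elem unfolding elementary_embedding_def J_def is_opair_iff by (elim conjE)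

lemma pr_J [simp]: "pr x y \<in> J \<longleftrightarrow> x \<in> M \<and> y = j x"
  by (auto simp: J_def)

definition repj :: "'v set \<Rightarrow> 'v set \<Rightarrow> bool" where
  "repj A A' \<longleftrightarrow> (\<exists>Z\<in>M. ext E Z = A \<and> ext E (j Z) = A')"

lemma repj_ext: "x \<in> M \<Longrightarrow> repj (ext E x) (ext E (j x))"
  unfolding repj_def by blast

lemma repj_op: assumes "repj A A'" "repj B B'" shows "repj (op_set g A B) (op_set g A' B')"
proof -
  obtain X Y where X: "X \<in> M" "Y \<in> M" "ext E X = A" "ext E (j X) = A'" "ext E Y = B" "ext E (j Y) = B'"
    using assms unfolding repj_def by blast
  obtain Z where Z: "Z \<in> M" "ext E Z = op_set g (ext E X) (ext E Y)" using Mi.op_closed[OF X(1,2)] by blast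
  have "ext E (j Z) = op_set g (ext E (j X)) (ext E (j Y))"
    using d0_transfer3[of "\<lambda>z x y. ext E z = op_set g (ext E x) (ext E y)", OF d0_op Z(1) X(1,2)] Z(2) by blast
  then show ?thesis unfolding repj_def using Z X by auto
qed

lemma repj_diff: "repj A A' \<Longrightarrow> repj B B' \<Longrightarrow> repj (A - B) (A' - B')"
  using repj_op[of A A' B B' Diff] by simp

lemma repj_subset: assumes "repj A A'" "repj B B'" "A \<subseteq> B" shows "A' \<subseteq> B'"
  using assms j_subset unfolding repj_def by blast

text \<open>
  \<open>iter m x\<close> says that the \<open>m\<close>-th iterate of \<open>j\<close> is defined at \<open>x\<close>, where \<open>m\<close> is a natural number
  of the universe.  Natural numbers are coded as \<open>\<emptyset>, {\<emptyset>}, {{\<emptyset>}}, \<dots>\<close>; the condition also forces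
  \<open>m\<close> to be one.
\<close>

definition iter :: "'v \<Rightarrow> 'v \<Rightarrow> bool" where
  "iter m x \<longleftrightarrow> (\<exists>f. E (pr m x) f \<and> (\<forall>u. E u f \<longrightarrow> (\<exists>y\<in>N. u = pr zero y) \<or>
    (\<exists>k. \<exists>y\<in>M. \<exists>z. pr y z \<in> J \<and> u = pr (sing k) y \<and> E (pr k z) f)))"

lemma iter_cls: "predicative E \<C> (\<lambda>e. iter (e 0) (e 1))"
  unfolding iter_def by (intro cls_intros Mi.D_class Ni.D_class J_class)

lemmas iter_intros = cls_intros ordinal_cls cls.subst2[of iter, OF iter_cls] Mi.D_class Ni.D_class J_class

lemma iter_cases:
  assumes "iter m x" shows "m = zero \<and> x \<in> N \<or> (\<exists>k. m = sing k \<and> x \<in> M \<and> iter k (j x))"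
proof -
  obtain f where f: "E (pr m x) f" "\<forall>u. E u f \<longrightarrow> (\<exists>y\<in>N. u = pr zero y) \<or>
    (\<exists>k. \<exists>y\<in>M. \<exists>z. pr y z \<in> J \<and> u = pr (sing k) y \<and> E (pr k z) f)"
    using assms unfolding iter_def by blast
  from f(2)[rule_format, OF f(1)] consider "m = zero \<and> x \<in> N" | k where "m = sing k" "x \<in> M" "E (pr k (j x)) f"
    by auto
  then show ?thesis
  proof cases
    case 2
    then have "iter k (j x)" unfolding iter_def using f(2) by blast
    then show ?thesis using 2 by blast
  qed simp
qed

lemma iter_zero: "iter zero x \<longleftrightarrow> x \<in> N"
proof
  show "x \<in> N" if "iter zero x" using iter_cases[OF that] by auto
  show "iter zero x" if "x \<in> N"
    unfolding iter_def using that by (intro exI[of _ "sing (pr zero x)"]) auto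
qed

lemma iter_sing: "iter (sing k) x \<longleftrightarrow> x \<in> M \<and> iter k (j x)"
proof
  show "x \<in> M \<and> iter k (j x)" if "iter (sing k) x" using iter_cases[OF that] by auto
  assume x: "x \<in> M \<and> iter k (j x)"
  then obtain f where f: "E (pr k (j x)) f" "\<forall>u. E u f \<longrightarrow> (\<exists>y\<in>N. u = pr zero y) \<or>
    (\<exists>k. \<exists>y\<in>M. \<exists>z. pr y z \<in> J \<and> u = pr (sing k) y \<and> E (pr k z) f)"
    unfolding iter_def by blast
  have "is_set (insert (pr (sing k) x) (ext E f))" by (intro is_set_insert is_set_ext)
  then obtain g where g: "\<forall>u. E u g \<longleftrightarrow> u = pr (sing k) x \<or> E u f" unfolding is_set_iff by auto
  show "iter (sing k) x"
    unfolding iter_def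
  proof (intro exI[of _ g] conjI allI impI)
    show "E (pr (sing k) x) g" using g by blast
    fix u assume "E u g"
    then consider "u = pr (sing k) x" | "E u f" using g by blast
    then show "(\<exists>y\<in>N. u = pr zero y) \<or> (\<exists>k. \<exists>y\<in>M. \<exists>z. pr y z \<in> J \<and> u = pr (sing k) y \<and> E (pr k z) g)"
    proof cases
      case 1
      then show ?thesis using x f(1) g by (intro disjI2 exI[of _ k] bexI[of _ x] exI[of _ "j x"]) auto
    next
      case 2
      then show ?thesis using f(2) g by blast
    qed
  qed
qed

lemma iter_in: "iter m x \<Longrightarrow> x \<in> N"
  using iter_cases M_N by blast

abbreviation stage :: "'v \<Rightarrow> 'v set" where
  "stage m \<equiv> {x. iter m x}"

lemma stage_class: "stage m \<in> \<C>"
  by (rule comprehension) (intro iter_intros)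

text \<open>As \<open>b\<close> lies in \<open>M\<close> and is fixed by \<open>j\<close>, the
  condition \<open>iter m b\<close> expresses that \<open>m\<close> is a natural number of the
  universe. Foundation provides a minimal counterexample.\<close>

lemma iter_induct:
  assumes "{m. Q m} \<in> \<C>" "Q zero" and step: "\<And>k. iter k b \<Longrightarrow> Q k \<Longrightarrow> Q (sing k)" and "iter m b"
  shows "Q m"
proof (rule ccontr)
  let ?X = "{m. iter m b \<and> m \<notin> {m. Q m}}"
  assume "\<not> Q m"
  then have "m \<in> ?X" using assms by blast
  moreover have "?X \<in> \<C>" by (rule comprehension) (intro iter_intros assms)
  ultimately have "\<exists>m\<in>?X. \<forall>k\<in>?X. \<not> E k m" by (intro foundation)
  then obtain n where n: "n \<in> ?X" "\<forall>k\<in>?X. \<not> E k n" by (elim bexE) (rule that)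
  then have "n \<noteq> zero" using assms(2) by auto
  then obtain k where k: "n = sing k" "iter k b" using iter_cases[of n b] n(1) j_b by auto
  then have "Q k" using n(2) by auto
  then show False using step[OF k(2)] k(1) n(1) by blast
qed

text \<open>
  The stages behave like the iterates of the definition of \<open>M\<close>, and \<open>j\<close> maps each stage to the
  preceding one.
\<close>

definition coherent :: "'v \<Rightarrow> bool" where
  "coherent m \<longleftrightarrow> (\<forall>a\<in>M. \<exists>c\<in>M. ext E c = ext E a \<inter> stage (sing m) \<and> ext E (j c) = ext E (j a) \<inter> stage m)"

definition stage_defined :: "'v \<Rightarrow> bool" where
  "stage_defined m \<longleftrightarrow> (\<forall>x. iter (sing m) x \<longleftrightarrow> iter m x \<and> sat E (stage m) (asg b [x]) \<psi>)"

text \<open>The formula is fixed but the stage is a variable. Statements about satisfaction in all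
  stages therefore define classes and admit induction on the stage.\<close>

lemma sat_stage_cls:
  assumes "cls.definable_term t" "cls.definable_term u"
  shows "predicative E \<C> (\<lambda>e. sat E (stage (t e)) (asg b [u e]) \<phi>)"
proof -
  have t: "cls.definable_term (\<lambda>e. asg b [u e] i)" for i
    by (cases "i = 0") (auto simp: asg_def intro: cls_const assms)
  have "predicative E \<C> (\<lambda>e. sat E (stage (t e)) (\<lambda>i. asg b [u e] i) \<phi>)"
    by (rule cls.sat_definable[OF _ _ t])
      (auto intro!: cls.subst2[of iter, OF iter_cls] cls.var cls.term_ren[OF assms(1)])
  then show ?thesis by simp
qed

text \<open>Collection gives a bound \<open>w\<close> for stage m+1; the point is that
  \<open>j w\<close> is a bound for stage m. A counterexample in stage m lies in some
  \<open>j d\<close> by cofinality. Every tuple refuted within \<open>d\<close> is refuted within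
  \<open>w\<close>, and \<open>j\<close> carries this inclusion between sets of \<open>M\<close>
  over to \<open>j d\<close> and \<open>j w\<close>.\<close>

lemma coherent_op_family:
  assumes "coherent m"
  shows "op_family E \<C> (\<lambda>v v'. v \<in> M \<and> v' = j v) (stage (sing m)) (stage m) b b"
proof
  let ?\<kappa> = "\<lambda>v v'. v \<in> M \<and> v' = j v"
  show "\<exists>Z Z'. ?\<kappa> Z Z' \<and> ext E Z = op_set g (ext E X) (ext E Y) \<and> ext E Z' = op_set g (ext E X') (ext E Y')"
    if "?\<kappa> X X'" "?\<kappa> Y Y'" for X X' Y Y' g
    using repj_op[OF repj_ext repj_ext, of X Y g] that unfolding repj_def by blast
  show "?\<kappa> (sing zero) (sing zero)"
    using Mi.zero_in j_sing[OF Mi.zero_in] by (simp add: j_zero)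
  fix vs vs' \<phi>
  assume vs: "list_all2 ?\<kappa> vs vs'"
    and IH: "\<And>w w'. ?\<kappa> w w' \<Longrightarrow> \<exists>Z Z'. ?\<kappa> Z Z' \<and> ext E Z = sol (stage (sing m)) b \<phi> (w # vs) \<and>
      ext E Z' = sol (stage m) b \<phi> (w' # vs')"
    and env: "\<exists>Z Z'. ?\<kappa> Z Z' \<and> ext E Z = env vs \<and> ext E Z' = env vs'"
  have IH': "repj (sol (stage (sing m)) b \<phi> (w # vs)) (sol (stage m) b \<phi> (j w # vs'))" if "w \<in> M" for w
    using IH[of w "j w"] that unfolding repj_def by blast
  have env': "repj (env vs) (env vs')" using env unfolding repj_def by blast
  obtain a where a: "ext E a = env vs" using env by blast
  let ?U = "stage (sing m)"
  let ?R = "{u. \<exists>d x. u = pr d x \<and> (\<exists>xs. length xs = length vs \<and> d = tup xs \<and> x \<in> ?U \<and> \<not> sat E ?U (asg b (x # xs)) \<phi>)}"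
  obtain \<gamma> where \<gamma>: "ordinal E \<gamma>" "\<forall>e. E e a \<longrightarrow> (\<exists>x\<in>M. pr e x \<in> ?R) \<longrightarrow> (\<exists>x. E x (Mi.VV \<gamma>) \<and> pr e x \<in> ?R)"
    using Mi.collection[OF refuted_class[OF stage_class, of "length vs" "sing m" b \<phi>], of a] by blast
  obtain w where w: "w \<in> M" "ext E w = ext E (Mi.VV \<gamma>) \<inter> ?U" "ext E (j w) = ext E (j (Mi.VV \<gamma>)) \<inter> stage m"
    using assms Mi.VV_in[OF \<gamma>(1)] unfolding coherent_def by blast
  have bw: "bounds ?U b \<phi> w vs"
    unfolding bounds_def
  proof (intro conjI allI impI)
    show "ext E w \<subseteq> ?U" using w(2) by blast
    fix xs assume xs: "list_all2 E xs vs" and "\<exists>x\<in>?U. \<not> sat E ?U (asg b (x # xs)) \<phi>"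
    then obtain x where x: "x \<in> ?U" "\<not> sat E ?U (asg b (x # xs)) \<phi>" by blast
    have len: "length xs = length vs" using xs by (rule list_all2_lengthD)
    have "E (tup xs) a" using tup_in_env[OF len] xs a by (metis in_ext_iff)
    moreover have "pr (tup xs) x \<in> ?R" using x len by auto
    moreover have "x \<in> M" using x(1) iter_sing by blast
    ultimately obtain y where y: "E y (Mi.VV \<gamma>)" "pr (tup xs) y \<in> ?R" using \<gamma>(2) by blast
    then obtain ys where ys: "length ys = length vs" "tup xs = tup ys" "y \<in> ?U" "\<not> sat E ?U (asg b (y # ys)) \<phi>" by auto
    then have "xs = ys" using tup_inject[of xs ys] len by simp
    moreover have "y \<in> ext E w" using w(2) y(1) ys(3) by auto
    ultimately show "\<exists>x. E x w \<and> \<not> sat E ?U (asg b (x # xs)) \<phi>" using ys by auto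
  qed
  have "bounds (stage m) b \<phi> (j w) vs'"
    unfolding bounds_def
  proof (intro conjI allI impI)
    show "ext E (j w) \<subseteq> stage m" using w(3) by blast
    fix xs assume xs: "list_all2 E xs vs'" and "\<exists>x\<in>stage m. \<not> sat E (stage m) (asg b (x # xs)) \<phi>"
    then obtain x where x: "x \<in> stage m" "\<not> sat E (stage m) (asg b (x # xs)) \<phi>" by blast
    have len: "length xs = length vs'" using xs by (rule list_all2_lengthD)
    obtain d' where d': "d' \<in> M" "E x (j d')" using j_cofinal x(1) iter_in by blast
    obtain d where d: "d \<in> M" "ext E d = ext E d' \<inter> ?U" "ext E (j d) = ext E (j d') \<inter> stage m"
      using assms d'(1) unfolding coherent_def by blast
    have xd: "E x (j d)" using d(3) d'(2) x(1) by (metis Int_iff in_ext_iff)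
    \<comment> \<open>The tuples refuted by some element of \<open>w\<close>, written with the set
      operations so that \<open>j\<close> can be applied; \<open>IH'\<close> covers the part that
      involves \<open>\<phi>\<close>.\<close>
    let ?Z = "\<lambda>U w vs. op_set Ran (op_set Prod (ext E w) (env vs) - sol U b \<phi> (w # vs)) {}"
    have Z: "tup xs \<in> ?Z U w vs \<longleftrightarrow> (\<exists>x. E x w \<and> \<not> sat E U (asg b (x # xs)) \<phi>)" if "list_all2 E xs vs" for U w vs xs
    proof -
      have len: "length xs = length vs" using that by (rule list_all2_lengthD)
      have "tup xs \<in> ?Z U w vs \<longleftrightarrow> (\<exists>x. E x w \<and> tup (x # xs) \<notin> sol U b \<phi> (w # vs))"
        using tup_in_env[OF len] that by auto
      also have "\<dots> \<longleftrightarrow> (\<exists>x. E x w \<and> \<not> sat E U (asg b (x # xs)) \<phi>)"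
        using that len by (subst tup_in_sol) auto
      finally show ?thesis .
    qed
    have "?Z ?U d vs \<subseteq> ?Z ?U w vs"
    proof
      fix u assume u: "u \<in> ?Z ?U d vs"
      then obtain ys where ys: "u = tup ys" "list_all2 E ys vs" unfolding env_def by auto
      then obtain y where "E y d" "\<not> sat E ?U (asg b (y # ys)) \<phi>" using Z[OF ys(2)] u by blast
      moreover from this have "y \<in> ?U" using d(2) by (metis Int_iff in_ext_iff)
      ultimately have "\<exists>x. E x w \<and> \<not> sat E ?U (asg b (x # ys)) \<phi>"
        using bw ys(2) unfolding bounds_def by blast
      then show "u \<in> ?Z ?U w vs" using Z[OF ys(2)] ys(1) by blast
    qed
    moreover have empty: "repj {} {}" using repj_diff[OF repj_ext[OF w(1)] repj_ext[OF w(1)]] by simp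
    have "repj (?Z ?U v vs) (?Z (stage m) (j v) vs')" if "v \<in> M" for v
      by (intro repj_op repj_diff repj_ext IH' env' empty that)
    ultimately have "?Z (stage m) (j d) vs' \<subseteq> ?Z (stage m) (j w) vs'"
      using repj_subset d(1) w(1) by blast
    moreover have "tup xs \<in> ?Z (stage m) (j d) vs'" using Z[OF xs] xd x(2) by blast
    ultimately show "\<exists>x. E x (j w) \<and> \<not> sat E (stage m) (asg b (x # xs)) \<phi>" using Z[OF xs] by blast
  qed
  then show "\<exists>w w'. ?\<kappa> w w' \<and> bounds ?U b \<phi> w vs \<and> bounds (stage m) b \<phi> w' vs'"
    using bw w(1) by blast
qed

lemma coherent_sol:
  assumes "coherent m" "set vs \<subseteq> M" "fv_below \<phi> (length vs)"
  shows "repj (sol (stage (sing m)) b \<phi> vs) (sol (stage m) b \<phi> (map j vs))"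
proof -
  interpret op_family E \<C> "\<lambda>v v'. v \<in> M \<and> v' = j v" "stage (sing m)" "stage m" b b
    by (rule coherent_op_family[OF assms(1)])
  have "list_all2 (\<lambda>v v'. v \<in> M \<and> v' = j v) vs (map j vs)"
    using assms(2) by (auto simp: list_all2_map2 intro!: list.rel_refl_strong)
  from rep_sol[OF this assms(3)] show ?thesis unfolding rep_def repj_def by blast
qed

lemma map_j_sing: "set xs \<subseteq> M \<Longrightarrow> map j (map sing xs) = map sing (map j xs)"
  using j_sing by auto

lemma sol_sing: "sol U b \<phi> (map sing xs) = (if sat E U (asg b xs) \<phi> then {tup xs} else {})"
  unfolding sol_def by (auto simp: Ni.list_all2_sing)

lemma sol_Cons_sing: "sol U b \<phi> (v # map sing xs) = {pr x (tup xs) |x. E x v \<and> sat E U (asg b (x # xs)) \<phi>}"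
proof -
  have *: "list_all2 E ys (v # map sing xs) \<longleftrightarrow> (\<exists>x. ys = x # xs \<and> E x v)" for ys
    by (auto simp: list_all2_Cons2 Ni.list_all2_sing)
  have "u \<in> sol U b \<phi> (v # map sing xs) \<longleftrightarrow> (\<exists>x. u = tup (x # xs) \<and> E x v \<and> sat E U (asg b (x # xs)) \<phi>)" for u
    unfolding sol_def mem_Collect_eq * by blast
  then show ?thesis by auto
qed

text \<open>Truth at \<open>xs\<close> is nonemptiness of a solution set over a product of
  singletons, and \<open>j\<close> preserves emptiness. Padding with \<open>b\<close>, which
  \<open>j\<close> fixes, makes the tuple long enough for the formula.\<close>

lemma stage_elementary:
  assumes "coherent m" "set xs \<subseteq> M"
  shows "sat E (stage (sing m)) (asg b xs) \<phi> \<longleftrightarrow> sat E (stage m) (asg b (map j xs)) \<phi>"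
proof -
  obtain n where n: "fv_below \<phi> n" using fv_below_exists by blast
  let ?ys = "xs @ replicate n b"
  have ys: "set ?ys \<subseteq> M" using assms(2) b_M by auto
  have map_ys: "map j ?ys = map j xs @ replicate n b" by (simp add: j_b)
  have "repj (sol (stage (sing m)) b \<phi> (map sing ?ys)) (sol (stage m) b \<phi> (map j (map sing ?ys)))"
    by (rule coherent_sol[OF assms(1)]) (use ys fv_below_mono[OF n] in auto)
  then have "repj (sol (stage (sing m)) b \<phi> (map sing ?ys)) (sol (stage m) b \<phi> (map sing (map j ?ys)))"
    unfolding map_j_sing[OF ys] .
  then have "sol (stage (sing m)) b \<phi> (map sing ?ys) = {} \<longleftrightarrow> sol (stage m) b \<phi> (map sing (map j ?ys)) = {}"
    unfolding repj_def using j_empty by blast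
  then show ?thesis unfolding sol_sing map_ys asg_pad by (simp split: if_splits)
qed

text \<open>Extends \<open>coherent\<close> from the next stage to whatever a formula cuts out of a
  stage. It is applied to the formula for \<open>M\<close> and to formulas that define an
  ordinal.\<close>

lemma stage_separation:
  assumes "coherent m" "a \<in> M"
  shows "\<exists>c\<in>M. ext E c = {x \<in> ext E a. iter (sing m) x \<and> sat E (stage (sing m)) (asg b [x]) \<phi>} \<and>
    ext E (j c) = {x \<in> ext E (j a). iter m x \<and> sat E (stage m) (asg b [x]) \<phi>}"
proof -
  obtain n where n: "fv_below \<phi> n" using fv_below_exists by blast
  obtain a' where a': "a' \<in> M" "ext E a' = ext E a \<inter> stage (sing m)" "ext E (j a') = ext E (j a) \<inter> stage m"
    using assms unfolding coherent_def by blast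
  let ?bs = "replicate n b"
  let ?vs = "a' # map sing ?bs"
  have bs: "set ?bs \<subseteq> M" using b_M by auto
  have "repj (sol (stage (sing m)) b \<phi> ?vs) (sol (stage m) b \<phi> (map j ?vs))"
    by (rule coherent_sol[OF assms(1)]) (use a' bs fv_below_mono[OF n] in auto)
  moreover have "map j ?vs = j a' # map sing ?bs"
    using map_j_sing[OF bs] by (simp add: j_b)
  ultimately have "repj (sol (stage (sing m)) b \<phi> ?vs) (sol (stage m) b \<phi> (j a' # map sing ?bs))" by (simp only:)
  from repj_op[OF this this, of Dom]
  obtain c where c: "c \<in> M" "ext E c = op_set Dom (sol (stage (sing m)) b \<phi> ?vs) {}"
    "ext E (j c) = op_set Dom (sol (stage m) b \<phi> (j a' # map sing ?bs)) {}"
    unfolding repj_def by auto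
  have "op_set Dom (sol U b \<phi> (v # map sing ?bs)) {} = {x \<in> ext E v. sat E U (asg b [x]) \<phi>}" for U v
  proof -
    have "sol U b \<phi> (v # map sing ?bs) = {pr x (tup ?bs) |x. E x v \<and> sat E U (asg b [x]) \<phi>}"
      unfolding sol_Cons_sing using asg_pad[of b "[_]" n] by simp
    then show ?thesis by auto
  qed
  then show ?thesis using c a' by (intro bexI[of _ c]) auto
qed

lemma stage_defined_step:
  assumes "coherent m" "stage_defined m" shows "stage_defined (sing m)"
  unfolding stage_defined_def
proof
  fix x
  have "iter (sing (sing m)) x \<longleftrightarrow> x \<in> M \<and> iter (sing m) (j x)" by (rule iter_sing)
  also have "\<dots> \<longleftrightarrow> x \<in> M \<and> iter m (j x) \<and> sat E (stage m) (asg b [j x]) \<psi>"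
    using assms(2) unfolding stage_defined_def by blast
  also have "\<dots> \<longleftrightarrow> iter (sing m) x \<and> sat E (stage (sing m)) (asg b [x]) \<psi>"
    using stage_elementary[OF assms(1), of "[x]" \<psi>] by (auto simp: iter_sing)
  finally show "iter (sing (sing m)) x \<longleftrightarrow> iter (sing m) x \<and> sat E (stage (sing m)) (asg b [x]) \<psi>" .
qed

text \<open>Stage m+2 is cut out of stage m+1 by the same formula that cuts stage m+1 out of stage
  m.\<close>

lemma coherent_step:
  assumes "coherent m" "stage_defined m" shows "coherent (sing m)"
  unfolding coherent_def
proof
  fix a assume a: "a \<in> M"
  obtain c where c: "c \<in> M" "ext E c = {x \<in> ext E a. iter (sing m) x \<and> sat E (stage (sing m)) (asg b [x]) \<psi>}"
    "ext E (j c) = {x \<in> ext E (j a). iter m x \<and> sat E (stage m) (asg b [x]) \<psi>}"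
    using stage_separation[OF assms(1) a] by blast
  have "iter (sing m) x \<and> sat E (stage (sing m)) (asg b [x]) \<psi> \<longleftrightarrow> iter (sing (sing m)) x" for x
    using stage_defined_step[OF assms] unfolding stage_defined_def by blast
  moreover have "iter m x \<and> sat E (stage m) (asg b [x]) \<psi> \<longleftrightarrow> iter (sing m) x" for x
    using assms(2) unfolding stage_defined_def by blast
  ultimately show "\<exists>c\<in>M. ext E c = ext E a \<inter> stage (sing (sing m)) \<and> ext E (j c) = ext E (j a) \<inter> stage (sing m)"
    using c by (intro bexI[of _ c]) auto
qed

lemma stage_zero: "stage zero = N"
  using iter_zero by blast

lemma stage_one: "stage (sing zero) = M"
  using iter_sing iter_zero j_in by blast

lemma coherent_zero: "coherent zero"
  unfolding coherent_def stage_zero stage_one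
proof
  fix a assume a: "a \<in> M"
  show "\<exists>c\<in>M. ext E c = ext E a \<inter> M \<and> ext E (j c) = ext E (j a) \<inter> N"
    using a Mi.D_mem[OF a] Ni.D_mem[OF j_in[OF a]] by (intro bexI[of _ a]) auto
qed

lemma stage_defined_zero: "stage_defined zero"
proof -
  have "iter (sing zero) x \<longleftrightarrow> x \<in> M" "iter zero x \<longleftrightarrow> x \<in> N" for x using stage_one stage_zero by blast+
  moreover have "x \<in> M \<longleftrightarrow> x \<in> N \<and> sat E N (asg b [x]) \<psi>" for x using M_def unfolding definable_class_def by blast
  ultimately show ?thesis unfolding stage_defined_def stage_zero by blast
qed

lemma stages: assumes "iter m b" shows "coherent m \<and> stage_defined m"
proof (rule iter_induct[OF _ _ _ assms])
  \<comment> \<open>\<open>coherent\<close> restated elementwise and with \<open>J\<close> in place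
    of \<open>j\<close>, so that it is visibly predicative.\<close>
  have coh: "coherent m \<longleftrightarrow> (\<forall>a\<in>M. \<exists>c\<in>M. \<exists>a' c'. pr a a' \<in> J \<and> pr c c' \<in> J \<and>
      (\<forall>u. E u c \<longleftrightarrow> E u a \<and> iter (sing m) u) \<and> (\<forall>u. E u c' \<longleftrightarrow> E u a' \<and> iter m u))" for m
    unfolding coherent_def set_eq_iff by auto
  show "{m. coherent m \<and> stage_defined m} \<in> \<C>"
    unfolding coh stage_defined_def by (rule comprehension) (intro iter_intros sat_stage_cls)
qed (use coherent_zero stage_defined_zero coherent_step stage_defined_step in blast)+

text \<open>Stages 0 and 1 are \<open>N\<close> and \<open>M\<close>, so the base case of the
  iteration is Gaifman's theorem: the cofinal map preserving bounded formulas is fully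
  elementary.\<close>

lemma elementary:
  assumes "set xs \<subseteq> M" shows "sat E M (asg b xs) \<phi> \<longleftrightarrow> sat E N (asg b (map j xs)) \<phi>"
  using stage_elementary[OF coherent_zero assms] unfolding stage_zero stage_one .

section \<open>Definable ordinals are fixed\<close>

text \<open>Applied to a least counterexample, \<open>j\<close> would produce a smaller one.\<close>

lemma j_ordinal_ge: assumes "ordinal E \<xi>" shows "\<not> E (j \<xi>) \<xi>"
proof
  assume "E (j \<xi>) \<xi>"
  moreover have "{\<xi>. \<exists>z. pr \<xi> z \<in> J \<and> E z \<xi>} \<in> \<C>" by (rule comprehension) (intro iter_intros)
  ultimately have "\<exists>\<xi>. ordinal E \<xi> \<and> (\<exists>z. pr \<xi> z \<in> J \<and> E z \<xi>) \<and> (\<forall>\<delta>. E \<delta> \<xi> \<longrightarrow> \<not> (\<exists>z. pr \<delta> z \<in> J \<and> E z \<delta>))"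
    using assms Mi.ordinal_in by (intro ordinal_least) auto
  then obtain \<zeta> where z: "ordinal E \<zeta>" "E (j \<zeta>) \<zeta>" "\<forall>\<delta>. E \<delta> \<zeta> \<longrightarrow> \<not> (\<exists>z. pr \<delta> z \<in> J \<and> E z \<delta>)"
    by auto
  have "\<zeta> \<in> M" "j \<zeta> \<in> M" using z Mi.ordinal_in ordinal_mem by blast+
  then have "E (j (j \<zeta>)) (j \<zeta>)" using z(2) j_mem by blast
  then show False using z(2,3) \<open>j \<zeta> \<in> M\<close> by auto
qed

lemma definable_ordinal_fixed:
  assumes \<delta>: "ordinal E \<delta>" and \<theta>: "\<And>x. x \<in> N \<Longrightarrow> sat E N (asg b [x]) \<theta> \<longleftrightarrow> x = \<delta>"
  shows "j \<delta> = \<delta>"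
proof (rule ccontr)
  assume ne: "j \<delta> \<noteq> \<delta>"
  define T where "T m x \<longleftrightarrow> ordinal E x \<and> iter m x \<and> (\<forall>y. iter m y \<longrightarrow> (sat E (stage m) (asg b [y]) \<theta> \<longleftrightarrow> y = x))" for m x
  have T_cls: "predicative E \<C> (\<lambda>e. T (e 0) (e 1))"
    unfolding T_def by (intro iter_intros sat_stage_cls)
  have step: "\<exists>x'. T (sing m) x' \<and> j x' = x" if m: "iter m b" and x: "T m x" for m x
  proof -
    have coh: "coherent m" using stages[OF m] by blast
    have "iter m x" using x unfolding T_def by blast
    \<comment> \<open>Cofinality and separation yield a set \<open>c\<close> of \<open>M\<close>
      that collects the solutions of \<open>\<theta>\<close> in \<open>a\<close> within stage m+1
      and whose image contains \<open>x\<close>. So \<open>c\<close> is nonempty and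
      \<open>\<theta>\<close> has a solution in stage m+1.\<close>
    then obtain a where a: "a \<in> M" "E x (j a)" using j_cofinal iter_in by blast
    obtain c where c: "c \<in> M" "ext E c = {x \<in> ext E a. iter (sing m) x \<and> sat E (stage (sing m)) (asg b [x]) \<theta>}"
      "ext E (j c) = {x \<in> ext E (j a). iter m x \<and> sat E (stage m) (asg b [x]) \<theta>}"
      using stage_separation[OF coh a(1)] by blast
    have "x \<in> ext E (j c)" unfolding c(3) using a(2) x unfolding T_def by auto
    then have "ext E c \<noteq> {}" using j_empty[OF c(1)] by blast
    then obtain x' where x': "x' \<in> ext E c" by blast
    then have x'': "iter (sing m) x'" "sat E (stage (sing m)) (asg b [x']) \<theta>" unfolding c(2) by auto
    have eq: "j y = x" if y: "iter (sing m) y" "sat E (stage (sing m)) (asg b [y]) \<theta>" for y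
    proof -
      have "y \<in> M" "iter m (j y)" using y(1) iter_sing by blast+
      then have "sat E (stage m) (asg b [j y]) \<theta>" using stage_elementary[OF coh, of "[y]" \<theta>] y(2) by simp
      then show ?thesis using x \<open>iter m (j y)\<close> unfolding T_def by blast
    qed
    have x'M: "x' \<in> M" using x''(1) unfolding iter_sing by simp
    have "y = x'" if y: "iter (sing m) y" "sat E (stage (sing m)) (asg b [y]) \<theta>" for y
    proof -
      have "y \<in> M" using y(1) unfolding iter_sing by simp
      then show ?thesis using eq[OF y] eq[OF x''] j_inject[OF _ x'M, of y] by simp
    qed
    moreover have "ordinal E x'" using j_ordinal[OF x'M] eq[OF x''] x unfolding T_def by simp
    ultimately have "T (sing m) x'" unfolding T_def using x'' by blast
    then show ?thesis using eq[OF x''] by blast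
  qed
  \<comment> \<open>In place of the decreasing sequence, its least member moved by \<open>j\<close>
    is considered: the next member is smaller, hence fixed, yet \<open>j\<close> maps it to the one
    considered.\<close>
  let ?B = "\<lambda>x. (\<exists>m. iter m b \<and> T m x) \<and> (\<exists>z. pr x z \<in> J \<and> z \<noteq> x)"
  have "{x. ?B x} \<in> \<C>"
    by (rule comprehension) (intro iter_intros cls.subst2[of T, OF T_cls])
  moreover have "?B \<delta>"
  proof -
    have "T zero \<delta>" unfolding T_def stage_zero iter_zero using \<delta> \<theta> Ni.ordinal_in by blast
    moreover have "iter zero b" using iter_zero b_M M_N by blast
    ultimately show ?thesis using ne Mi.ordinal_in[OF \<delta>] by auto
  qed
  ultimately have "\<exists>x. ordinal E x \<and> ?B x \<and> (\<forall>y. E y x \<longrightarrow> \<not> ?B y)" using \<delta> by (intro ordinal_least)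
  then obtain x m where x: "ordinal E x" "iter m b" "T m x" "j x \<noteq> x" "\<forall>y. E y x \<longrightarrow> \<not> ?B y" by auto
  obtain x' where x': "T (sing m) x'" "j x' = x" using step[OF x(2,3)] by blast
  have o: "ordinal E x'" using x'(1) unfolding T_def by blast
  have "x' \<noteq> x" using x'(2) x(4) by blast
  then have "E x' x" using ordinal_linear[OF o x(1)] j_ordinal_ge[OF o] x'(2) by blast
  then have "\<not> ?B x'" using x(5) by blast
  moreover have "iter (sing m) b" using x(2) b_M j_b iter_sing by simp
  ultimately have "j x' = x'" using x'(1) Mi.ordinal_in[OF o] by auto
  then show False using x'(2) \<open>x' \<noteq> x\<close> by simp
qed

text \<open>The source of all fixed names below. Since the parameter is a variable of
  \<open>R\<close>, the least solution is defined in \<open>N\<close> from \<open>b\<close>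
  alone.\<close>

lemma least_fixed:
  assumes R: "fo_definable E N (\<lambda>e. R (e 0) (e 1))" and "ordinal E \<gamma>" "R \<gamma> b"
  shows "\<exists>\<gamma>. ordinal E \<gamma> \<and> R \<gamma> b \<and> (\<forall>\<delta>. E \<delta> \<gamma> \<longrightarrow> \<not> R \<delta> b) \<and> j \<gamma> = \<gamma>"
proof -
  have "{x \<in> N. R x b} \<in> \<C>"
    by (rule Ni.definable_class_in) (intro Ni.par.subst2[of R, OF fo_definable_parI, OF R] Ni.par_intros Ni.b_in)
  then have "{x. x \<in> N \<and> R x b} \<in> \<C>" by simp
  then have "\<exists>\<gamma>. ordinal E \<gamma> \<and> (\<gamma> \<in> N \<and> R \<gamma> b) \<and> (\<forall>\<delta>. E \<delta> \<gamma> \<longrightarrow> \<not> (\<delta> \<in> N \<and> R \<delta> b))"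
    by (rule ordinal_least) (use assms Ni.ordinal_in in auto)
  then obtain \<delta> where \<delta>: "ordinal E \<delta>" "R \<delta> b" "\<delta> \<in> N" "\<forall>\<xi>. E \<xi> \<delta> \<longrightarrow> \<not> (\<xi> \<in> N \<and> R \<xi> b)" by auto
  let ?Q = "\<lambda>x c. ordinal E x \<and> R x c \<and> (\<forall>y\<in>N. E y x \<longrightarrow> \<not> R y c)"
  have "fo_definable E N (\<lambda>e. ?Q (e 0) (e 1))"
    by (intro Ni.fo_intros Ni.fo.subst2[of R, OF R])
  then obtain \<theta> where \<theta>: "\<forall>e. range e \<subseteq> N \<longrightarrow> (sat E N e \<theta> \<longleftrightarrow> ?Q (e 0) (e 1))"
    unfolding fo_definable_def by (elim exE)
  have "sat E N (asg b [x]) \<theta> \<longleftrightarrow> x = \<delta>" if x: "x \<in> N" for x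
  proof -
    have "sat E N (asg b [x]) \<theta> \<longleftrightarrow> ?Q x b"
      using \<theta>[rule_format, OF Ni.range_asg[of "[x]"]] x by (simp add: asg_def)
    also have "\<dots> \<longleftrightarrow> x = \<delta>"
    proof
      assume Q: "?Q x b"
      have "\<not> E x \<delta>" using \<delta>(4) Q x by blast
      moreover have "\<not> E \<delta> x" using Q \<delta>(2,3) by blast
      ultimately show "x = \<delta>" using ordinal_linear[of x \<delta>] Q \<delta>(1) by blast
    qed (use \<delta> in blast)
    finally show ?thesis .
  qed
  then have "j \<delta> = \<delta>" by (rule definable_ordinal_fixed[OF \<delta>(1)])
  moreover have "\<not> R \<xi> b" if "E \<xi> \<delta>" for \<xi> using \<delta>(4) that Ni.D_mem[OF \<delta>(3) that] by blast
  ultimately show ?thesis using \<delta>(1,2) by blast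
qed

end

section \<open>Agreement on hereditarily ordinal definable classes\<close>

context embedding
begin

text \<open>Makes \<open>M\<close> available in formulas over \<open>N\<close> with \<open>b\<close>
  as a variable, as \<open>least_fixed\<close> demands.\<close>

definition in_M :: "'v \<Rightarrow> 'v \<Rightarrow> bool" where
  "in_M c x \<longleftrightarrow> x \<in> N \<and> sat E N (asg c [x]) \<psi>"

lemma in_M: "in_M b x \<longleftrightarrow> x \<in> M"
  unfolding in_M_def using M_def unfolding definable_class_def by blast

lemma in_M_fo: "fo_definable E N (\<lambda>e. in_M (e 0) (e 1))"
  unfolding in_M_def by (intro Ni.fo_intros Ni.fo.in_dom Ni.sat1_fo)

lemmas in_M_intro = Ni.fo.subst2[of in_M, OF in_M_fo]

text \<open>One formula is fixed so that the enumeration of \<open>M\<close> can be its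
  interpretation in \<open>M\<close>; elementarity of \<open>j\<close> then compares it directly
  with the enumeration of \<open>N\<close>.\<close>

definition enum_fm :: fm where
  "enum_fm = (SOME \<phi>. \<forall>e. range e \<subseteq> N \<longrightarrow> (sat E N e \<phi> \<longleftrightarrow> Ni.enum (e 2) (e 0) (e 1)))"

lemma enum_fm: assumes "\<gamma> \<in> N" "x \<in> N" shows "sat E N (asg b [\<gamma>, x]) enum_fm \<longleftrightarrow> Ni.enum b \<gamma> x"
proof -
  have "fo_definable E N (\<lambda>e. Ni.enum (e 2) (e 0) (e 1))"
    by (intro Ni.fo.subst3[of Ni.enum, OF Ni.enum_fo] Ni.fo.var)
  then have "\<forall>e. range e \<subseteq> N \<longrightarrow> (sat E N e enum_fm \<longleftrightarrow> Ni.enum (e 2) (e 0) (e 1))"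
    unfolding enum_fm_def fo_definable_def by (rule someI_ex)
  then show ?thesis using Ni.range_asg[of "[\<gamma>, x]"] assms by (simp add: asg_def)
qed

text \<open>The enumeration of \<open>M\<close>, with the parameter \<open>b\<close> and hence \<open>M\<close> itself as a variable.\<close>

definition enum_M :: "'v \<Rightarrow> 'v \<Rightarrow> 'v \<Rightarrow> bool" where
  "enum_M c \<gamma> x \<longleftrightarrow> in_M c \<gamma> \<and> in_M c x \<and> sat E {y. in_M c y} (asg c [\<gamma>, x]) enum_fm"

definition class_M :: "fm \<Rightarrow> 'v \<Rightarrow> 'v \<Rightarrow> bool" where
  "class_M \<phi> c x \<longleftrightarrow> in_M c x \<and> sat E {y. in_M c y} (asg c [x]) \<phi>"

lemma sat_in_M_fo:
  assumes "\<And>i. Ni.fo.definable_term (t i)" "Ni.fo.definable_term u"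
  shows "fo_definable E N (\<lambda>e. sat E {y. in_M (u e) y} (\<lambda>i. t i e) \<phi>)"
proof (rule Ni.fo.sat_definable[of "\<lambda>y e. in_M (u e) y", OF _ _ assms(1)])
  show "fo_definable E N (\<lambda>e. in_M (u (\<lambda>i. e (Suc i))) (e 0))"
    by (intro in_M_intro Ni.fo.var Ni.fo.term_ren[OF assms(2)])
qed (simp add: in_M_def)

lemma enum_M_fo: "fo_definable E N (\<lambda>e. enum_M (e 0) (e 1) (e 2))"
proof -
  have "fo_definable E N (\<lambda>e. sat E {y. in_M (e 0) y} (\<lambda>i. asg (e 0) [e 1, e 2] i) enum_fm)"
    by (intro sat_in_M_fo Ni.asg_term2 Ni.fo.var)
  then show ?thesis unfolding enum_M_def by (intro Ni.fo.conj in_M_intro Ni.fo.var) simp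
qed

lemma class_M_fo: "fo_definable E N (\<lambda>e. class_M \<phi> (e 0) (e 1))"
proof -
  have "fo_definable E N (\<lambda>e. sat E {y. in_M (e 0) y} (\<lambda>i. asg (e 0) [e 1] i) \<phi>)"
    by (intro sat_in_M_fo Ni.asg_term1 Ni.fo.var)
  then show ?thesis unfolding class_M_def by (intro Ni.fo.conj in_M_intro Ni.fo.var) simp
qed

lemma class_M: "class_M \<phi> b x \<longleftrightarrow> x \<in> M \<and> sat E M (asg b [x]) \<phi>"
  unfolding class_M_def in_M by simp

lemma enum_M: "enum_M b \<gamma> x \<longleftrightarrow> \<gamma> \<in> M \<and> x \<in> M \<and> sat E M (asg b [\<gamma>, x]) enum_fm"
  unfolding enum_M_def in_M by simp

lemma enum_M_j: assumes "\<gamma> \<in> M" "x \<in> M" shows "enum_M b \<gamma> x \<longleftrightarrow> Ni.enum b (j \<gamma>) (j x)"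
  unfolding enum_M using elementary[of "[\<gamma>, x]" enum_fm] enum_fm[OF j_in[OF assms(1)] j_in[OF assms(2)]] assms
  by simp

lemma enum_M_in: "enum_M b \<gamma> x \<Longrightarrow> \<gamma> \<in> M \<and> x \<in> M"
  by (simp add: enum_M)

lemma enum_M_ordinal: assumes "enum_M b \<gamma> x" shows "ordinal E \<gamma>"
proof -
  have "\<gamma> \<in> M" "x \<in> M" using enum_M_in[OF assms] by auto
  then show ?thesis using enum_M_j assms Ni.enum_ordinal j_ordinal by blast
qed

lemma enum_M_unique: assumes "enum_M b \<gamma> x" "enum_M b \<gamma> y" shows "x = y"
proof -
  have M: "\<gamma> \<in> M" "x \<in> M" "y \<in> M" using enum_M_in assms by blast+
  then have "j x = j y" using enum_M_j assms Ni.enum_unique by blast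
  then show ?thesis using j_inject M by blast
qed

lemma enum_M_fixed: assumes "enum_M b \<gamma> x" "j \<gamma> = \<gamma>" shows "Ni.enum b \<gamma> (j x)"
  using enum_M_j[of \<gamma> x] enum_M_in[OF assms(1)] assms by simp

text \<open>Elementarity for the formula stating that a name exists; the name obtained in
  \<open>M\<close> may differ from the given one.\<close>

lemma enum_M_name: assumes "x \<in> M" "Ni.enum b \<gamma> (j x)" shows "\<exists>\<gamma>. enum_M b \<gamma> x"
proof -
  let ?\<phi> = "Neg (Forall (Neg enum_fm))"
  have "\<gamma> \<in> N" using Ni.enum_ordinal[OF assms(2)] Ni.ordinal_in by blast
  then have "sat E N (asg b [j x]) ?\<phi>" using enum_fm[of \<gamma> "j x"] assms j_in by (auto simp: asg_Cons)
  then have "sat E M (asg b [x]) ?\<phi>" using elementary[of "[x]" ?\<phi>] assms(1) by simp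
  then show ?thesis unfolding enum_M using assms(1) by (auto simp: asg_Cons)
qed

lemma enum_M_value: assumes "\<gamma> \<in> M" "Ni.enum b (j \<gamma>) y" shows "\<exists>x. enum_M b \<gamma> x"
proof -
  \<comment> \<open>\<open>Forall\<close> binds variable 0, which in \<open>enum_fm\<close> is the
    name; the swap puts the value there.\<close>
  let ?f = "\<lambda>i. if i = 0 then 1 else if i = 1 then 0 else i"
  let ?\<phi> = "Neg (Forall (Neg (rename ?f enum_fm)))"
  have swap: "sat E D (asg b [u, v]) (rename ?f enum_fm) \<longleftrightarrow> sat E D (asg b [v, u]) enum_fm" for D u v
  proof -
    have "(\<lambda>i. asg b [u, v] (?f i)) = asg b [v, u]" by (rule HOL.ext) (simp add: asg_def)
    then show ?thesis unfolding sat_rename by simp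
  qed
  have "sat E N (asg b [j \<gamma>]) ?\<phi>"
    using enum_fm[of "j \<gamma>" y] assms j_in Ni.enum_in[OF assms(2)] by (auto simp: asg_Cons swap)
  then have "sat E M (asg b [\<gamma>]) ?\<phi>" using elementary[of "[\<gamma>]" ?\<phi>] assms(1) by simp
  then show ?thesis unfolding enum_M using assms(1) by (auto simp: asg_Cons swap)
qed

lemma HK_name: assumes "Ni.HK b x" "x \<in> N" obtains \<gamma> where "Ni.enum b \<gamma> x" "ordinal E \<gamma>"
  using Ni.HK_K[OF assms] Ni.enum_ordinal unfolding Ni.K_def by blast

definition bad :: "'v \<Rightarrow> 'v \<Rightarrow> bool" where
  "bad c \<zeta> \<longleftrightarrow> (\<exists>x\<in>N. Ni.enum c \<zeta> x \<and> Ni.HK c x \<and> \<not> enum_M c \<zeta> x)"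

text \<open>Minimality concerns membership between values and not the order of names, because an
  element of a set may have only larger names than the set. It guarantees that elements of the value
  at \<open>\<zeta>\<close> keep their names from \<open>N\<close> in \<open>M\<close>.\<close>

definition bad_min :: "'v \<Rightarrow> 'v \<Rightarrow> bool" where
  "bad_min c \<zeta> \<longleftrightarrow> bad c \<zeta> \<and> (\<forall>x\<in>N. Ni.enum c \<zeta> x \<longrightarrow>
    (\<forall>z\<in>N. E z x \<longrightarrow> (\<forall>\<eta>\<in>N. Ni.enum c \<eta> z \<longrightarrow> \<not> bad c \<eta>)))"

definition first_bad :: "'v \<Rightarrow> 'v \<Rightarrow> bool" where
  "first_bad c \<zeta> \<longleftrightarrow> ordinal E \<zeta> \<and> bad_min c \<zeta> \<and> (\<forall>\<eta>\<in>N. E \<eta> \<zeta> \<longrightarrow> \<not> bad_min c \<eta>)"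

lemmas base_fo_intros = Ni.fo_intros Ni.fo.subst3[of Ni.enum, OF Ni.enum_fo] Ni.fo.subst2[of Ni.HK, OF Ni.HK_fo]
  Ni.fo.subst3[of enum_M, OF enum_M_fo]

lemma bad_fo: "fo_definable E N (\<lambda>e. bad (e 0) (e 1))"
  unfolding bad_def by (intro base_fo_intros)

lemma bad_min_fo: "fo_definable E N (\<lambda>e. bad_min (e 0) (e 1))"
  unfolding bad_min_def by (intro base_fo_intros Ni.fo.subst2[of bad, OF bad_fo])

lemma first_bad_fo: "fo_definable E N (\<lambda>e. first_bad (e 0) (e 1))"
  unfolding first_bad_def by (intro base_fo_intros Ni.fo.subst2[of bad_min, OF bad_min_fo])

lemma bad_min_exists: assumes "bad b \<zeta>" shows "\<exists>\<zeta>. ordinal E \<zeta> \<and> bad_min b \<zeta>"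
proof -
  let ?X = "{x \<in> N. \<exists>\<zeta>\<in>N. Ni.enum b \<zeta> x \<and> bad b \<zeta>}"
  have "?X \<in> \<C>"
    by (rule Ni.definable_class_in)
      (intro Ni.par_intros Ni.par.subst3[of Ni.enum, OF fo_definable_parI, OF Ni.enum_fo]
        Ni.par.subst2[of bad, OF fo_definable_parI, OF bad_fo] Ni.b_in)
  moreover obtain x where "x \<in> N" "Ni.enum b \<zeta> x" using assms unfolding bad_def by blast
  then have "x \<in> ?X" using assms Ni.enum_ordinal Ni.ordinal_in by blast
  ultimately have "\<exists>m\<in>?X. \<forall>k\<in>?X. \<not> E k m" by (rule foundation)
  then obtain m where m: "m \<in> ?X" "\<forall>k\<in>?X. \<not> E k m" by (elim bexE) (rule that)
  then obtain \<eta> where \<eta>: "Ni.enum b \<eta> m" "bad b \<eta>" by blast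
  have "bad_min b \<eta>"
    unfolding bad_min_def
  proof (intro conjI ballI impI)
    fix y z \<xi> assume y: "y \<in> N" "Ni.enum b \<eta> y" and z: "z \<in> N" "E z y" and \<xi>: "\<xi> \<in> N" "Ni.enum b \<xi> z"
    have "y = m" using Ni.enum_unique[OF y(2) \<eta>(1)] .
    then show "\<not> bad b \<xi>" using m(2) z \<xi> by blast
  qed (rule \<eta>(2))
  then show ?thesis using Ni.enum_ordinal[OF \<eta>(1)] by blast
qed

lemma not_bad: "\<not> bad b \<zeta>"
proof
  assume "bad b \<zeta>"
  then obtain \<zeta> where \<zeta>: "ordinal E \<zeta>" "bad_min b \<zeta>" using bad_min_exists by blast
  have "fo_definable E N (\<lambda>e. bad_min (e 1) (e 0))"
    by (intro Ni.fo.subst2[of bad_min, OF bad_min_fo] Ni.fo.var)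
  from least_fixed[of "\<lambda>\<zeta> c. bad_min c \<zeta>", OF this \<zeta>]
  have "\<exists>\<gamma>. ordinal E \<gamma> \<and> bad_min b \<gamma> \<and> (\<forall>\<delta>. E \<delta> \<gamma> \<longrightarrow> \<not> bad_min b \<delta>) \<and> j \<gamma> = \<gamma>" .
  then obtain \<zeta> where \<zeta>: "ordinal E \<zeta>" "bad_min b \<zeta>" "\<forall>\<delta>. E \<delta> \<zeta> \<longrightarrow> \<not> bad_min b \<delta>" "j \<zeta> = \<zeta>"
    by (elim exE conjE) (rule that)
  have fb: "first_bad b \<zeta>" unfolding first_bad_def using \<zeta> by blast
  have fb_unique: "\<xi> = \<zeta>" if \<xi>: "first_bad b \<xi>" for \<xi>
  proof -
    have \<xi>': "ordinal E \<xi>" "bad_min b \<xi>" "\<forall>\<eta>\<in>N. E \<eta> \<xi> \<longrightarrow> \<not> bad_min b \<eta>" using \<xi> unfolding first_bad_def by auto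
    have "\<not> E \<xi> \<zeta>" using \<zeta>(3) \<xi>'(2) by blast
    moreover have "\<not> E \<zeta> \<xi>" using \<xi>'(3) \<zeta>(2) Ni.ordinal_in[OF \<zeta>(1)] by blast
    ultimately show ?thesis using ordinal_linear[OF \<xi>'(1) \<zeta>(1)] by blast
  qed
  obtain x where x: "x \<in> N" "Ni.enum b \<zeta> x" "Ni.HK b x" "\<not> enum_M b \<zeta> x"
    using \<zeta>(2) unfolding bad_min_def bad_def by blast
  have min: "enum_M b \<eta> z" if z: "E z x" and \<eta>: "Ni.enum b \<eta> z" for \<eta> z
  proof -
    have "z \<in> N" "\<eta> \<in> N" using Ni.D_mem[OF x(1) z] Ni.enum_ordinal[OF \<eta>] Ni.ordinal_in by auto
    then have "\<not> bad b \<eta>" using \<zeta>(2) x(1,2) z \<eta> unfolding bad_min_def by blast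
    then show ?thesis using \<eta> \<open>z \<in> N\<close> Ni.HK_mem[OF x(3) z] unfolding bad_def by blast
  qed
  have zM: "\<zeta> \<in> M" using Mi.ordinal_in[OF \<zeta>(1)] .
  obtain x1 where x1: "enum_M b \<zeta> x1" using enum_M_value[OF zM, of x] x(2) \<zeta>(4) by auto
  have x1M: "x1 \<in> M" using enum_M_in[OF x1] by blast
  have jx1: "j x1 = x" using enum_M_fixed[OF x1 \<zeta>(4)] Ni.enum_unique x(2) by blast
  \<comment> \<open>The two values at the first bad name, \<open>x\<close> in \<open>N\<close> and
    \<open>y\<close> in \<open>M\<close>, are described from \<open>c\<close> alone, so that
    \<open>least_fixed\<close> applies to properties of names that mention them.\<close>
  let ?D = "\<lambda>c P \<eta>. \<exists>\<zeta>\<in>N. \<exists>x\<in>N. \<exists>y\<in>N. \<exists>z\<in>N. first_bad c \<zeta> \<and> Ni.enum c \<zeta> x \<and> enum_M c \<zeta> y \<and> P c \<eta> x y z"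
  have D: "?D b P \<eta> \<longleftrightarrow> (\<exists>z\<in>N. P b \<eta> x x1 z)" for P \<eta>
  proof
    assume "?D b P \<eta>"
    then obtain \<xi> u v z where u: "z \<in> N" "first_bad b \<xi>" "Ni.enum b \<xi> u" "enum_M b \<xi> v" "P b \<eta> u v z" by blast
    have "\<xi> = \<zeta>" using fb_unique[OF u(2)] .
    then have "u = x" "v = x1" using u(3,4) Ni.enum_unique[OF _ x(2)] enum_M_unique[OF _ x1] by auto
    then show "\<exists>z\<in>N. P b \<eta> x x1 z" using u by blast
  next
    assume "\<exists>z\<in>N. P b \<eta> x x1 z"
    then show "?D b P \<eta>" using fb x(1,2) x1 x1M M_N zM by blast
  qed
  \<comment> \<open>The least name of an element \<open>u\<close> of \<open>x\<close> outside
    \<open>x1\<close> is fixed by \<open>j\<close>. By minimality \<open>u\<close> has this name in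
    \<open>M\<close> too, so \<open>j u = u\<close>; as \<open>j x1 = x\<close>, this puts
    \<open>u\<close> into \<open>x1\<close>.\<close>
  have "E z x1" if z: "E z x" for z
  proof (rule ccontr)
    let ?P = "\<lambda>c \<eta> x y z. E z x \<and> \<not> E z y \<and> Ni.enum c \<eta> z"
    assume nz: "\<not> E z x1"
    have zN: "z \<in> N" using Ni.D_mem[OF x(1) z] .
    obtain \<eta> where \<eta>: "Ni.enum b \<eta> z" "ordinal E \<eta>" by (rule HK_name[OF Ni.HK_mem[OF x(3) z] zN])
    have fo: "fo_definable E N (\<lambda>e. ?D (e 1) ?P (e 0))"
      by (intro base_fo_intros Ni.fo.subst2[of first_bad, OF first_bad_fo])
    have D\<eta>: "?D b ?P \<eta>" by (rule D[of ?P, THEN iffD2]) (use z nz \<eta>(1) zN in blast)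
    have "\<exists>\<gamma>. ordinal E \<gamma> \<and> ?D b ?P \<gamma> \<and> (\<forall>\<delta>. E \<delta> \<gamma> \<longrightarrow> \<not> ?D b ?P \<delta>) \<and> j \<gamma> = \<gamma>"
      by (rule least_fixed[of "\<lambda>\<eta> c. ?D c ?P \<eta>", OF fo \<eta>(2) D\<eta>])
    then obtain \<gamma> where g: "?D b ?P \<gamma>" "j \<gamma> = \<gamma>" by (elim exE conjE) (rule that)
    from g(1) obtain u where u: "E u x" "\<not> E u x1" "Ni.enum b \<gamma> u" using D[of ?P \<gamma>, THEN iffD1] by blast
    have eu: "enum_M b \<gamma> u" by (rule min[OF u(1,3)])
    then have "j u = u" using enum_M_fixed[OF _ g(2)] Ni.enum_unique u(3) by blast
    then have "E (j u) (j x1)" using u(1) jx1 by simp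
    then show False using u(2) j_mem[OF _ x1M, of u] enum_M_in[OF eu] by blast
  qed
  \<comment> \<open>Now names in \<open>M\<close> are used, since an element of \<open>x1\<close>
    outside \<open>x\<close> is not known to be named in \<open>N\<close>. Its image
    \<open>j u\<close> has the same fixed name in \<open>N\<close> and lies in \<open>x\<close>;
    minimality gives it this name in \<open>M\<close> as well, whence
    \<open>j u = u\<close>.\<close>
  moreover have "E z x" if z: "E z x1" for z
  proof (rule ccontr)
    let ?P = "\<lambda>c \<eta> x y z. E z y \<and> \<not> E z x \<and> enum_M c \<eta> z"
    assume nz: "\<not> E z x"
    have zM: "z \<in> M" using Mi.D_mem[OF x1M z] .
    have jz: "E (j z) x" using j_mem[OF zM x1M] z jx1 by simp
    obtain \<eta>' where "Ni.enum b \<eta>' (j z)" by (rule HK_name[OF Ni.HK_mem[OF x(3) jz] j_in[OF zM]])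
    then obtain \<eta> where \<eta>: "enum_M b \<eta> z" using enum_M_name[OF zM] by blast
    have fo: "fo_definable E N (\<lambda>e. ?D (e 1) ?P (e 0))"
      by (intro base_fo_intros Ni.fo.subst2[of first_bad, OF first_bad_fo])
    have D\<eta>: "?D b ?P \<eta>" by (rule D[of ?P, THEN iffD2]) (use z nz \<eta>(1) zM M_N in blast)
    have "\<exists>\<gamma>. ordinal E \<gamma> \<and> ?D b ?P \<gamma> \<and> (\<forall>\<delta>. E \<delta> \<gamma> \<longrightarrow> \<not> ?D b ?P \<delta>) \<and> j \<gamma> = \<gamma>"
      by (rule least_fixed[of "\<lambda>\<eta> c. ?D c ?P \<eta>", OF fo enum_M_ordinal[OF \<eta>] D\<eta>])
    then obtain \<gamma> where g: "?D b ?P \<gamma>" "j \<gamma> = \<gamma>" by (elim exE conjE) (rule that)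
    from g(1) obtain u where u: "E u x1" "\<not> E u x" "enum_M b \<gamma> u" using D[of ?P \<gamma>, THEN iffD1] by blast
    have uM: "u \<in> M" using enum_M_in[OF u(3)] by blast
    have ju: "E (j u) x" using j_mem[OF uM x1M] u(1) jx1 by simp
    have "enum_M b \<gamma> (j u)" by (rule min[OF ju enum_M_fixed[OF u(3) g(2)]])
    then have "j u = u" using enum_M_unique[OF _ u(3)] by blast
    then show False using ju u(2) by simp
  qed
  ultimately have "x = x1" by (intro set_eqI) blast
  then show False using x(4) x1 by simp
qed

lemma enum_HK: assumes "Ni.enum b \<zeta> x" "Ni.HK b x" shows "enum_M b \<zeta> x"
  using not_bad[of \<zeta>] assms Ni.enum_in[OF assms(1)] unfolding bad_def by blast

theorem definable_class_eq:
  assumes A: "definable_class E N b \<phi> \<subseteq> HOD E \<C> N b"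
  shows "definable_class E M b \<phi> = definable_class E N b \<phi>"
proof -
  let ?A = "\<lambda>c x. sat E N (asg c [x]) \<phi>"
  have HK: "Ni.HK b x" if "x \<in> N" "?A b x" for x
    using A that Ni.HOD_iff unfolding definable_class_def by blast
  have AM: "sat E M (asg b [x]) \<phi> \<longleftrightarrow> ?A b (j x)" if "x \<in> M" for x
    using elementary[of "[x]" \<phi>] that by simp
  note fo_intros = base_fo_intros Ni.sat1_fo Ni.fo.subst2[of "class_M \<phi>", OF class_M_fo]
  have "x \<in> definable_class E M b \<phi>" if x: "x \<in> N" "?A b x" for x
  proof (rule ccontr)
    let ?R = "\<lambda>\<zeta> c. \<exists>x\<in>N. Ni.enum c \<zeta> x \<and> ?A c x \<and> \<not> class_M \<phi> c x"
    assume "x \<notin> definable_class E M b \<phi>"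
    then have nx: "\<not> class_M \<phi> b x" unfolding class_M definable_class_def by blast
    obtain \<zeta> where \<zeta>: "Ni.enum b \<zeta> x" "ordinal E \<zeta>" by (rule HK_name[OF HK[OF x] x(1)])
    have fo: "fo_definable E N (\<lambda>e. ?R (e 0) (e 1))" by (intro fo_intros)
    have R: "?R \<zeta> b" using x \<zeta> nx by blast
    have "\<exists>\<gamma>. ordinal E \<gamma> \<and> ?R \<gamma> b \<and> (\<forall>\<delta>. E \<delta> \<gamma> \<longrightarrow> \<not> ?R \<delta> b) \<and> j \<gamma> = \<gamma>"
      by (rule least_fixed[of ?R, OF fo \<zeta>(2) R])
    then obtain \<gamma> where g: "?R \<gamma> b" "j \<gamma> = \<gamma>" by (elim exE conjE) (rule that)
    from g(1) obtain y where y: "y \<in> N" "Ni.enum b \<gamma> y" "?A b y" "\<not> class_M \<phi> b y" by blast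
    have ey: "enum_M b \<gamma> y" by (rule enum_HK[OF y(2) HK[OF y(1,3)]])
    then have "j y = y" using enum_M_fixed[OF _ g(2)] Ni.enum_unique y(2) by blast
    then show False using y(3,4) AM[of y] enum_M_in[OF ey] unfolding class_M by simp
  qed
  moreover have "?A b x" if x: "x \<in> M" "sat E M (asg b [x]) \<phi>" for x
  proof (rule ccontr)
    let ?R = "\<lambda>\<zeta> c. \<exists>x\<in>N. enum_M c \<zeta> x \<and> class_M \<phi> c x \<and> \<not> ?A c x"
    assume nx: "\<not> ?A b x"
    \<comment> \<open>\<open>x\<close> is not yet known to be hereditarily ordinal definable in
      \<open>N\<close>. Its image lies in \<open>A\<close> and so has a name, which elementarity
      turns into a name of \<open>x\<close> in \<open>M\<close>.\<close>
    have "Ni.HK b (j x)" using HK[OF j_in[OF x(1)]] AM[OF x(1)] x(2) by blast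
    then obtain \<zeta>' where "Ni.enum b \<zeta>' (j x)" by (rule HK_name[OF _ j_in[OF x(1)]])
    then obtain \<zeta> where \<zeta>: "enum_M b \<zeta> x" using enum_M_name[OF x(1)] by blast
    have fo: "fo_definable E N (\<lambda>e. ?R (e 0) (e 1))" by (intro fo_intros)
    have R: "?R \<zeta> b" using x \<zeta> nx M_N class_M by blast
    have "\<exists>\<gamma>. ordinal E \<gamma> \<and> ?R \<gamma> b \<and> (\<forall>\<delta>. E \<delta> \<gamma> \<longrightarrow> \<not> ?R \<delta> b) \<and> j \<gamma> = \<gamma>"
      by (rule least_fixed[of ?R, OF fo enum_M_ordinal[OF \<zeta>] R])
    then obtain \<gamma> where g: "?R \<gamma> b" "j \<gamma> = \<gamma>" by (elim exE conjE) (rule that)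
    from g(1) obtain y where y: "enum_M b \<gamma> y" "class_M \<phi> b y" "\<not> ?A b y" by blast
    have yM: "y \<in> M" using enum_M_in[OF y(1)] by blast
    have jy: "?A b (j y)" using y(2) AM[OF yM] unfolding class_M by blast
    have "enum_M b \<gamma> (j y)"
      by (rule enum_HK[OF enum_M_fixed[OF y(1) g(2)] HK[OF j_in[OF yM] jy]])
    then have "j y = y" using enum_M_unique[OF _ y(1)] by blast
    then show False using jy y(3) by simp
  qed
  ultimately show ?thesis unfolding definable_class_def using M_N by blast
qed

end

theorem theorem24:
  fixes E :: "'v \<Rightarrow> 'v \<Rightarrow> bool" and \<C> :: "'v set set"
    and M N A :: "'v set" and j :: "'v \<Rightarrow> 'v" and b :: 'v and \<phi> :: fm
  assumes "NGB E \<C>"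
    and "inner_model E \<C> M" and "inner_model E \<C> N" and "M \<subseteq> N"
    and "elementary_embedding E \<C> j M N"
    and "b \<in> M" and "j b = b"
    and "\<exists>\<psi>. M = definable_class E N b \<psi>"
    and "A = definable_class E N b \<phi>"
  shows "(trcl_definably_well_ordered E \<C> N b A \<longleftrightarrow> A \<subseteq> HOD E \<C> N b) \<and>
    (trcl_definably_well_ordered E \<C> N b A \<or> A \<subseteq> HOD E \<C> N b \<longrightarrow>
      definable_class E M b \<phi> = definable_class E N b \<phi>)"
proof -
  obtain \<psi> where "M = definable_class E N b \<psi>" using assms(8) by blast
  then interpret embedding E \<C> M N j b \<psi>
    using assms by unfold_locales
  have "trcl_definably_well_ordered E \<C> N b A \<longleftrightarrow> A \<subseteq> HOD E \<C> N b"
    by (rule Ni.trcl_definably_well_ordered_iff[OF assms(9)])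
  then show ?thesis using definable_class_eq assms(9) by blast
qed

end
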